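(* Let $I$ be a Dixmier ideal in a $C^*$-algebra $A$. Then: (1) For every $s \in (0,\infty)$, $I^s$ is a Dixmier ideal with $(I^s)_+ = \{a^s : a \in I_+\}$. (2) $(I^s)^t = I^{st} = (I^t)^s$ for all $s,t \in (0,\infty)$. (3) $I^s I^t = I^{s+t}$ for all $s,t \in (0,\infty)$. In particular, $I^s \subseteq I^t$ whenever $s \geq t > 0$.
   Context: $C^*$-algebras are not assumed unital, and $A_+$ denotes the set of positive elements of $A$. An ideal in $A$ is an additive subgroup $I \subseteq A$ with $aI \cup Ia \subseteq I$ for all $a \in A$, not assumed norm-closed; put $I_+ := I \cap A_+$. An order ideal in $A_+$ is an additive submonoid $M \subseteq A_+$ such that $a,b \in A_+$, $a \leq b$ and $b \in M$ imply $a \in M$; it is strongly invariant if for all $x \in A$, $x^*x \in M$ if and only if $xx^* \in M$. A Dixmier ideal in $A$ is a two-sided ideal $I$ (not necessarily norm-closed) that is positively spanned ($I$ is the complex linear span of $I_+$), hereditary ($I_+$ is an order ideal), and such that $I_+$ is strongly invariant. For a Dixmier ideal $I$ and $s \in (0,\infty)$, $I^s$ is defined as the complex linear span of $\{a^s : a \in I_+\}$, where $a^s$ is given by functional calculus. For ideals $J,K$, $JK$ denotes the additive subgroup generated by $\{xy : x \in J, y \in K\}$. *)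

theory Defs
  imports "HOL-Analysis.Analysis"
begin

text \<open>No unit is required, and the zero algebra is allowed. The unit law
  \<open>1 *\<^sub>C x = x\<close> follows from compatibility with the real scalar multiplication, and
  submultiplicativity of the norm is part of the superclass.\<close>

class cstar_algebra = real_normed_algebra + banach +
  fixes scaleC :: "complex \<Rightarrow> 'a \<Rightarrow> 'a" (infixr "*\<^sub>C" 75)
    and star :: "'a \<Rightarrow> 'a"
  assumes scaleC_add_right: "c *\<^sub>C (x + y) = c *\<^sub>C x + c *\<^sub>C y"
    and scaleC_add_left: "(c + d) *\<^sub>C x = c *\<^sub>C x + d *\<^sub>C x"
    and scaleC_scaleC: "c *\<^sub>C d *\<^sub>C x = (c * d) *\<^sub>C x"
    and scaleR_scaleC: "r *\<^sub>R x = complex_of_real r *\<^sub>C x"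
    and mult_scaleC_left: "(c *\<^sub>C x) * y = c *\<^sub>C (x * y)"
    and mult_scaleC_right: "x * (c *\<^sub>C y) = c *\<^sub>C (x * y)"
    and norm_scaleC: "norm (c *\<^sub>C x) = cmod c * norm x"
    and star_star: "star (star x) = x"
    and star_add: "star (x + y) = star x + star y"
    and star_scaleC: "star (c *\<^sub>C x) = cnj c *\<^sub>C star x"
    and star_mult: "star (x * y) = star y * star x"
    and cstar_identity: "norm (star x * x) = (norm x)\<^sup>2"

global_interpretation complex_vector:
  vector_space "scaleC :: complex \<Rightarrow> 'a::cstar_algebra \<Rightarrow> 'a"
proof
  fix x :: 'a
  show "1 *\<^sub>C x = x"
    using scaleR_scaleC[of 1 x] by simp
qed (simp_all add: scaleC_add_right scaleC_add_left scaleC_scaleC)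

text \<open>Multiplication of the unitization \<open>A \<oplus> \<complex>\<close>, whose unit is \<open>(0, 1)\<close>;
  the pair \<open>(x, c)\<close> stands for \<open>x + c 1\<close>.\<close>

definition unitization_mult ::
    "'a::cstar_algebra \<times> complex \<Rightarrow> 'a \<times> complex \<Rightarrow> 'a \<times> complex" where
  "unitization_mult u v =
     (fst u * fst v + snd u *\<^sub>C fst v + snd v *\<^sub>C fst u, snd u * snd v)"

definition unitization_invertible :: "'a::cstar_algebra \<times> complex \<Rightarrow> bool" where
  "unitization_invertible u \<longleftrightarrow>
     (\<exists>v. unitization_mult u v = (0, 1) \<and> unitization_mult v u = (0, 1))"

text \<open>The unit is adjoined even if the algebra already has one, so \<open>0\<close> always belongs to
  this spectrum. Neither positivity nor the calculus for functions vanishing at \<open>0\<close>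
  depends on that convention.\<close>

definition cstar_spectrum :: "'a::cstar_algebra \<Rightarrow> complex set" where
  "cstar_spectrum a = {z. \<not> unitization_invertible (a, - z)}"

definition cstar_pos :: "'a::cstar_algebra set" where
  "cstar_pos = {a. star a = a \<and> (\<forall>z\<in>cstar_spectrum a. z \<in> \<real> \<and> 0 \<le> Re z)}"

definition cstar_le :: "'a::cstar_algebra \<Rightarrow> 'a \<Rightarrow> bool" where
  "cstar_le a b \<longleftrightarrow> b - a \<in> cstar_pos"

definition cfc_dom :: "'a::cstar_algebra \<Rightarrow> (complex \<Rightarrow> complex) set" where
  "cfc_dom a = {f. continuous_on (cstar_spectrum a) f \<and> f 0 = 0}"

text \<open>\<open>\<Phi>\<close> is the continuous functional calculus of \<open>a\<close>: an isometric *-homomorphism,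
  sending the identity function to \<open>a\<close>, from the continuous functions on the spectrum
  that vanish at \<open>0\<close>. Functions on the spectrum are represented by total functions; by the
  norm condition and linearity, \<open>\<Phi> f\<close> depends only on the restriction of \<open>f\<close>
  to the spectrum. On \<open>cfc_dom a\<close> such a \<open>\<Phi>\<close> is unique, and it exists for normal \<open>a\<close>.\<close>

definition is_cfc :: "'a::cstar_algebra \<Rightarrow> ((complex \<Rightarrow> complex) \<Rightarrow> 'a) \<Rightarrow> bool" where
  "is_cfc a \<Phi> \<longleftrightarrow>
     (\<forall>f\<in>cfc_dom a. \<forall>g\<in>cfc_dom a. \<Phi> (\<lambda>z. f z + g z) = \<Phi> f + \<Phi> g) \<and>
     (\<forall>c. \<forall>f\<in>cfc_dom a. \<Phi> (\<lambda>z. c * f z) = c *\<^sub>C \<Phi> f) \<and>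
     (\<forall>f\<in>cfc_dom a. \<forall>g\<in>cfc_dom a. \<Phi> (\<lambda>z. f z * g z) = \<Phi> f * \<Phi> g) \<and>
     (\<forall>f\<in>cfc_dom a. \<Phi> (\<lambda>z. cnj (f z)) = star (\<Phi> f)) \<and>
     (\<forall>f\<in>cfc_dom a. norm (\<Phi> f) = (SUP z\<in>cstar_spectrum a. cmod (f z))) \<and>
     \<Phi> (\<lambda>z. z) = a"

definition cfc :: "'a::cstar_algebra \<Rightarrow> (complex \<Rightarrow> complex) \<Rightarrow> 'a" where
  "cfc a = (SOME \<Phi>. is_cfc a \<Phi>)"

text \<open>Meaningful for positive \<open>a\<close> and \<open>s > 0\<close>; note \<open>0 powr s = 0\<close>.\<close>

definition cstar_powr :: "'a::cstar_algebra \<Rightarrow> real \<Rightarrow> 'a" where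
  "cstar_powr a s = cfc a (\<lambda>z. complex_of_real (Re z powr s))"

definition add_subgroup :: "'a::ab_group_add set \<Rightarrow> bool" where
  "add_subgroup H \<longleftrightarrow> 0 \<in> H \<and> (\<forall>x\<in>H. \<forall>y\<in>H. x + y \<in> H) \<and> (\<forall>x\<in>H. - x \<in> H)"

definition cstar_ideal :: "'a::cstar_algebra set \<Rightarrow> bool" where
  "cstar_ideal I \<longleftrightarrow> add_subgroup I \<and> (\<forall>a. \<forall>x\<in>I. a * x \<in> I \<and> x * a \<in> I)"

definition pos_part :: "'a::cstar_algebra set \<Rightarrow> 'a set" where
  "pos_part I = I \<inter> cstar_pos"

definition order_ideal :: "'a::cstar_algebra set \<Rightarrow> bool" where
  "order_ideal M \<longleftrightarrow> M \<subseteq> cstar_pos \<and> 0 \<in> M \<and> (\<forall>a\<in>M. \<forall>b\<in>M. a + b \<in> M) \<and>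
     (\<forall>a\<in>cstar_pos. \<forall>b\<in>cstar_pos. cstar_le a b \<longrightarrow> b \<in> M \<longrightarrow> a \<in> M)"

definition strongly_invariant :: "'a::cstar_algebra set \<Rightarrow> bool" where
  "strongly_invariant M \<longleftrightarrow> (\<forall>x. star x * x \<in> M \<longleftrightarrow> x * star x \<in> M)"

definition dixmier_ideal :: "'a::cstar_algebra set \<Rightarrow> bool" where
  "dixmier_ideal I \<longleftrightarrow> cstar_ideal I \<and> I = complex_vector.span (pos_part I) \<and>
     order_ideal (pos_part I) \<and> strongly_invariant (pos_part I)"

definition ideal_powr :: "'a::cstar_algebra set \<Rightarrow> real \<Rightarrow> 'a set" where
  "ideal_powr I s = complex_vector.span ((\<lambda>a. cstar_powr a s) ` pos_part I)"

definition ideal_prod :: "'a::cstar_algebra set \<Rightarrow> 'a set \<Rightarrow> 'a set" where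
  "ideal_prod J K = add_subgroup hull {x * y |x y. x \<in> J \<and> y \<in> K}"

end

theory Submission
  imports Defs "HOL-Computational_Algebra.Fundamental_Theorem_Algebra"
begin

text \<open>A Dixmier ideal is determined by its positive part, a strongly invariant order ideal, and the
  powers act on positive parts. So the point is that \<open>L\<^sub>r = {b \<ge> 0. b\<^sup>r \<in> M}\<close> is again a strongly
  invariant order ideal if \<open>M\<close> is one. As \<open>L\<^sub>r\<close> is multiplicative in \<open>r\<close>, the cases \<open>r = 2\<close> and
  \<open>r < 1\<close> suffice. For \<open>r = 2\<close>, if \<open>a \<le> b\<close> then \<open>a\<^sup>2 \<le> a\<^sup>1\<^sup>/\<^sup>2 b a\<^sup>1\<^sup>/\<^sup>2\<close>, which strong invariance exchanges for
  \<open>b\<^sup>1\<^sup>/\<^sup>2 a b\<^sup>1\<^sup>/\<^sup>2 \<le> b\<^sup>2\<close>. For \<open>r < 1\<close>, heredity is the Loewner-Heinz inequality; for sums put \<open>c = a + b\<close> and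
  let \<open>y\<close> be \<open>a\<^sup>1\<^sup>/\<^sup>2 c\<^sup>-\<^sup>(\<^sup>1\<^sup>-\<^sup>r\<^sup>)\<^sup>/\<^sup>2\<close>, a norm limit: then \<open>y y\<^sup>* \<le> a\<^sup>r\<close>, so \<open>y\<^sup>* y \<in> M\<close>, and \<open>c\<^sup>r\<close> is the sum of
  \<open>y\<^sup>* y\<close> and its analogue for \<open>b\<close>. For products, rescale to \<open>s + t = 1/2\<close> and bound \<open>x = a\<^sup>s b\<^sup>t\<close> with
  \<open>c = a + b\<close>: up to strong invariance \<open>x\<^sup>* x\<close> is dominated by \<open>c\<^sup>s c\<^sup>2\<^sup>t c\<^sup>s = c\<close>, and \<open>x\<close> factors as
  \<open>v (x\<^sup>* x)\<^sup>1\<^sup>/\<^sup>4\<close> with \<open>v\<^sup>* v = (x\<^sup>* x)\<^sup>1\<^sup>/\<^sup>2\<close>.\<close>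

section \<open>The unitization as a unital C*-algebra\<close>

text \<open>The ideals are not norm-closed, so membership is never passed to a limit. A limit only
  produces an element \<open>y\<close>; what passes to it is an order relation such as
  \<open>y * star y \<preceq> upow d r\<close>, or an exact formula for \<open>star y * y\<close>,
  and heredity and strong invariance do the rest. The exponent 2 is treated apart because squaring
  does not preserve the order of noncommuting positive elements, whereas exponents up to 1 do. In
  the product, the normalisation \<open>s + t = 1/2\<close> has two reasons: the exponents
  \<open>2 * s\<close> and \<open>2 * t\<close> in \<open>star x * x\<close> are then below 1, where
  powers are monotone, and they add up to 1, so that the bound is \<open>c\<close> itself, which is
  known to lie in the order ideal. Negative powers need a unit and the shift from \<open>t\<close>
  to \<open>t + e\<close>, hence the unitization; the way back is that an element \<open>u\<close>
  with \<open>star u * u\<close> in the algebra lies in the algebra itself.\<close>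

lemma star_zero [simp]: "star (0::'a::cstar_algebra) = 0"
  using star_add[of "0::'a" 0] by simp

lemma star_minus [simp]: "star (- x) = - star (x::'a::cstar_algebra)"
  using star_add[of x "-x"] by (simp add: eq_neg_iff_add_eq_0 add.commute)

lemma star_diff [simp]: "star (x - y) = star x - star (y::'a::cstar_algebra)"
  using star_add[of x "-y"] by simp

lemma star_scaleR [simp]: "star (r *\<^sub>R x) = r *\<^sub>R star (x::'a::cstar_algebra)"
  by (simp add: scaleR_scaleC star_scaleC)

declare star_star [simp] star_add [simp]

lemma norm_star [simp]: "norm (star x) = norm (x::'a::cstar_algebra)"
proof -
  have le: "norm y \<le> norm (star y)" for y :: 'a
  proof (cases "y = 0")
    case False
    have "norm y * norm y \<le> norm (star y) * norm y"
      using norm_mult_ineq[of "star y" y] by (simp add: cstar_identity power2_eq_square)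
    with False show ?thesis by simp
  qed simp
  from le[of x] le[of "star x"] show ?thesis by simp
qed

lemma norm_mult_star: "norm (x * star x) = (norm (x::'a::cstar_algebra))\<^sup>2"
  using cstar_identity[of "star x"] by simp

lemma bounded_linear_star: "bounded_linear (star :: 'a::cstar_algebra \<Rightarrow> 'a)"
  by (rule bounded_linear_intro[where K=1]) auto

lemmas tendsto_star [tendsto_intros] = bounded_linear.tendsto[OF bounded_linear_star]

lemma bounded_linear_scaleC: "bounded_linear (\<lambda>x::'a::cstar_algebra. c *\<^sub>C x)"
  by (rule bounded_linear_intro[where K="cmod c"])
    (auto simp: scaleR_scaleC scaleC_add_right scaleC_scaleC norm_scaleC mult.commute)

text \<open>The spectral theory lives in this class. The unit has norm 1 and so differs from
  \<open>0\<close>, which holds in the unitization of the zero algebra too.\<close>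

class unital_cstar_algebra = cstar_algebra + real_normed_algebra_1

text \<open>A type of its own, because pairs already carry the Euclidean norm of a product.\<close>

datatype 'a unitization = Unitization (alg_part: 'a) (scalar_part: complex)

lemma unitization_eqI:
  "alg_part u = alg_part v \<Longrightarrow> scalar_part u = scalar_part v \<Longrightarrow> u = v"
  by (cases u; cases v) simp

instantiation unitization :: (cstar_algebra) ring_1
begin

definition "0 = Unitization 0 0"
definition "1 = Unitization 0 1"
definition "u + v = Unitization (alg_part u + alg_part v) (scalar_part u + scalar_part v)"
definition "u - v = Unitization (alg_part u - alg_part v) (scalar_part u - scalar_part v)"
definition "- u = Unitization (- alg_part u) (- scalar_part u)"
definition "u * v = Unitization
  (alg_part u * alg_part v + scalar_part u *\<^sub>C alg_part v + scalar_part v *\<^sub>C alg_part u)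
  (scalar_part u * scalar_part v)"

instance
  by standard
    (auto simp: zero_unitization_def one_unitization_def plus_unitization_def
      minus_unitization_def uminus_unitization_def times_unitization_def algebra_simps
      scaleC_add_right scaleC_add_left scaleC_scaleC mult_scaleC_left mult_scaleC_right
      intro!: unitization_eqI)

end

lemma unitization_sel [simp]:
  "alg_part 0 = 0" "scalar_part 0 = 0" "alg_part 1 = 0" "scalar_part 1 = 1"
  "alg_part (u + v) = alg_part u + alg_part v" "scalar_part (u + v) = scalar_part u + scalar_part v"
  "alg_part (u - v) = alg_part u - alg_part v" "scalar_part (u - v) = scalar_part u - scalar_part v"
  "alg_part (- u) = - alg_part u" "scalar_part (- u) = - scalar_part u"
  "alg_part (u * v) = alg_part u * alg_part v + scalar_part u *\<^sub>C alg_part v + scalar_part v *\<^sub>C alg_part u"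
  "scalar_part (u * v) = scalar_part u * scalar_part v"
  for u v :: "'a::cstar_algebra unitization"
  by (simp_all add: zero_unitization_def one_unitization_def plus_unitization_def
      minus_unitization_def uminus_unitization_def times_unitization_def)

text \<open>The regular representation; its operator norm is the main ingredient of the norm on the
  unitization.\<close>

definition lmult :: "'a::cstar_algebra unitization \<Rightarrow> 'a \<Rightarrow> 'a" where
  "lmult u b = alg_part u * b + scalar_part u *\<^sub>C b"

lemma bounded_linear_lmult: "bounded_linear (lmult u)"
  unfolding lmult_def
  by (intro bounded_linear_add bounded_linear_scaleC bounded_linear_mult_right)

lemma lmult_add: "lmult (u + v) b = lmult u b + lmult v b"
  by (simp add: lmult_def algebra_simps scaleC_add_left)

lemma lmult_mult: "lmult (u * v) b = lmult u (lmult v b)"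
  by (simp add: lmult_def algebra_simps scaleC_add_right scaleC_scaleC mult_scaleC_left mult_scaleC_right)

lemma norm_lmult_le: "norm (lmult u b) \<le> onorm (lmult u) * norm b"
  by (rule onorm[OF bounded_linear_lmult])

text \<open>Testing on \<open>star a\<close> gives the lower bound, by the C*-identity for
  \<open>a * star a\<close>.\<close>

lemma onorm_lmult_alg: "onorm (lmult (Unitization a 0)) = norm a"
proof (rule antisym)
  show "onorm (lmult (Unitization a 0)) \<le> norm a"
    by (rule onorm_bound) (auto simp: lmult_def norm_mult_ineq)
  show "norm a \<le> onorm (lmult (Unitization a 0))"
  proof (cases "a = 0")
    case False
    have "norm a * norm a \<le> onorm (lmult (Unitization a 0)) * norm a"
      using norm_lmult_le[of "Unitization a 0" "star a"]
      by (simp add: lmult_def norm_mult_star power2_eq_square)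
    with False show ?thesis by simp
  qed (simp add: onorm_pos_le[OF bounded_linear_lmult])
qed

instantiation unitization :: (cstar_algebra) real_normed_algebra_1
begin

text \<open>The character \<open>scalar_part\<close> keeps the norm definite when the algebra already has a
  unit, in which case left multiplication alone is not faithful.\<close>

definition "norm u = max (cmod (scalar_part u)) (onorm (lmult u))"
definition "r *\<^sub>R u = Unitization (r *\<^sub>R alg_part u) (complex_of_real r * scalar_part u)"
  for u :: "'a unitization"
definition "dist u v = norm (u - v)" for u v :: "'a unitization"
definition "sgn u = inverse (norm u) *\<^sub>R u" for u :: "'a unitization"
definition "(uniformity :: ('a unitization \<times> 'a unitization) filter) =
  (INF e\<in>{0<..}. principal {(u, v). dist u v < e})"
definition "open (S :: 'a unitization set) \<longleftrightarrow>
  (\<forall>u\<in>S. eventually (\<lambda>(u', v). u' = u \<longrightarrow> v \<in> S) uniformity)"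

instance
proof
  fix u v :: "'a unitization" and r s :: real
  have lin: "bounded_linear (lmult w)" for w :: "'a unitization"
    by (rule bounded_linear_lmult)
  show "dist u v = norm (u - v)" "sgn u = inverse (norm u) *\<^sub>R u"
    by (simp_all add: dist_unitization_def sgn_unitization_def)
  show "(uniformity :: ('a unitization \<times> 'a unitization) filter) =
      (INF e\<in>{0<..}. principal {(u, v). dist u v < e})"
    by (rule uniformity_unitization_def)
  show "open S \<longleftrightarrow> (\<forall>u\<in>S. eventually (\<lambda>(u', v). u' = u \<longrightarrow> v \<in> S) uniformity)"
    for S :: "'a unitization set"
    by (rule open_unitization_def)
  show "r *\<^sub>R (u + v) = r *\<^sub>R u + r *\<^sub>R v" "(r + s) *\<^sub>R u = r *\<^sub>R u + s *\<^sub>R u"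
    "r *\<^sub>R s *\<^sub>R u = (r * s) *\<^sub>R u" "1 *\<^sub>R u = u"
    "r *\<^sub>R u * v = r *\<^sub>R (u * v)" "u * r *\<^sub>R v = r *\<^sub>R (u * v)"
    by (auto simp: scaleR_unitization_def algebra_simps scaleR_scaleC scaleC_scaleC
        scaleC_add_right intro!: unitization_eqI)
      (auto simp: mult_scaleC_left mult_scaleC_right scaleC_scaleC mult.commute)
  show "norm u = 0 \<longleftrightarrow> u = 0"
  proof
    assume "norm u = 0"
    then have sc: "scalar_part u = 0" and on: "onorm (lmult u) \<le> 0"
      unfolding norm_unitization_def
      by (metis max.cobounded1 norm_le_zero_iff, metis max.cobounded2)
    have "u = Unitization (alg_part u) 0"
      using sc by (metis unitization.collapse)
    then have "norm (alg_part u) \<le> 0"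
      using on onorm_lmult_alg by metis
    with sc show "u = 0" by (auto intro: unitization_eqI)
  next
    assume "u = 0"
    then have "lmult u = (\<lambda>b. 0)" by (auto simp: lmult_def)
    with \<open>u = 0\<close> show "norm u = 0" by (simp add: norm_unitization_def onorm_zero)
  qed
  have "onorm (lmult (u + v)) \<le> onorm (lmult u) + onorm (lmult v)"
    using onorm_triangle[OF lin[of u] lin[of v]] by (simp add: lmult_add[abs_def])
  then show "norm (u + v) \<le> norm u + norm v"
    using norm_triangle_ineq[of "scalar_part u" "scalar_part v"]
    unfolding norm_unitization_def by (auto simp: max_def)
  have "lmult (r *\<^sub>R u) = (\<lambda>b. r *\<^sub>R lmult u b)"
    by (auto simp: lmult_def scaleR_unitization_def scaleR_scaleC scaleC_add_right
        mult_scaleC_left scaleC_scaleC)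
  then have "onorm (lmult (r *\<^sub>R u)) = \<bar>r\<bar> * onorm (lmult u)"
    using onorm_scaleR[OF lin] by metis
  then show "norm (r *\<^sub>R u) = \<bar>r\<bar> * norm u"
    by (simp add: norm_unitization_def scaleR_unitization_def norm_mult max_mult_distrib_left)
  have "onorm (lmult (u * v)) \<le> onorm (lmult u) * onorm (lmult v)"
    using onorm_compose[OF lin[of u] lin[of v]] by (simp add: lmult_mult[abs_def] comp_def)
  also have "\<dots> \<le> norm u * norm v"
    by (intro mult_mono) (auto simp: norm_unitization_def onorm_pos_le[OF lin] le_max_iff_disj)
  finally show "norm (u * v) \<le> norm u * norm v"
    unfolding norm_unitization_def[of "u * v"]
    by (auto simp: norm_mult norm_unitization_def intro!: mult_mono simp: le_max_iff_disj)
  have "onorm (lmult (1 :: 'a unitization)) \<le> 1"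
    by (rule onorm_bound) (auto simp: lmult_def)
  then show "norm (1 :: 'a unitization) = 1"
    by (simp add: norm_unitization_def)
qed

end

lemma norm_scalar_part_le: "cmod (scalar_part u) \<le> norm u"
  by (simp add: norm_unitization_def)

lemma norm_Unitization_0 [simp]: "norm (Unitization a 0) = norm a"
  by (simp add: norm_unitization_def onorm_lmult_alg)

lemma norm_Unitization_le: "norm (Unitization a c) \<le> norm a + cmod c"
proof -
  have "onorm (lmult (Unitization a c)) \<le> norm a + cmod c"
    by (rule onorm_bound)
      (auto simp: lmult_def distrib_right norm_scaleC
        intro!: order_trans[OF norm_triangle_ineq] add_mono norm_mult_ineq)
  then show ?thesis by (simp add: norm_unitization_def)
qed

text \<open>Together with \<open>norm_Unitization_le\<close>, this makes the norm equivalent to the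
  sum of the norms of the two components, so completeness is inherited from them.\<close>

lemma norm_alg_part_le: "norm (alg_part u) \<le> 2 * norm u"
proof -
  have "Unitization (alg_part u) 0 = u - Unitization 0 (scalar_part u)"
    by (auto intro: unitization_eqI)
  then have "norm (alg_part u) \<le> norm u + norm (Unitization (0::'a) (scalar_part u))"
    by (metis norm_Unitization_0 norm_triangle_ineq4)
  also have "norm (Unitization (0::'a) (scalar_part u)) \<le> cmod (scalar_part u)"
    using norm_Unitization_le[of "0::'a" "scalar_part u"] by simp
  finally show ?thesis using norm_scalar_part_le[of u] by simp
qed

instance unitization :: (cstar_algebra) banach
proof
  fix X :: "nat \<Rightarrow> 'a unitization"
  assume X: "Cauchy X"
  have "Cauchy (\<lambda>n. scalar_part (X n))"
  proof (rule CauchyI)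
    fix e :: real assume "0 < e"
    then obtain N where "\<forall>m\<ge>N. \<forall>n\<ge>N. norm (X m - X n) < e"
      using CauchyD[OF X] by blast
    then show "\<exists>M. \<forall>m\<ge>M. \<forall>n\<ge>M. cmod (scalar_part (X m) - scalar_part (X n)) < e"
      by (metis norm_scalar_part_le order_le_less_trans unitization_sel(8))
  qed
  moreover have "Cauchy (\<lambda>n. alg_part (X n))"
  proof (rule CauchyI)
    fix e :: real assume "0 < e"
    then obtain N where N: "\<forall>m\<ge>N. \<forall>n\<ge>N. norm (X m - X n) < e / 2"
      using CauchyD[OF X, of "e/2"] by auto
    have "norm (alg_part (X m) - alg_part (X n)) < e" if "m \<ge> N" "n \<ge> N" for m n
      using N that norm_alg_part_le[of "X m - X n"] by fastforce
    then show "\<exists>M. \<forall>m\<ge>M. \<forall>n\<ge>M. norm (alg_part (X m) - alg_part (X n)) < e" by blast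
  qed
  ultimately obtain a c where lim: "(\<lambda>n. alg_part (X n)) \<longlonglongrightarrow> a" "(\<lambda>n. scalar_part (X n)) \<longlonglongrightarrow> c"
    by (meson Cauchy_convergent convergent_def)
  have "(\<lambda>n. norm (alg_part (X n) - a) + cmod (scalar_part (X n) - c)) \<longlonglongrightarrow> 0"
    using lim by (intro tendsto_add_zero tendsto_norm_zero LIM_zero)
  then have "(\<lambda>n. norm (X n - Unitization a c)) \<longlonglongrightarrow> 0"
  proof (rule Lim_null_comparison[rotated], intro always_eventually allI)
    fix n
    have "X n - Unitization a c = Unitization (alg_part (X n) - a) (scalar_part (X n) - c)"
      by (auto intro: unitization_eqI)
    then show "norm (norm (X n - Unitization a c)) \<le> norm (alg_part (X n) - a) + cmod (scalar_part (X n) - c)"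
      using norm_Unitization_le by simp
  qed
  then show "convergent X"
    unfolding convergent_def by (metis LIM_zero_cancel tendsto_norm_zero_iff)
qed

instantiation unitization :: (cstar_algebra) cstar_algebra
begin

definition "c *\<^sub>C u = Unitization (c *\<^sub>C alg_part u) (c * scalar_part u)"
definition "star u = Unitization (star (alg_part u)) (cnj (scalar_part u))"

instance
proof
  fix u v :: "'a unitization" and c d :: complex and r :: real
  show "c *\<^sub>C (u + v) = c *\<^sub>C u + c *\<^sub>C v" "(c + d) *\<^sub>C u = c *\<^sub>C u + d *\<^sub>C u"
    "c *\<^sub>C d *\<^sub>C u = (c * d) *\<^sub>C u" "r *\<^sub>R u = complex_of_real r *\<^sub>C u"
    "(c *\<^sub>C u) * v = c *\<^sub>C (u * v)" "u * (c *\<^sub>C v) = c *\<^sub>C (u * v)"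
    "star (star u) = u" "star (u + v) = star u + star v"
    "star (c *\<^sub>C u) = cnj c *\<^sub>C star u"
    by (auto simp: scaleC_unitization_def star_unitization_def scaleR_unitization_def algebra_simps
        scaleR_scaleC scaleC_scaleC scaleC_add_right scaleC_add_left mult_scaleC_left
        mult_scaleC_right star_scaleC intro!: unitization_eqI)
  show star_mult: "star (u * v) = star v * star u" for u v :: "'a unitization"
    by (auto simp: star_unitization_def star_mult star_scaleC algebra_simps intro!: unitization_eqI)
  have "lmult (c *\<^sub>C u) = (\<lambda>b. c *\<^sub>C lmult u b)"
    by (auto simp: lmult_def scaleC_unitization_def scaleC_add_right mult_scaleC_left scaleC_scaleC)
  then have "onorm (lmult (c *\<^sub>C u)) = onorm (\<lambda>b. cmod c *\<^sub>R lmult u b)"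
    by (simp add: onorm_def norm_scaleC)
  also have "\<dots> = cmod c * onorm (lmult u)"
    using onorm_scaleR[OF bounded_linear_lmult[of u], of "cmod c"] by simp
  finally have "onorm (lmult (c *\<^sub>C u)) = cmod c * onorm (lmult u)" .
  then show "norm (c *\<^sub>C u) = cmod c * norm u"
    by (simp add: norm_unitization_def scaleC_unitization_def norm_mult max_mult_distrib_left)
  have star_adj: "star (lmult w b) * x = star b * lmult (star w) x" for w :: "'a unitization" and b x
    by (simp add: lmult_def star_unitization_def star_mult star_scaleC algebra_simps
        mult_scaleC_left mult_scaleC_right Defs.star_mult)
  \<comment> \<open>\<open>star b * c\<close> serves as an inner product with values in the algebra:
    \<open>star_adj\<close> makes \<open>star w\<close> the adjoint of \<open>w\<close>, and the
    argument is the one for operators on a Hilbert space.\<close>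
  have sq: "(onorm (lmult w))\<^sup>2 \<le> onorm (lmult (star w * w))" for w :: "'a unitization"
  proof -
    have pos: "0 \<le> onorm (lmult (star w * w))"
      by (rule onorm_pos_le[OF bounded_linear_lmult])
    have "onorm (lmult w) \<le> sqrt (onorm (lmult (star w * w)))"
    proof (rule onorm_bound)
      fix b
      have "(norm (lmult w b))\<^sup>2 = norm (star b * lmult (star w * w) b)"
        by (simp add: cstar_identity[symmetric] star_adj lmult_mult)
      also have "\<dots> \<le> norm b * (onorm (lmult (star w * w)) * norm b)"
        by (rule order_trans[OF norm_mult_ineq]) (simp add: mult_left_mono norm_lmult_le)
      also have "\<dots> = (sqrt (onorm (lmult (star w * w))) * norm b)\<^sup>2"
        using pos by (simp add: power_mult_distrib power2_eq_square)
      finally show "norm (lmult w b) \<le> sqrt (onorm (lmult (star w * w))) * norm b"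
        by (rule power2_le_imp_le) (simp add: pos)
    qed (simp add: pos)
    then show ?thesis
      using pos by (metis onorm_pos_le[OF bounded_linear_lmult] power_mono real_sqrt_pow2)
  qed
  have prod: "onorm (lmult (v * w)) \<le> onorm (lmult v) * onorm (lmult w)" for v w :: "'a unitization"
    using onorm_compose[OF bounded_linear_lmult[of v] bounded_linear_lmult[of w]]
    by (simp add: lmult_mult[abs_def] comp_def)
  have le: "onorm (lmult w) \<le> onorm (lmult (star w))" for w :: "'a unitization"
    using order_trans[OF sq[of w] prod[of "star w" w]] onorm_pos_le[OF bounded_linear_lmult[of w]]
      onorm_pos_le[OF bounded_linear_lmult[of "star w"]]
    by (cases "onorm (lmult w) = 0") (auto simp: power2_eq_square)
  have "star (star u) = u" by (auto simp: star_unitization_def)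
  then have "onorm (lmult (star u)) = onorm (lmult u)"
    using le[of u] le[of "star u"] by simp
  then have "onorm (lmult (star u * u)) = (onorm (lmult u))\<^sup>2"
    using sq[of u] prod[of "star u" u] by (simp add: power2_eq_square)
  moreover have "cmod (scalar_part (star u * u)) = (cmod (scalar_part u))\<^sup>2"
    by (simp add: star_unitization_def norm_mult power2_eq_square)
  moreover have "max (x\<^sup>2) (y\<^sup>2) = (max x y)\<^sup>2" if "0 \<le> x" "0 \<le> y" for x y :: real
    using that by (auto simp: max_def power2_le_iff_abs_le abs_le_square_iff[symmetric])
  ultimately show "norm (star u * u) = (norm u)\<^sup>2"
    unfolding norm_unitization_def using onorm_pos_le[OF bounded_linear_lmult[of u]] by simp
qed

end

instance unitization :: (cstar_algebra) unital_cstar_algebra ..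

section \<open>Spectrum and spectral radius\<close>

definition has_inverse :: "'a::monoid_mult \<Rightarrow> bool" where
  "has_inverse x \<longleftrightarrow> (\<exists>y. x * y = 1 \<and> y * x = 1)"

lemma has_inverseI: "x * y = 1 \<Longrightarrow> y * x = 1 \<Longrightarrow> has_inverse x"
  unfolding has_inverse_def by blast

lemma has_inverseI2:
  assumes "x * y = 1" "z * x = 1"
  shows "has_inverse x"
proof -
  have "z = z * (x * y)" using assms by simp
  also have "\<dots> = (z * x) * y" by (simp only: mult.assoc)
  also have "\<dots> = y" using assms by simp
  finally show ?thesis using assms has_inverseI by blast
qed

lemma has_inverse_mult:
  assumes "has_inverse x" "has_inverse y"
  shows "has_inverse (x * y)"
proof -
  obtain x' y' where "x * x' = 1" "x' * x = 1" "y * y' = 1" "y' * y = 1"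
    using assms unfolding has_inverse_def by blast
  then have "x * y * (y' * x') = 1" "y' * x' * (x * y) = 1"
    by (metis mult.assoc mult_1_left)+
  then show ?thesis by (rule has_inverseI)
qed

lemma has_inverse_commuting_factor:
  assumes "x * y = y * x" "has_inverse (x * y)"
  shows "has_inverse x"
proof -
  obtain g where "x * y * g = 1" "g * (x * y) = 1"
    using assms(2) unfolding has_inverse_def by blast
  then have "x * (y * g) = 1" "(g * y) * x = 1"
    using assms(1) by (metis mult.assoc)+
  then show ?thesis by (rule has_inverseI2)
qed

text \<open>The inverse is suggested by the geometric series: formally, the sum of the powers of
  \<open>y * x\<close> is \<open>1 + y * g * x\<close>, where \<open>g\<close> is the sum of the
  powers of \<open>x * y\<close>.\<close>

lemma has_inverse_swap:
  fixes x y :: "'a::ring_1"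
  assumes "has_inverse (1 - x * y)"
  shows "has_inverse (1 - y * x)"
proof -
  obtain g where "(1 - x * y) * g = 1" "g * (1 - x * y) = 1"
    using assms unfolding has_inverse_def by blast
  then have g: "x * (y * g) = g - 1" "g * (x * y) = g - 1"
    by (simp_all add: algebra_simps)
  have "(1 - y * x) * (1 + y * (g * x)) = 1 - y * x + y * (g * x) - y * ((x * (y * g)) * x)"
    by (simp add: algebra_simps)
  also have "\<dots> = 1" unfolding g by (simp add: algebra_simps)
  finally have 1: "(1 - y * x) * (1 + y * (g * x)) = 1" .
  have "(1 + y * (g * x)) * (1 - y * x) = 1 - y * x + y * (g * x) - y * ((g * (x * y)) * x)"
    by (simp add: algebra_simps)
  also have "\<dots> = 1" unfolding g by (simp add: algebra_simps)
  finally show ?thesis using 1 has_inverseI by blast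
qed

lemma has_inverse_one_minus:
  fixes x :: "'a::{real_normed_algebra_1, banach}"
  assumes "norm x < 1"
  shows "has_inverse (1 - x)"
proof -
  have sum: "summable (\<lambda>n. x ^ n)"
    by (rule summable_comparison_test'[OF summable_geometric[of "norm x"]])
      (use assms norm_power_ineq in auto)
  have tail: "(\<Sum>n. x ^ Suc n) = (\<Sum>n. x ^ n) - 1"
    using suminf_split_head[OF sum] by simp
  have "x * (\<Sum>n. x ^ n) = (\<Sum>n. x ^ n) - 1"
    unfolding tail[symmetric] using suminf_mult[OF sum, of x] by simp
  moreover have "(\<Sum>n. x ^ n) * x = (\<Sum>n. x ^ n) - 1"
    unfolding tail[symmetric] using suminf_mult2[OF sum, of x] by (simp add: power_Suc2 del: power_Suc)
  ultimately show ?thesis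
    by (intro has_inverseI[of _ "\<Sum>n. x ^ n"]) (simp_all add: algebra_simps)
qed

lemma has_inverse_perturb:
  fixes x :: "'a::{real_normed_algebra_1, banach}"
  assumes "x * y = 1" "y * x = 1" "norm y * norm d < 1"
  shows "has_inverse (x - d)"
proof -
  have "x - d = x * (1 - y * d)"
    using assms by (simp add: algebra_simps mult.assoc[symmetric])
  moreover have "has_inverse (1 - y * d)"
    using assms norm_mult_ineq[of y d] by (intro has_inverse_one_minus) simp
  moreover have "has_inverse x" using assms has_inverseI by blast
  ultimately show ?thesis by (simp add: has_inverse_mult)
qed

lemma has_inverse_scaleC:
  fixes x :: "'a::unital_cstar_algebra"
  assumes "c \<noteq> 0"
  shows "has_inverse (c *\<^sub>C x) \<longleftrightarrow> has_inverse x"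
proof -
  have "has_inverse (c *\<^sub>C x)" if c: "c \<noteq> 0" and inv: "has_inverse x" for c and x :: 'a
  proof -
    obtain y where "x * y = 1" "y * x = 1" using inv unfolding has_inverse_def by blast
    then show ?thesis using c
      by (intro has_inverseI[of _ "(1/c) *\<^sub>C y"]) (simp_all add: mult_scaleC_left mult_scaleC_right scaleC_scaleC)
  qed
  from this[of c x] this[of "1/c" "c *\<^sub>C x"] assms show ?thesis
    by (auto simp: scaleC_scaleC)
qed

definition spec :: "'a::unital_cstar_algebra \<Rightarrow> complex set" where
  "spec x = {z. \<not> has_inverse (x - z *\<^sub>C 1)}"

lemma star_one [simp]: "star (1::'a::unital_cstar_algebra) = 1"
  by (metis mult_1_left mult_1_right star_mult star_star)

lemma norm_scaleC_one [simp]: "norm (c *\<^sub>C (1::'a::unital_cstar_algebra)) = cmod c"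
  by (simp add: norm_scaleC)

lemma norm_spec_le:
  assumes "z \<in> spec x"
  shows "cmod z \<le> norm x"
proof (rule ccontr)
  assume "\<not> cmod z \<le> norm x"
  then have "norm x < cmod z" and z: "z \<noteq> 0" by auto
  then have "norm ((1/z) *\<^sub>C x) < 1" by (simp add: norm_scaleC norm_divide field_simps)
  then have "has_inverse ((- z) *\<^sub>C (1 - (1/z) *\<^sub>C x))"
    using has_inverse_one_minus z has_inverse_scaleC[of "-z"] by fastforce
  moreover have "(- z) *\<^sub>C (1 - (1/z) *\<^sub>C x) = x - z *\<^sub>C 1"
    using z by (simp add: complex_vector.scale_right_diff_distrib scaleC_scaleC)
  ultimately show False using assms by (simp add: spec_def)
qed

lemma compact_spec: "compact (spec (x::'a::unital_cstar_algebra))"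
proof -
  have "open (- spec x)"
    unfolding open_contains_ball
  proof
    fix z assume "z \<in> - spec x"
    then obtain y where y: "(x - z *\<^sub>C 1) * y = 1" "y * (x - z *\<^sub>C 1) = 1"
      by (auto simp: spec_def has_inverse_def)
    have y0: "0 < norm y" using y by auto
    have shift: "x - z *\<^sub>C 1 - (w - z) *\<^sub>C 1 = x - w *\<^sub>C 1" for w
      by (simp add: complex_vector.scale_left_diff_distrib)
    have "w \<in> - spec x" if "w \<in> ball z (1 / norm y)" for w
    proof -
      have "norm y * cmod (w - z) < 1"
        using y0 that by (simp add: dist_norm field_simps norm_minus_commute[of z])
      then have "has_inverse (x - z *\<^sub>C 1 - (w - z) *\<^sub>C 1)"
        by (intro has_inverse_perturb[OF y]) (simp only: norm_scaleC_one)
      then show ?thesis unfolding shift by (simp add: spec_def)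
    qed
    with y0 show "\<exists>e>0. ball z e \<subseteq> - spec x" by (intro exI[of _ "1 / norm y"]) auto
  qed
  then have "closed (spec x)" by (simp add: closed_def)
  moreover have "bounded (spec x)" using norm_spec_le bounded_iff by blast
  ultimately show ?thesis by (simp add: compact_eq_bounded_closed)
qed

lemma spec_mult_swap:
  assumes "z \<in> spec (x * y)" "z \<noteq> 0"
  shows "z \<in> spec (y * x)"
proof -
  have iff: "z \<in> spec (a * b) \<longleftrightarrow> \<not> has_inverse (1 - ((1/z) *\<^sub>C a) * b)" for a b :: 'a
  proof -
    have "a * b - z *\<^sub>C 1 = (- z) *\<^sub>C (1 - ((1/z) *\<^sub>C a) * b)"
      using assms(2) by (simp add: complex_vector.scale_right_diff_distrib scaleC_scaleC mult_scaleC_left)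
    then show ?thesis
      using assms(2) has_inverse_scaleC[of "- z" "1 - ((1/z) *\<^sub>C a) * b"] unfolding spec_def by auto
  qed
  show ?thesis
    using assms has_inverse_swap[of "(1/z) *\<^sub>C y" x]
    by (auto simp: iff mult_scaleC_right mult_scaleC_left)
qed

text \<open>Averaging the resolvent over a sign change squares the element; iterating this replaces
  the contour integral in the usual proof of the spectral radius formula.\<close>

lemma inverse_average:
  fixes x :: "'a::real_algebra_1"
  assumes "(1 - x) * g = 1" "g * (1 - x) = 1" "(1 + x) * h = 1" "h * (1 + x) = 1"
  shows "(1 - x * x) * ((1/2) *\<^sub>R (g + h)) = 1" "((1/2) *\<^sub>R (g + h)) * (1 - x * x) = 1"
proof -
  have f: "1 - x * x = (1 + x) * (1 - x)" "1 - x * x = (1 - x) * (1 + x)"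
    by (simp_all add: algebra_simps)
  have "(1 - x * x) * g = 1 + x"
    unfolding f(1) using assms(1) by (simp only: mult.assoc mult_1_right)
  moreover have "(1 - x * x) * h = 1 - x"
    unfolding f(2) using assms(3) by (simp only: mult.assoc mult_1_right)
  moreover have "g * (1 - x * x) = 1 + x"
    unfolding f(2) using assms(2) by (simp only: mult.assoc[symmetric] mult_1_left)
  moreover have "h * (1 - x * x) = 1 - x"
    unfolding f(1) using assms(4) by (simp only: mult.assoc[symmetric] mult_1_left)
  ultimately show "(1 - x * x) * ((1/2) *\<^sub>R (g + h)) = 1" "((1/2) *\<^sub>R (g + h)) * (1 - x * x) = 1"
    by (simp_all add: distrib_left distrib_right scaleR_2[symmetric] mult_2[symmetric])
qed

lemma resolvent_continuous:
  fixes b :: "'a::unital_cstar_algebra"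
  assumes "\<And>w. w \<in> S \<Longrightarrow> F w * (1 - w *\<^sub>C b) = 1 \<and> (1 - w *\<^sub>C b) * F w = 1"
  shows "continuous_on S F"
  unfolding continuous_on_iff
proof (intro ballI allI impI)
  fix w and e :: real assume w: "w \<in> S" and e: "0 < e"
  let ?K = "norm b * norm (F w)"
  have res: "F v - F w = (v - w) *\<^sub>C (F v * b * F w)" if "v \<in> S" for v
  proof -
    have "F v - F w = F v * ((1 - w *\<^sub>C b) * F w) - (F v * (1 - v *\<^sub>C b)) * F w"
      using assms[OF w] assms[OF that] by simp
    also have "\<dots> = F v * ((1 - w *\<^sub>C b) - (1 - v *\<^sub>C b)) * F w"
      by (simp add: algebra_simps)
    also have "\<dots> = (v - w) *\<^sub>C (F v * b * F w)"
      by (simp add: complex_vector.scale_left_diff_distrib mult_scaleC_left mult_scaleC_right algebra_simps)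
    finally show ?thesis .
  qed
  have le: "norm (F v - F w) \<le> cmod (v - w) * norm (F v) * ?K" if "v \<in> S" for v
  proof -
    have "norm (F v * b * F w) \<le> norm (F v) * norm b * norm (F w)"
      by (meson norm_mult_ineq mult_right_mono norm_ge_zero order_trans)
    then show ?thesis by (simp add: res[OF that] norm_scaleC mult_left_mono mult.assoc)
  qed
  \<comment> \<open>The first bound gives \<open>norm (F v) \<le> 2 * norm (F w)\<close>; with it
    the second controls the resolvent identity \<open>res\<close>. The added constants keep the
    denominators positive when \<open>?K = 0\<close>.\<close>
  define d where "d = min (1 / (2 * ?K + 2)) (e / (2 * norm (F w) * ?K + 1))"
  have K0: "0 \<le> ?K" by simp
  have d: "0 < d" unfolding d_def using e K0 by (simp add: add_nonneg_pos)
  have "dist (F v) (F w) < e" if v: "v \<in> S" and dv: "dist v w < d" for v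
  proof -
    have vw: "cmod (v - w) * (2 * ?K + 2) \<le> 1" "cmod (v - w) * (2 * norm (F w) * ?K + 1) < e"
      using dv K0 unfolding d_def dist_norm by (simp_all add: pos_less_divide_eq add_nonneg_pos)
    have "norm (F v) \<le> norm (F w) + norm (F v - F w)"
      by (metis norm_triangle_sub)
    also have "norm (F v - F w) \<le> norm (F v) * (1 / 2)"
    proof -
      have "cmod (v - w) * ?K \<le> 1 / 2" using vw(1) by (simp add: algebra_simps) (smt (verit) norm_ge_zero)
      then show ?thesis using le[OF v] mult_left_mono[of "cmod (v - w) * ?K" "1/2" "norm (F v)"]
        by (simp add: algebra_simps)
    qed
    finally have Fv: "norm (F v) \<le> 2 * norm (F w)" by simp
    have "norm (F v - F w) \<le> cmod (v - w) * (2 * norm (F w)) * ?K"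
      using le[OF v] Fv by (meson K0 mult_left_mono mult_right_mono norm_ge_zero order_trans)
    also have "\<dots> \<le> cmod (v - w) * (2 * norm (F w) * ?K + 1)" by (simp add: algebra_simps)
    also have "\<dots> < e" by (rule vw(2))
    finally show ?thesis by (simp add: dist_norm)
  qed
  with d show "\<exists>d>0. \<forall>v\<in>S. dist v w < d \<longrightarrow> dist (F v) (F w) < e" by blast
qed

text \<open>Otherwise the resolvent is uniformly continuous on the closed disc, so its values at
  \<open>u\<close> and \<open>u * \<rho>\<close> are uniformly close for \<open>cmod u = 1\<close>,
  and averaging keeps them close for the elements \<open>b ^ 2 ^ k\<close>. For large
  \<open>k\<close> the damping factor \<open>\<rho> ^ 2 ^ k\<close> is tiny, so both resolvents are
  near \<open>1\<close>; but then \<open>b ^ 2 ^ k\<close> is small, against its norm being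
  1.\<close>

lemma resolvent_singular_in_unit_disc:
  fixes b :: "'a::unital_cstar_algebra"
  assumes norm1: "\<And>k. norm (b ^ (2 ^ k)) = 1"
  shows "\<exists>w. cmod w \<le> 1 \<and> \<not> has_inverse (1 - w *\<^sub>C b)"
proof (rule ccontr)
  assume "\<not> ?thesis"
  then have "\<forall>w\<in>cball 0 1. \<exists>y. y * (1 - w *\<^sub>C b) = 1 \<and> (1 - w *\<^sub>C b) * y = 1"
    unfolding has_inverse_def by (metis mem_cball_0)
  then obtain F where F: "\<And>w. w \<in> cball 0 1 \<Longrightarrow> F w * (1 - w *\<^sub>C b) = 1 \<and> (1 - w *\<^sub>C b) * F w = 1"
    by metis
  have "uniformly_continuous_on (cball 0 1) F"
    by (intro compact_uniformly_continuous resolvent_continuous[OF F]) auto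
  then obtain d where d: "0 < d"
    "\<And>v w. v \<in> cball 0 1 \<Longrightarrow> w \<in> cball 0 1 \<Longrightarrow> dist w v < d \<Longrightarrow> dist (F w) (F v) < 1/8"
    unfolding uniformly_continuous_on_def by (metis zero_less_divide_1_iff zero_less_numeral)
  define \<rho> where "\<rho> = max 0 (1 - d / 2)"
  have \<rho>: "0 \<le> \<rho>" "\<rho> < 1" "1 - \<rho> < d" using d(1) by (auto simp: \<rho>_def)
  \<comment> \<open>The point \<open>u\<close> stays arbitrary, as the step from \<open>k\<close> to
    \<open>Suc k\<close> averages over both square roots of \<open>u\<close>.\<close>
  have step: "\<exists>G H. (1 - u *\<^sub>C b ^ 2 ^ k) * G = 1 \<and> G * (1 - u *\<^sub>C b ^ 2 ^ k) = 1 \<and>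
      (1 - (u * \<rho> ^ 2 ^ k) *\<^sub>C b ^ 2 ^ k) * H = 1 \<and> H * (1 - (u * \<rho> ^ 2 ^ k) *\<^sub>C b ^ 2 ^ k) = 1 \<and>
      norm (G - H) \<le> 1/8" if "cmod u = 1" for u k
    using that
  proof (induction k arbitrary: u)
    case 0
    have "u \<in> cball 0 1" "u * \<rho> \<in> cball 0 1"
      using 0 \<rho> by (auto simp: dist_norm norm_mult)
    moreover have "u - u * \<rho> = u * complex_of_real (1 - \<rho>)" by (simp add: algebra_simps)
    then have "dist u (u * \<rho>) < d"
      using 0 \<rho> by (simp only: dist_norm norm_mult norm_of_real) simp
    ultimately show ?case using F d(2) by (intro exI[of _ "F u"] exI[of _ "F (u * \<rho>)"])
      (simp add: dist_norm less_imp_le)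
  next
    case (Suc k)
    define c where "c = b ^ 2 ^ k"
    have cc: "b ^ 2 ^ Suc k = c * c" unfolding c_def by (simp only: power_add[symmetric] power_Suc mult_2)
    define v where "v = csqrt u"
    have v: "v * v = u" by (simp add: v_def power2_eq_square[symmetric])
    have v1: "cmod v = 1" using Suc.prems by (simp add: v_def)
    then have v2: "cmod (- v) = 1" by simp
    obtain G1 H1 where 1: "(1 - v *\<^sub>C c) * G1 = 1" "G1 * (1 - v *\<^sub>C c) = 1"
      "(1 - (v * \<rho> ^ 2 ^ k) *\<^sub>C c) * H1 = 1" "H1 * (1 - (v * \<rho> ^ 2 ^ k) *\<^sub>C c) = 1"
      "norm (G1 - H1) \<le> 1/8"
      using Suc.IH[OF v1] unfolding c_def by blast
    obtain G2 H2 where 2: "(1 + v *\<^sub>C c) * G2 = 1" "G2 * (1 + v *\<^sub>C c) = 1"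
      "(1 + (v * \<rho> ^ 2 ^ k) *\<^sub>C c) * H2 = 1" "H2 * (1 + (v * \<rho> ^ 2 ^ k) *\<^sub>C c) = 1"
      "norm (G2 - H2) \<le> 1/8"
      using Suc.IH[OF v2] unfolding c_def by (auto simp: complex_vector.scale_minus_left)
    have x1: "v *\<^sub>C c * v *\<^sub>C c = u *\<^sub>C b ^ 2 ^ Suc k"
      by (simp only: cc mult_scaleC_left mult_scaleC_right scaleC_scaleC v)
    have "\<rho> ^ 2 ^ Suc k = \<rho> ^ 2 ^ k * \<rho> ^ 2 ^ k" by (simp add: power_add[symmetric] mult_2)
    then have "v * \<rho> ^ 2 ^ k * (v * \<rho> ^ 2 ^ k) = u * \<rho> ^ 2 ^ Suc k"
      by (simp add: v[symmetric])
    then have x2: "(v * \<rho> ^ 2 ^ k) *\<^sub>C c * (v * \<rho> ^ 2 ^ k) *\<^sub>C c = (u * \<rho> ^ 2 ^ Suc k) *\<^sub>C b ^ 2 ^ Suc k"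
      by (simp only: cc mult_scaleC_left mult_scaleC_right scaleC_scaleC)
    have "(1/2) *\<^sub>R (G1 + G2) - (1/2) *\<^sub>R (H1 + H2) = (1/2) *\<^sub>R ((G1 - H1) + (G2 - H2))"
      by (simp add: algebra_simps)
    then have "norm ((1/2) *\<^sub>R (G1 + G2) - (1/2) *\<^sub>R (H1 + H2)) \<le> 1/8"
      using norm_triangle_ineq[of "G1 - H1" "G2 - H2"] 1(5) 2(5) by simp
    with inverse_average[OF 1(1,2) 2(1,2)] inverse_average[OF 1(3,4) 2(3,4)]
    show ?case unfolding x1 x2 by blast
  qed
  \<comment> \<open>The constants fit together: \<open>norm (H - 1) \<le> norm H / 9\<close> gives
    \<open>norm (H - 1) \<le> 1/8\<close>, hence \<open>norm (G - 1) \<le> 1/4\<close> and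
    \<open>norm c \<le> 1/4 + norm c / 4\<close>, which is false for norm 1.\<close>
  obtain n where "\<rho> ^ n < 1/9"
    using real_arch_pow_inv[of "1/9" \<rho>] \<rho> by auto
  moreover have "\<rho> ^ 2 ^ n \<le> \<rho> ^ n"
    using \<rho> by (intro power_decreasing) (auto simp: less_imp_le)
  ultimately have small: "\<rho> ^ 2 ^ n \<le> 1/9" by simp
  define c where "c = b ^ 2 ^ n"
  obtain G H where G: "G * (1 - c) = 1" and H: "H * (1 - complex_of_real (\<rho> ^ 2 ^ n) *\<^sub>C c) = 1"
    and GH: "norm (G - H) \<le> 1/8"
    using step[of 1 n] by (auto simp: c_def)
  define x where "x = complex_of_real (\<rho> ^ 2 ^ n) *\<^sub>C c"
  have c1: "norm c = 1" by (simp add: c_def norm1)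
  have x: "norm x \<le> 1/9"
    using small \<rho> by (simp add: x_def norm_scaleC c1 norm_power)
  have H1: "H - 1 = H * x" using H unfolding x_def[symmetric] by (simp add: algebra_simps)
  have "norm (H - 1) \<le> norm H * norm x" unfolding H1 by (rule norm_mult_ineq)
  also have "\<dots> \<le> norm H * (1/9)" using x by (intro mult_left_mono) auto
  finally have "norm (H - 1) \<le> 1/8"
    using norm_triangle_ineq[of "H - 1" 1] by simp
  then have G1: "norm (G - 1) \<le> 1/4"
    using GH norm_triangle_ineq[of "G - H" "H - 1"] by simp
  have "c = (G - 1) - (G - 1) * c" using G by (simp add: algebra_simps)
  from arg_cong[OF this, of norm] have "norm c \<le> norm (G - 1) + norm (G - 1) * norm c"
    using norm_triangle_ineq4[of "G - 1" "(G - 1) * c"] norm_mult_ineq[of "G - 1" c] by linarith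
  with c1 G1 show False by simp
qed

lemma star_power: "star (x ^ n) = star (x::'a::unital_cstar_algebra) ^ n"
  by (induction n) (simp_all add: star_mult power_commutes)

lemma norm_power_selfadjoint:
  assumes "star (b::'a::unital_cstar_algebra) = b"
  shows "norm (b ^ 2 ^ k) = norm b ^ 2 ^ k"
proof (induction k)
  case (Suc k)
  have "star (b ^ 2 ^ k) = b ^ 2 ^ k" using assms by (simp add: star_power)
  then have "norm (b ^ 2 ^ k * b ^ 2 ^ k) = (norm (b ^ 2 ^ k))\<^sup>2" by (metis cstar_identity)
  then show ?case using Suc by (simp add: power_add[symmetric] mult_2 power2_eq_square)
qed simp

text \<open>Scaled to norm 1, the element keeps all its powers with exponent \<open>2 ^ k\<close> at
  norm 1 by the C*-identity, so the resolvent must fail at some \<open>w\<close> in the unit disc;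
  \<open>norm b / w\<close> is then in the spectrum and has modulus at least
  \<open>norm b\<close>.\<close>

lemma spec_norm_attained:
  assumes sa: "star (b::'a::unital_cstar_algebra) = b"
  obtains z where "z \<in> spec b" "cmod z = norm b"
proof (cases "b = 0")
  case True
  then have "0 \<in> spec b" by (simp add: spec_def has_inverse_def)
  with True that show thesis by force
next
  case False
  define b' where "b' = complex_of_real (1 / norm b) *\<^sub>C b"
  have "star b' = b'" using sa by (simp add: b'_def star_scaleC)
  moreover have "norm b' = 1" using False by (simp add: b'_def norm_scaleC norm_divide)
  ultimately obtain w where w: "cmod w \<le> 1" "\<not> has_inverse (1 - w *\<^sub>C b')"
    using resolvent_singular_in_unit_disc[of b'] norm_power_selfadjoint[of b'] by auto
  have w0: "w \<noteq> 0" using w(2) by (auto simp: has_inverse_def)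
  define z where "z = norm b / w"
  have z0: "z \<noteq> 0" using False w0 by (simp add: z_def)
  have "b - z *\<^sub>C 1 = (- z) *\<^sub>C (1 - w *\<^sub>C b')"
    using False w0 by (simp add: b'_def z_def complex_vector.scale_right_diff_distrib scaleC_scaleC)
  then have z: "z \<in> spec b"
    using w(2) z0 has_inverse_scaleC[of "- z" "1 - w *\<^sub>C b'"] unfolding spec_def by auto
  have "norm b \<le> cmod z"
    using w w0 by (simp add: z_def norm_divide pos_le_divide_eq mult_left_le)
  with norm_spec_le[OF z] z that show thesis by force
qed

lemma spec_shift: "z \<in> spec x \<Longrightarrow> z + c \<in> spec (x + c *\<^sub>C 1)"
  by (simp add: spec_def scaleC_add_left)

text \<open>Arens' trick: after adding \<open>\<i> * t\<close>, the square of the norm has grown by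
  at most \<open>t\<^sup>2\<close>, while the squared modulus of the shifted spectral point contains
  the term \<open>2 * Im z * t\<close>, which is unbounded in \<open>t\<close> unless
  \<open>Im z = 0\<close>.\<close>

lemma spec_selfadjoint_real:
  assumes sa: "star (x::'a::unital_cstar_algebra) = x" and z: "z \<in> spec x"
  shows "z \<in> \<real>"
proof -
  have bound: "2 * Im z * t \<le> (norm x)\<^sup>2" for t :: real
  proof -
    let ?y = "x + (\<i> * t) *\<^sub>C 1"
    have "star ?y * ?y = x * x + complex_of_real (t\<^sup>2) *\<^sub>C 1"
      using sa by (simp add: star_scaleC algebra_simps mult_scaleC_left mult_scaleC_right scaleC_scaleC power2_eq_square)
    then have "(norm ?y)\<^sup>2 \<le> norm (x * x) + t\<^sup>2"
      by (metis cstar_identity norm_triangle_ineq norm_scaleC_one norm_of_real abs_of_nonneg zero_le_power2)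
    also have "norm (x * x) = (norm x)\<^sup>2" by (metis cstar_identity sa)
    finally have "(norm ?y)\<^sup>2 \<le> (norm x)\<^sup>2 + t\<^sup>2" .
    moreover have "(cmod (z + \<i> * t))\<^sup>2 \<le> (norm ?y)\<^sup>2"
      by (intro power_mono norm_spec_le spec_shift z) auto
    moreover have "(cmod (z + \<i> * t))\<^sup>2 = (Re z)\<^sup>2 + (Im z + t)\<^sup>2" by (simp add: cmod_power2)
    ultimately have "(Re z)\<^sup>2 + (Im z)\<^sup>2 + 2 * Im z * t \<le> (norm x)\<^sup>2"
      by (simp add: power2_sum)
    then show ?thesis by (smt (verit) zero_le_power2)
  qed
  have "Im z = 0"
  proof (rule ccontr)
    assume "Im z \<noteq> 0"
    then have "(norm x)\<^sup>2 + 1 \<le> (norm x)\<^sup>2"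
      using bound[of "((norm x)\<^sup>2 + 1) / (2 * Im z)"] by simp
    then show False by simp
  qed
  then show ?thesis by (simp add: complex_is_Real_iff)
qed

text \<open>Horner evaluation with scalar coefficients and an argument in the algebra, which
  \<open>poly\<close> cannot express since it takes both from one type.\<close>

definition peval :: "complex poly \<Rightarrow> 'a::unital_cstar_algebra \<Rightarrow> 'a" where
  "peval p x = fold_coeffs (\<lambda>c y. c *\<^sub>C 1 + x * y) p 0"

lemma peval_0 [simp]: "peval 0 x = 0"
  by (simp add: peval_def)

lemma peval_pCons [simp]: "peval (pCons c p) x = c *\<^sub>C 1 + x * peval p x"
  by (cases "p = 0 \<and> c = 0") (auto simp: peval_def)

lemma peval_add: "peval (p + q) x = peval p x + peval q x"
  by (induction p q rule: poly_induct2) (simp_all add: algebra_simps scaleC_add_left)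

lemma peval_smult: "peval (smult c p) x = c *\<^sub>C peval p x"
  by (induction p) (simp_all add: scaleC_add_right scaleC_scaleC mult_scaleC_right)

lemma peval_diff: "peval (p - q) x = peval p x - peval q x"
  using peval_add[of "p - q" q x] by (simp add: eq_diff_eq)

lemma peval_mult: "peval (p * q) x = peval p x * peval q x"
  by (induction p) (simp_all add: peval_add peval_smult algebra_simps mult_scaleC_left)

lemma peval_commute: "x * peval p x = peval p x * x"
proof (induction p)
  case (pCons c p)
  have "x * (x * peval p x) = x * peval p x * x" using pCons.IH by (metis mult.assoc)
  then show ?case by (simp add: distrib_left distrib_right mult_scaleC_left mult_scaleC_right)
qed simp

lemma peval_star:
  "star (x::'a::unital_cstar_algebra) = x \<Longrightarrow> peval (map_poly cnj p) x = star (peval p x)"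
  by (induction p) (simp_all add: map_poly_pCons star_scaleC star_mult peval_commute)

text \<open>One half of the spectral mapping theorem: \<open>p - [:poly p z:]\<close> has the factor
  \<open>[:-z, 1:]\<close>, and commuting factors of an invertible element are invertible.\<close>

lemma poly_mem_spec:
  assumes "z \<in> spec x"
  shows "poly p z \<in> spec (peval p x)"
proof -
  have "[:-z, 1:] dvd p - [:poly p z:]" by (simp add: poly_eq_0_iff_dvd[symmetric])
  then obtain q where q: "p - [:poly p z:] = [:-z, 1:] * q" by (auto simp: dvd_def)
  have "peval p x - poly p z *\<^sub>C 1 = (x - z *\<^sub>C 1) * peval q x"
    using arg_cong[OF q, of "\<lambda>p. peval p x"] by (simp only: peval_mult peval_diff) (simp add: complex_vector.scale_minus_left)
  moreover have "(x - z *\<^sub>C 1) * peval q x = peval q x * (x - z *\<^sub>C 1)"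
    by (simp add: algebra_simps peval_commute mult_scaleC_left mult_scaleC_right)
  ultimately have "has_inverse (peval p x - poly p z *\<^sub>C 1) \<Longrightarrow> has_inverse (x - z *\<^sub>C 1)"
    using has_inverse_commuting_factor by metis
  then show ?thesis using assms by (auto simp: spec_def)
qed

text \<open>The other half: over the complex numbers \<open>p\<close> splits into linear factors,
  each of them invertible at \<open>x\<close>.\<close>

lemma has_inverse_peval:
  assumes "p \<noteq> 0" "\<And>z. z \<in> spec x \<Longrightarrow> poly p z \<noteq> 0"
  shows "has_inverse (peval p x)"
  using assms
proof (induction "degree p" arbitrary: p)
  case 0
  then obtain c where "p = [:c:]" "c \<noteq> 0" by (metis degree_eq_zeroE pCons_0_0)
  moreover have "has_inverse (1::'a)" by (simp add: has_inverse_def)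
  ultimately show ?case using has_inverse_scaleC[of c "1::'a"] by simp
next
  case (Suc n)
  have "\<not> constant (poly p)" using Suc.hyps(2) by (simp add: constant_degree)
  then obtain z where "poly p z = 0" using fundamental_theorem_of_algebra by blast
  then obtain q where q: "p = [:-z, 1:] * q" and z: "z \<notin> spec x"
    using Suc.prems(2) by (auto simp: poly_eq_0_iff_dvd dvd_def)
  have "q \<noteq> 0" using q Suc.prems by auto
  then have "degree p = Suc (degree q)" unfolding q by (subst degree_mult_eq) auto
  then have "has_inverse (peval q x)"
    using Suc q \<open>q \<noteq> 0\<close> by (intro Suc.hyps(1)) auto
  moreover have "has_inverse (peval [:-z, 1:] x)" using z by (simp add: spec_def complex_vector.scale_minus_left)
  ultimately show ?case unfolding q peval_mult by (rule has_inverse_mult[rotated])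
qed

text \<open>The constant polynomial is a case of its own, because its value is attained on
  \<open>spec x\<close> only if there is a point in it.\<close>

lemma spec_peval:
  assumes "w \<in> spec (peval p x)"
  obtains z where "z \<in> spec x" "w = poly p z" | "p = [:w:]"
proof -
  have "\<not> has_inverse (peval (p - [:w:]) x)"
    using assms by (simp add: spec_def peval_diff)
  then have "p - [:w:] = 0 \<or> (\<exists>z\<in>spec x. poly (p - [:w:]) z = 0)"
    using has_inverse_peval by blast
  then show thesis using that by auto
qed

text \<open>\<open>peval p x\<close> need not be selfadjoint, but
  \<open>star (peval p x) * peval p x\<close> is, and it is again a polynomial in \<open>x\<close>,
  since conjugating the coefficients yields the adjoint.\<close>

lemma norm_peval_attained:
  assumes sa: "star (x::'a::unital_cstar_algebra) = x"
  obtains z where "z \<in> spec x" "cmod (poly p z) = norm (peval p x)"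
proof -
  let ?q = "map_poly cnj p * p"
  have q: "peval ?q x = star (peval p x) * peval p x"
    by (simp add: peval_mult peval_star[OF sa])
  have "star (peval ?q x) = peval ?q x" unfolding q by (simp add: star_mult)
  then obtain w where w: "w \<in> spec (peval ?q x)" "cmod w = norm (peval ?q x)"
    by (rule spec_norm_attained)
  \<comment> \<open>Some point of the spectrum is required in case \<open>?q\<close> is
    constant.\<close>
  obtain z0 where z0: "z0 \<in> spec x" using spec_norm_attained[OF sa] by blast
  have "\<exists>z\<in>spec x. w = poly ?q z"
    using spec_peval[OF w(1)] z0 by (metis mult_zero_right add_0_right poly_0 poly_pCons)
  then obtain z where z: "z \<in> spec x" "w = poly ?q z" by blast
  have "cmod w = (cmod (poly p z))\<^sup>2"
    using spec_selfadjoint_real[OF sa z(1)]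
    by (simp add: z Reals_cnj_iff norm_mult power2_eq_square)
  then have "(cmod (poly p z))\<^sup>2 = (norm (peval p x))\<^sup>2" using w(2) q by (simp add: cstar_identity)
  then have "cmod (poly p z) = norm (peval p x)" by simp
  with z that show thesis by blast
qed

lemma norm_poly_le_norm_peval: "z \<in> spec x \<Longrightarrow> cmod (poly p z) \<le> norm (peval p x)"
  by (intro norm_spec_le poly_mem_spec)

section \<open>Continuous functional calculus\<close>

lemma uniform_poly_approximation:
  fixes S :: "complex set"
  assumes S: "compact S" "S \<subseteq> \<real>" and f: "continuous_on S f"
  obtains P where "uniform_limit S (\<lambda>n. poly (P n)) f sequentially"
proof -
  have re: "of_real (Re z) = z" if "z \<in> S" for z :: complex
    using S(2) that by (auto simp: subset_iff)
  have "\<exists>p. \<forall>z\<in>S. cmod (poly p z - f z) < e" if e: "0 < e" for e :: real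
  proof -
    have "(\<lambda>r. complex_of_real r) ` Re ` S = S" using re by force
    then have "continuous_on (Re ` S) (\<lambda>r. f (of_real r))"
      using f continuous_on_compose2[of S f "Re ` S" complex_of_real] by (simp add: continuous_on_of_real_id)
    moreover have "compact (Re ` S)"
      using S(1) by (intro compact_continuous_image continuous_intros)
    ultimately obtain q where q: "polynomial_function q"
      "\<And>r. r \<in> Re ` S \<Longrightarrow> norm (f (of_real r) - q r) < e"
      using Stone_Weierstrass_polynomial_function[of "Re ` S" "\<lambda>r. f (of_real r)" e] e by blast
    have "real_polynomial_function (\<lambda>r. Re (q r))" "real_polynomial_function (\<lambda>r. Im (q r))"
      using q(1) bounded_linear_Re bounded_linear_Im unfolding polynomial_function_def comp_def by blast+
    then obtain a n b m where "(\<lambda>r. Re (q r)) = (\<lambda>r. \<Sum>i\<le>n. a i * r ^ i)"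
      "(\<lambda>r. Im (q r)) = (\<lambda>r. \<Sum>i\<le>m. b i * r ^ i)"
      unfolding real_polynomial_function_iff_sum by blast
    then have ab: "\<And>r. Re (q r) = (\<Sum>i\<le>n. a i * r ^ i)" "\<And>r. Im (q r) = (\<Sum>i\<le>m. b i * r ^ i)"
      by (simp_all add: fun_eq_iff)
    define p where "p = (\<Sum>i\<le>n. monom (of_real (a i)) i) + smult \<i> (\<Sum>i\<le>m. monom (of_real (b i)) i)"
    have "poly p (of_real r) = q r" for r
    proof -
      have "poly p (of_real r) = of_real (Re (q r)) + \<i> * of_real (Im (q r))"
        by (simp add: p_def ab poly_sum poly_monom)
      then show ?thesis by (simp add: complex_eq_iff)
    qed
    then have "\<forall>z\<in>S. cmod (poly p z - f z) < e"
      using q(2) re by (metis imageI norm_minus_commute)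
    then show ?thesis by blast
  qed
  then have "\<forall>n. \<exists>p. \<forall>z\<in>S. cmod (poly p z - f z) < inverse (real (Suc n))" by simp
  then obtain P where P: "\<And>n z. z \<in> S \<Longrightarrow> cmod (poly (P n) z - f z) < inverse (real (Suc n))" by metis
  have "uniform_limit S (\<lambda>n. poly (P n)) f sequentially"
  proof (rule uniform_limitI)
    fix e :: real assume "0 < e"
    then have "\<forall>\<^sub>F n in sequentially. inverse (real (Suc n)) < e"
      by (rule order_tendstoD(2)[OF LIMSEQ_inverse_real_of_nat])
    then show "\<forall>\<^sub>F n in sequentially. \<forall>z\<in>S. dist (poly (P n) z) (f z) < e"
    proof eventually_elim
      case (elim n)
      then show ?case using P[of _ n] by (auto simp: dist_norm intro: less_trans)
    qed
  qed
  then show thesis by (rule that)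
qed

text \<open>The polynomial calculus extended by uniform limits. For selfadjoint \<open>x\<close> the
  limit does not depend on the approximating sequence, which \<open>fcalc_eqI\<close> shows; the
  choice is then harmless.\<close>

definition fcalc :: "'a::unital_cstar_algebra \<Rightarrow> (complex \<Rightarrow> complex) \<Rightarrow> 'a" where
  "fcalc x f = (SOME y. \<exists>P. uniform_limit (spec x) (\<lambda>n. poly (P n)) f sequentially \<and>
     (\<lambda>n. peval (P n) x) \<longlonglongrightarrow> y)"

lemma fcalc_cong:
  assumes "\<And>z. z \<in> spec x \<Longrightarrow> f z = g z"
  shows "fcalc x f = fcalc x g"
proof -
  have "uniform_limit (spec x) h f sequentially \<longleftrightarrow> uniform_limit (spec x) h g sequentially"
    for h :: "nat \<Rightarrow> complex \<Rightarrow> complex"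
    using assms by (intro uniform_limit_cong) auto
  then show ?thesis by (simp add: fcalc_def)
qed

context
  fixes x :: "'a::unital_cstar_algebra"
  assumes sa: "star x = x"
begin

lemma norm_peval_le: "(\<And>z. z \<in> spec x \<Longrightarrow> cmod (poly p z) \<le> c) \<Longrightarrow> norm (peval p x) \<le> c"
  by (metis norm_peval_attained[OF sa])

lemma peval_diff_tendsto_0:
  assumes "uniform_limit (spec x) (\<lambda>n. poly (P n)) f sequentially"
    "uniform_limit (spec x) (\<lambda>n. poly (Q n)) f sequentially"
  shows "(\<lambda>n. peval (P n) x - peval (Q n) x) \<longlonglongrightarrow> 0"
proof (rule LIMSEQ_I)
  fix e :: real assume e: "0 < e"
  have "uniform_limit (spec x) (\<lambda>n z. poly (P n) z - poly (Q n) z) (\<lambda>z. f z - f z) sequentially"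
    by (intro uniform_limit_intros assms)
  from uniform_limitD[OF this, of "e/2"] e
  have "\<forall>\<^sub>F n in sequentially. \<forall>z\<in>spec x. cmod (poly (P n - Q n) z) < e/2" by simp
  then have "\<forall>\<^sub>F n in sequentially. norm (peval (P n) x - peval (Q n) x) \<le> e/2"
    by eventually_elim (unfold peval_diff[symmetric], rule norm_peval_le, rule less_imp_le, blast)
  then show "\<exists>N. \<forall>n\<ge>N. norm (peval (P n) x - peval (Q n) x - 0) < e"
    using e unfolding eventually_sequentially by fastforce
qed

lemma peval_convergent:
  assumes "uniform_limit (spec x) (\<lambda>n. poly (P n)) f sequentially"
  shows "convergent (\<lambda>n. peval (P n) x)"
proof -
  have "Cauchy (\<lambda>n. peval (P n) x)"
  proof (rule CauchyI)
    fix e :: real assume e: "0 < e"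
    then obtain N where N: "\<And>n z. n \<ge> N \<Longrightarrow> z \<in> spec x \<Longrightarrow> cmod (poly (P n) z - f z) < e/4"
      using uniform_limitD[OF assms, of "e/4"] unfolding eventually_sequentially dist_norm by auto
    have "norm (peval (P m) x - peval (P n) x) < e" if "m \<ge> N" "n \<ge> N" for m n
    proof -
      have "norm (peval (P m - P n) x) \<le> e/2"
      proof (rule norm_peval_le)
        fix z assume "z \<in> spec x"
        then show "cmod (poly (P m - P n) z) \<le> e/2"
          using N[OF that(1)] N[OF that(2)] norm_triangle_ineq4[of "poly (P m) z - f z" "poly (P n) z - f z"]
          by fastforce
      qed
      then show ?thesis using e by (simp add: peval_diff)
    qed
    then show "\<exists>M. \<forall>m\<ge>M. \<forall>n\<ge>M. norm (peval (P m) x - peval (P n) x) < e" by blast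
  qed
  then show ?thesis by (rule Cauchy_convergent)
qed

lemma spec_real_subset: "spec x \<subseteq> \<real>"
  using spec_selfadjoint_real[OF sa] by blast

lemma fcalc_eqI:
  assumes "uniform_limit (spec x) (\<lambda>n. poly (P n)) f sequentially" "(\<lambda>n. peval (P n) x) \<longlonglongrightarrow> y"
  shows "fcalc x f = y"
  unfolding fcalc_def
proof (rule some_equality)
  fix y' assume "\<exists>P. uniform_limit (spec x) (\<lambda>n. poly (P n)) f sequentially \<and> (\<lambda>n. peval (P n) x) \<longlonglongrightarrow> y'"
  then obtain Q where Q: "uniform_limit (spec x) (\<lambda>n. poly (Q n)) f sequentially" "(\<lambda>n. peval (Q n) x) \<longlonglongrightarrow> y'"
    by blast
  have "(\<lambda>n. peval (P n) x - peval (Q n) x) \<longlonglongrightarrow> y - y'"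
    using assms Q by (intro tendsto_diff)
  then show "y' = y"
    using peval_diff_tendsto_0[OF assms(1) Q(1)] LIMSEQ_unique by fastforce
qed (use assms in blast)

lemma fcalc_approx:
  assumes "continuous_on (spec x) f"
  obtains P where "uniform_limit (spec x) (\<lambda>n. poly (P n)) f sequentially"
    "(\<lambda>n. peval (P n) x) \<longlonglongrightarrow> fcalc x f"
proof -
  obtain P where P: "uniform_limit (spec x) (\<lambda>n. poly (P n)) f sequentially"
    using uniform_poly_approximation[OF compact_spec spec_real_subset assms] by blast
  then obtain y where "(\<lambda>n. peval (P n) x) \<longlonglongrightarrow> y"
    using peval_convergent unfolding convergent_def by blast
  with P that show thesis using fcalc_eqI by blast
qed

lemma fcalc_poly: "fcalc x (poly p) = peval p x"
  by (rule fcalc_eqI[where P="\<lambda>_. p"]) (auto intro: uniform_limitI)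

lemma fcalc_id: "fcalc x (\<lambda>z. z) = x"
proof -
  have "(\<lambda>z. z) = poly [:0, 1 :: complex:]" by auto
  then show ?thesis by (simp only: fcalc_poly) simp
qed

lemma fcalc_const: "fcalc x (\<lambda>z. c) = c *\<^sub>C 1"
proof -
  have "(\<lambda>z. c) = poly [:c:]" by auto
  then show ?thesis by (simp only: fcalc_poly) simp
qed

lemma fcalc_add:
  assumes "continuous_on (spec x) f" "continuous_on (spec x) g"
  shows "fcalc x (\<lambda>z. f z + g z) = fcalc x f + fcalc x g"
proof -
  obtain P where P: "uniform_limit (spec x) (\<lambda>n. poly (P n)) f sequentially"
    "(\<lambda>n. peval (P n) x) \<longlonglongrightarrow> fcalc x f" using fcalc_approx[OF assms(1)] .
  obtain Q where Q: "uniform_limit (spec x) (\<lambda>n. poly (Q n)) g sequentially"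
    "(\<lambda>n. peval (Q n) x) \<longlonglongrightarrow> fcalc x g" using fcalc_approx[OF assms(2)] .
  show ?thesis
  proof (rule fcalc_eqI[where P="\<lambda>n. P n + Q n"])
    show "uniform_limit (spec x) (\<lambda>n. poly (P n + Q n)) (\<lambda>z. f z + g z) sequentially"
      using uniform_limit_add[OF P(1) Q(1)] by (simp add: poly_add[abs_def] fun_eq_iff)
  qed (auto simp: peval_add intro: tendsto_add P Q)
qed

lemma fcalc_mult:
  assumes "continuous_on (spec x) f" "continuous_on (spec x) g"
  shows "fcalc x (\<lambda>z. f z * g z) = fcalc x f * fcalc x g"
proof -
  obtain P where P: "uniform_limit (spec x) (\<lambda>n. poly (P n)) f sequentially"
    "(\<lambda>n. peval (P n) x) \<longlonglongrightarrow> fcalc x f" using fcalc_approx[OF assms(1)] .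
  obtain Q where Q: "uniform_limit (spec x) (\<lambda>n. poly (Q n)) g sequentially"
    "(\<lambda>n. peval (Q n) x) \<longlonglongrightarrow> fcalc x g" using fcalc_approx[OF assms(2)] .
  show ?thesis
  proof (rule fcalc_eqI[where P="\<lambda>n. P n * Q n"])
    have "bounded (f ` spec x)" "bounded (g ` spec x)"
      by (intro compact_imp_bounded compact_continuous_image assms compact_spec)+
    then show "uniform_limit (spec x) (\<lambda>n. poly (P n * Q n)) (\<lambda>z. f z * g z) sequentially"
      using uniform_lim_mult[OF P(1) Q(1)] by (simp add: poly_mult[abs_def])
  qed (auto simp: peval_mult intro: tendsto_mult P Q)
qed

lemma fcalc_scaleC:
  assumes "continuous_on (spec x) f"
  shows "fcalc x (\<lambda>z. c * f z) = c *\<^sub>C fcalc x f"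
  using fcalc_mult[of "\<lambda>_. c" f] assms by (simp add: fcalc_const mult_scaleC_left)

lemma fcalc_diff:
  assumes "continuous_on (spec x) f" "continuous_on (spec x) g"
  shows "fcalc x (\<lambda>z. f z - g z) = fcalc x f - fcalc x g"
  using fcalc_add[of "\<lambda>z. f z - g z" g] assms by (simp add: eq_diff_eq continuous_on_diff)

lemma fcalc_cnj:
  assumes "continuous_on (spec x) f"
  shows "fcalc x (\<lambda>z. cnj (f z)) = star (fcalc x f)"
proof -
  obtain P where P: "uniform_limit (spec x) (\<lambda>n. poly (P n)) f sequentially"
    "(\<lambda>n. peval (P n) x) \<longlonglongrightarrow> fcalc x f" using fcalc_approx[OF assms(1)] .
  show ?thesis
  proof (rule fcalc_eqI[where P="\<lambda>n. map_poly cnj (P n)"])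
    have "uniform_limit (spec x) (\<lambda>n z. cnj (poly (P n) z)) (\<lambda>z. cnj (f z)) sequentially"
      by (rule bounded_linear.uniform_limit[OF bounded_linear_cnj P(1)])
    moreover have "poly (map_poly cnj (P n)) z = cnj (poly (P n) z)" if "z \<in> spec x" for n z
      using spec_real_subset that by (auto simp: Reals_cnj_iff subset_iff)
    ultimately show "uniform_limit (spec x) (\<lambda>n. poly (map_poly cnj (P n))) (\<lambda>z. cnj (f z)) sequentially"
      by (subst uniform_limit_cong) auto
    show "(\<lambda>n. peval (map_poly cnj (P n)) x) \<longlonglongrightarrow> star (fcalc x f)"
      using P(2) by (simp add: peval_star[OF sa] tendsto_star)
  qed
qed

lemma norm_fcalc_le:
  assumes "continuous_on (spec x) f" "\<And>z. z \<in> spec x \<Longrightarrow> cmod (f z) \<le> c"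
  shows "norm (fcalc x f) \<le> c"
proof (rule field_le_epsilon)
  fix e :: real assume e: "0 < e"
  obtain P where P: "uniform_limit (spec x) (\<lambda>n. poly (P n)) f sequentially"
    "(\<lambda>n. peval (P n) x) \<longlonglongrightarrow> fcalc x f" using fcalc_approx[OF assms(1)] .
  have "\<forall>\<^sub>F n in sequentially. norm (peval (P n) x) \<le> c + e"
    using uniform_limitD[OF P(1) e]
  proof eventually_elim
    case (elim n)
    show ?case
    proof (rule norm_peval_le)
      fix z assume "z \<in> spec x"
      then show "cmod (poly (P n) z) \<le> c + e"
        using elim assms(2)[of z] norm_triangle_sub[of "poly (P n) z" "f z"] by (fastforce simp: dist_norm)
    qed
  qed
  then show "norm (fcalc x f) \<le> c + e"
    by (intro tendsto_upperbound[OF tendsto_norm[OF P(2)]]) auto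
qed

lemma norm_le_norm_fcalc:
  assumes "continuous_on (spec x) f" "z \<in> spec x"
  shows "cmod (f z) \<le> norm (fcalc x f)"
proof -
  obtain P where P: "uniform_limit (spec x) (\<lambda>n. poly (P n)) f sequentially"
    "(\<lambda>n. peval (P n) x) \<longlonglongrightarrow> fcalc x f" using fcalc_approx[OF assms(1)] .
  have "(\<lambda>n. cmod (poly (P n) z)) \<longlonglongrightarrow> cmod (f z)"
    using tendsto_uniform_limitI[OF P(1) assms(2)] by (rule tendsto_norm)
  moreover have "(\<lambda>n. norm (peval (P n) x)) \<longlonglongrightarrow> norm (fcalc x f)" using P(2) by (rule tendsto_norm)
  ultimately show ?thesis
    by (rule LIMSEQ_le) (auto intro: norm_poly_le_norm_peval assms(2))
qed

lemma fcalc_tendsto: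
  assumes "uniform_limit (spec x) F f sequentially" "\<And>n::nat. continuous_on (spec x) (F n)"
    "continuous_on (spec x) f"
  shows "(\<lambda>n. fcalc x (F n)) \<longlonglongrightarrow> fcalc x f"
proof (rule LIMSEQ_I)
  fix e :: real assume e: "0 < e"
  have "\<forall>\<^sub>F n in sequentially. norm (fcalc x (F n) - fcalc x f) \<le> e/2"
    using uniform_limitD[OF assms(1) half_gt_zero[OF e]]
  proof eventually_elim
    case (elim n)
    then show ?case
      unfolding fcalc_diff[OF assms(2,3), symmetric]
      by (intro norm_fcalc_le continuous_on_diff assms) (auto simp: dist_norm intro: less_imp_le)
  qed
  then show "\<exists>N. \<forall>n\<ge>N. norm (fcalc x (F n) - fcalc x f) < e"
    using e unfolding eventually_sequentially by fastforce
qed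

lemma spec_fcalc_subset:
  assumes f: "continuous_on (spec x) f"
  shows "spec (fcalc x f) \<subseteq> f ` spec x"
proof
  fix w assume w: "w \<in> spec (fcalc x f)"
  show "w \<in> f ` spec x"
  proof (rule ccontr)
    assume ne: "w \<notin> f ` spec x"
    let ?h = "\<lambda>z. 1 / (f z - w)"
    have h: "continuous_on (spec x) ?h"
      using ne by (intro continuous_intros f) auto
    have g: "continuous_on (spec x) (\<lambda>z. f z - w)" by (intro continuous_intros f)
    have eq: "fcalc x f - w *\<^sub>C 1 = fcalc x (\<lambda>z. f z - w)"
      using f by (simp add: fcalc_diff fcalc_const)
    have 1: "fcalc x (\<lambda>z. 1) = 1" by (simp add: fcalc_const)
    have "fcalc x (\<lambda>z. (f z - w) * ?h z) = 1" "fcalc x (\<lambda>z. ?h z * (f z - w)) = 1"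
      using ne by (subst 1[symmetric], intro fcalc_cong, force)+
    then have "has_inverse (fcalc x f - w *\<^sub>C 1)"
      unfolding eq fcalc_mult[OF g h] fcalc_mult[OF h g] by (rule has_inverseI)
    with w show False by (simp add: spec_def)
  qed
qed

lemma peval_fcalc:
  assumes f: "continuous_on (spec x) f"
  shows "peval p (fcalc x f) = fcalc x (\<lambda>z. poly p (f z))"
proof (induction p)
  case (pCons c p)
  have "continuous_on (spec x) (\<lambda>z. poly p (f z))" by (intro continuous_intros f)
  then show ?case using pCons f by (simp add: fcalc_add fcalc_const fcalc_mult continuous_on_mult)
qed (simp add: fcalc_const)

end

lemma star_fcalc:
  assumes "star x = x" "continuous_on (spec x) f" "\<And>z. z \<in> spec x \<Longrightarrow> f z \<in> \<real>"
  shows "star (fcalc x f) = fcalc x f"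
  unfolding fcalc_cnj[OF assms(1,2), symmetric]
  using assms(3) by (intro fcalc_cong) (auto simp: Reals_cnj_iff)

lemma fcalc_fcalc:
  assumes sa: "star x = x" and f: "continuous_on (spec x) f" "\<And>z. z \<in> spec x \<Longrightarrow> f z \<in> \<real>"
    and g: "continuous_on (f ` spec x) g"
  shows "fcalc (fcalc x f) g = fcalc x (\<lambda>z. g (f z))"
proof -
  \<comment> \<open>The image contains the spectrum of \<open>fcalc x f\<close>, so one sequence of
    polynomials approximating \<open>g\<close> on it serves both sides.\<close>
  let ?T = "f ` spec x"
  have T: "compact ?T" "?T \<subseteq> \<real>"
    using f by (auto intro: compact_continuous_image compact_spec)
  obtain P where P: "uniform_limit ?T (\<lambda>n. poly (P n)) g sequentially"
    using uniform_poly_approximation[OF T g] .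
  have sa': "star (fcalc x f) = fcalc x f" using star_fcalc[OF sa f] .
  show ?thesis
  proof (rule fcalc_eqI[OF sa'])
    show "uniform_limit (spec (fcalc x f)) (\<lambda>n. poly (P n)) g sequentially"
      using P spec_fcalc_subset[OF sa f(1)] by (rule uniform_limit_on_subset)
    have "uniform_limit (spec x) (\<lambda>n z. poly (P n) (f z)) (\<lambda>z. g (f z)) sequentially"
      by (rule uniform_limit_compose'[OF P]) auto
    then show "(\<lambda>n. peval (P n) (fcalc x f)) \<longlonglongrightarrow> fcalc x (\<lambda>z. g (f z))"
      unfolding peval_fcalc[OF sa f(1)]
      by (rule fcalc_tendsto[OF sa]) (auto intro!: continuous_intros f continuous_on_compose2[OF g f(1)])
  qed
qed

section \<open>Functional calculus in an algebra without unit\<close>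

abbreviation embed :: "'a::cstar_algebra \<Rightarrow> 'a unitization" where
  "embed a \<equiv> Unitization a 0"

lemma embed_simps:
  "embed 0 = 0" "embed a + embed b = embed (a + b)" "embed a - embed b = embed (a - b)"
  "embed a * embed b = embed (a * b)" "c *\<^sub>C embed a = embed (c *\<^sub>C a)" "star (embed a) = embed (star a)"
  by (auto intro: unitization_eqI simp: scaleC_unitization_def star_unitization_def)

lemma scaleC_unitization_sel [simp]:
  "alg_part (c *\<^sub>C u) = c *\<^sub>C alg_part u" "scalar_part (c *\<^sub>C u) = c * scalar_part u"
  by (simp_all add: scaleC_unitization_def)

lemma star_unitization_sel [simp]:
  "alg_part (star u) = star (alg_part u)" "scalar_part (star u) = cnj (scalar_part u)"
  by (simp_all add: star_unitization_def)

lemma spec_embed: "spec (embed a) = cstar_spectrum a"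
proof -
  have "has_inverse u \<longleftrightarrow> unitization_invertible (alg_part u, scalar_part u)" for u :: "'a unitization"
  proof -
    have eq: "u * v = 1 \<longleftrightarrow> unitization_mult (alg_part u, scalar_part u) (alg_part v, scalar_part v) = (0, 1)"
      for u v :: "'a unitization"
      by (auto simp: unitization_mult_def add.assoc dest: arg_cong[of _ _ alg_part] arg_cong[of _ _ scalar_part]
          intro!: unitization_eqI)
    have "unitization_invertible (alg_part u, scalar_part u)" if "has_inverse u"
      using that unfolding has_inverse_def unitization_invertible_def eq by blast
    moreover have "has_inverse u" if inv: "unitization_invertible (alg_part u, scalar_part u)"
    proof -
      obtain a c where "unitization_mult (alg_part u, scalar_part u) (a, c) = (0, 1)"
        "unitization_mult (a, c) (alg_part u, scalar_part u) = (0, 1)"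
        using inv unfolding unitization_invertible_def by fast
      then show ?thesis
        using eq[of u "Unitization a c"] eq[of "Unitization a c" u] by (intro has_inverseI) auto
    qed
    ultimately show ?thesis by blast
  qed
  then show ?thesis by (simp add: spec_def cstar_spectrum_def)
qed

lemma zero_in_spec_embed: "0 \<in> spec (embed a)"
proof -
  have "scalar_part (embed a * v) = 0" for v by simp
  then have "embed a * v \<noteq> 1" for v by (metis unitization_sel(4) zero_neq_one)
  then show ?thesis by (simp add: spec_def has_inverse_def)
qed

lemma bounded_linear_scalar_part: "bounded_linear (scalar_part :: 'a::cstar_algebra unitization \<Rightarrow> complex)"
  by (rule bounded_linear_intro[where K=1])
    (auto simp: scaleR_unitization_def norm_scalar_part_le scaleR_conv_of_real)

lemma scalar_part_peval: "scalar_part (peval p u) = poly p (scalar_part u)"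
  by (induction p) simp_all

text \<open>\<open>scalar_part\<close> is a continuous character with value \<open>0\<close> at
  \<open>embed a\<close>, so it evaluates functions at \<open>0\<close>. Functions vanishing there
  give elements of the algebra itself.\<close>

lemma scalar_part_fcalc:
  assumes "star a = a" "continuous_on (spec (embed a)) f"
  shows "scalar_part (fcalc (embed a) f) = f 0"
proof -
  have sa: "star (embed a) = embed a" using assms by (simp add: embed_simps)
  obtain P where P: "uniform_limit (spec (embed a)) (\<lambda>n. poly (P n)) f sequentially"
    "(\<lambda>n. peval (P n) (embed a)) \<longlonglongrightarrow> fcalc (embed a) f" using fcalc_approx[OF sa assms(2)] .
  have "(\<lambda>n. poly (P n) 0) \<longlonglongrightarrow> f 0"
    by (rule tendsto_uniform_limitI[OF P(1) zero_in_spec_embed])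
  moreover have "(\<lambda>n. scalar_part (peval (P n) (embed a))) \<longlonglongrightarrow> scalar_part (fcalc (embed a) f)"
    using bounded_linear.tendsto[OF bounded_linear_scalar_part P(2)] .
  ultimately show ?thesis by (simp add: scalar_part_peval) (metis LIMSEQ_unique)
qed

text \<open>Existence of a calculus. Since \<open>cfc\<close> is an arbitrary choice, it becomes
  computable only together with uniqueness, \<open>embed_is_cfc\<close>.\<close>

lemma is_cfc_fcalc:
  assumes sa: "star a = a"
  shows "is_cfc a (\<lambda>f. alg_part (fcalc (embed a) f))"
proof -
  have sa': "star (embed a) = embed a" using assms by (simp add: embed_simps)
  note fc = fcalc_add[OF sa'] fcalc_scaleC[OF sa'] fcalc_mult[OF sa'] fcalc_cnj[OF sa']
  have embed: "embed (alg_part (fcalc (embed a) f)) = fcalc (embed a) f" if "f \<in> cfc_dom a" for f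
    using that scalar_part_fcalc[OF sa] by (auto intro!: unitization_eqI simp: cfc_dom_def spec_embed)
  show ?thesis
    unfolding is_cfc_def
  proof (intro conjI ballI allI)
    fix f g and c :: complex assume f: "f \<in> cfc_dom a"
    then have cf: "continuous_on (spec (embed a)) f" and f0: "f 0 = 0"
      by (simp_all add: cfc_dom_def spec_embed)
    have sp: "scalar_part (fcalc (embed a) f) = 0"
      using scalar_part_fcalc[OF sa cf] f0 by simp
    show "alg_part (fcalc (embed a) (\<lambda>z. c * f z)) = c *\<^sub>C alg_part (fcalc (embed a) f)"
      by (simp add: fc cf)
    show "alg_part (fcalc (embed a) (\<lambda>z. cnj (f z))) = star (alg_part (fcalc (embed a) f))"
      by (simp add: fc cf)
    have n: "norm (alg_part (fcalc (embed a) f)) = norm (fcalc (embed a) f)"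
      by (metis embed[OF f] norm_Unitization_0)
    have le: "cmod (f z) \<le> norm (fcalc (embed a) f)" if "z \<in> cstar_spectrum a" for z
      using norm_le_norm_fcalc[OF sa' cf] that by (simp add: spec_embed)
    show "norm (alg_part (fcalc (embed a) f)) = (SUP z\<in>cstar_spectrum a. cmod (f z))"
      unfolding n
    proof (rule antisym)
      show "norm (fcalc (embed a) f) \<le> (SUP z\<in>cstar_spectrum a. cmod (f z))"
        using le by (intro norm_fcalc_le[OF sa' cf]) (auto simp: spec_embed intro!: cSUP_upper bdd_aboveI2)
      show "(SUP z\<in>cstar_spectrum a. cmod (f z)) \<le> norm (fcalc (embed a) f)"
        using le zero_in_spec_embed[of a] by (intro cSUP_least) (auto simp: spec_embed)
    qed
    {
      assume "g \<in> cfc_dom a"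
      then have cg: "continuous_on (spec (embed a)) g" and g0: "g 0 = 0"
        by (simp_all add: cfc_dom_def spec_embed)
      have sp': "scalar_part (fcalc (embed a) g) = 0"
        using scalar_part_fcalc[OF sa cg] g0 by simp
      show "alg_part (fcalc (embed a) (\<lambda>z. f z + g z)) = alg_part (fcalc (embed a) f) + alg_part (fcalc (embed a) g)"
        "alg_part (fcalc (embed a) (\<lambda>z. f z * g z)) = alg_part (fcalc (embed a) f) * alg_part (fcalc (embed a) g)"
        by (simp_all add: fc cf cg sp sp')
    }
  qed (simp add: fcalc_id[OF sa'])
qed

text \<open>\<open>\<Phi>\<close> is determined on the functions \<open>z * p z\<close> with \<open>p\<close> a polynomial, and these are dense.\<close>

lemma embed_is_cfc:
  assumes sa: "star a = a" and \<Phi>: "is_cfc a \<Phi>" and f: "f \<in> cfc_dom a"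
  shows "embed (\<Phi> f) = fcalc (embed a) f"
proof -
  have sa': "star (embed a) = embed a" using assms by (simp add: embed_simps)
  have add: "\<Phi> (\<lambda>z. f z + g z) = \<Phi> f + \<Phi> g" and mult: "\<Phi> (\<lambda>z. f z * g z) = \<Phi> f * \<Phi> g"
    if "f \<in> cfc_dom a" "g \<in> cfc_dom a" for f g
    using \<Phi> that unfolding is_cfc_def by blast+
  have scale: "\<Phi> (\<lambda>z. c * f z) = c *\<^sub>C \<Phi> f"
    and norm: "norm (\<Phi> f) = (SUP z\<in>cstar_spectrum a. cmod (f z))" if "f \<in> cfc_dom a" for f c
    using \<Phi> that unfolding is_cfc_def by blast+
  have id: "\<Phi> (\<lambda>z. z) = a" using \<Phi> unfolding is_cfc_def by blast
  have dom: "(\<lambda>z. z) \<in> cfc_dom a" "(\<lambda>z. z * poly p z) \<in> cfc_dom a" "(\<lambda>z. c * z) \<in> cfc_dom a" for p c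
    by (auto simp: cfc_dom_def intro!: continuous_intros)
  have poly: "embed (\<Phi> (\<lambda>z. z * poly p z)) = embed a * peval p (embed a)" for p
  proof (induction p)
    case 0
    have "\<Phi> (\<lambda>z. 0 * z) = 0" using scale[OF dom(1), of 0] by simp
    then show ?case by (simp add: embed_simps)
  next
    case (pCons c p)
    have "(\<lambda>z. z * poly (pCons c p) z) = (\<lambda>z. c * z + z * (z * poly p z))"
      by (auto simp: algebra_simps)
    then have "\<Phi> (\<lambda>z. z * poly (pCons c p) z) = \<Phi> (\<lambda>z. c * z + z * (z * poly p z))" by simp
    also have "\<dots> = c *\<^sub>C a + a * \<Phi> (\<lambda>z. z * poly p z)"
      using dom(2)[of "pCons 0 p"]
      by (subst add) (auto simp: dom mult scale id)
    finally show ?case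
      by (simp add: embed_simps(2,4,5)[symmetric] pCons.IH distrib_left mult_scaleC_right)
  qed
  have cf: "continuous_on (spec (embed a)) f" and f0: "f 0 = 0"
    using f by (simp_all add: cfc_dom_def spec_embed)
  obtain P where P: "uniform_limit (spec (embed a)) (\<lambda>n. poly (P n)) f sequentially"
    using fcalc_approx[OF sa' cf] by blast
  have "\<exists>q. P n = pCons (poly (P n) 0) q" for n
    by (cases "P n") auto
  then obtain Q where Q: "\<And>n. P n = pCons (poly (P n) 0) (Q n)" by metis
  \<comment> \<open>The constant coefficients tend to \<open>f 0 = 0\<close>, as \<open>0\<close>
    lies in the spectrum; so removing them keeps the uniform convergence and puts the approximants
    into \<open>cfc_dom a\<close>.\<close>
  define F where "F n = (\<lambda>z. z * poly (Q n) z)" for n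
  have F: "F n z = poly (P n) z - poly (P n) 0" for n z
    by (subst Q[of n]) (simp add: F_def)
  have "uniform_limit (spec (embed a)) (\<lambda>n z. poly (P n) z - poly (P n) 0) (\<lambda>z. f z - 0) sequentially"
  proof (intro uniform_limit_minus P)
    have "(\<lambda>n. poly (P n) 0) \<longlonglongrightarrow> 0"
      using tendsto_uniform_limitI[OF P zero_in_spec_embed] f0 by simp
    then show "uniform_limit (spec (embed a)) (\<lambda>n z. poly (P n) 0) (\<lambda>z. 0) sequentially"
      unfolding tendsto_iff uniform_limit_iff by (force elim: eventually_mono)
  qed
  then have ul: "uniform_limit (spec (embed a)) F f sequentially" by (simp add: F[abs_def])
  have cF: "continuous_on (spec (embed a)) (F n)" for n unfolding F_def by (intro continuous_intros)
  have "(\<lambda>n. fcalc (embed a) (F n)) \<longlonglongrightarrow> fcalc (embed a) f"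
    by (rule fcalc_tendsto[OF sa' ul cF cf])
  moreover have "fcalc (embed a) (F n) = embed (\<Phi> (F n))" for n
    unfolding F_def poly by (subst fcalc_mult[OF sa']) (auto simp: fcalc_id[OF sa'] fcalc_poly[OF sa', unfolded] intro: continuous_intros)
  ultimately have 1: "(\<lambda>n. embed (\<Phi> (F n))) \<longlonglongrightarrow> fcalc (embed a) f" by simp
  have "(\<lambda>n. embed (\<Phi> (F n))) \<longlonglongrightarrow> embed (\<Phi> f)"
  proof (rule LIMSEQ_I)
    fix e :: real assume e: "0 < e"
    have "\<forall>\<^sub>F n in sequentially. norm (embed (\<Phi> (F n)) - embed (\<Phi> f)) \<le> e / 2"
      using uniform_limitD[OF ul half_gt_zero[OF e]]
    proof eventually_elim
      case (elim n)
      have d: "(\<lambda>z. (-1) * f z) \<in> cfc_dom a" "F n \<in> cfc_dom a" "(\<lambda>z. F n z + (-1) * f z) \<in> cfc_dom a"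
        using f by (auto simp: cfc_dom_def F_def intro!: continuous_intros)
      have "\<Phi> (\<lambda>z. F n z + (-1) * f z) = \<Phi> (F n) - \<Phi> f"
        by (simp only: add[OF d(2,1)] scale[OF f]) (simp add: complex_vector.scale_minus_left)
      then have "norm (\<Phi> (F n) - \<Phi> f) = (SUP z\<in>cstar_spectrum a. cmod (F n z + (-1) * f z))"
        using norm[OF d(3)] by simp
      also have "\<dots> \<le> e / 2"
        using elim e zero_in_spec_embed[of a]
        by (intro cSUP_least) (auto simp: spec_embed dist_norm less_imp_le)
      finally show ?case by (simp add: embed_simps)
    qed
    then show "\<exists>N. \<forall>n\<ge>N. norm (embed (\<Phi> (F n)) - embed (\<Phi> f)) < e"
      using e unfolding eventually_sequentially by fastforce
  qed
  then show ?thesis using 1 LIMSEQ_unique by blast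
qed

lemma embed_cfc:
  assumes "star a = a" "f \<in> cfc_dom a"
  shows "embed (cfc a f) = fcalc (embed a) f"
proof -
  have "is_cfc a (cfc a)"
    unfolding cfc_def by (rule someI[where P="is_cfc a"], rule is_cfc_fcalc[OF assms(1)])
  then show ?thesis using embed_is_cfc assms by blast
qed

section \<open>Positive elements\<close>

definition upos :: "'a::unital_cstar_algebra set" where
  "upos = {x. star x = x \<and> (\<forall>z\<in>spec x. z \<in> \<real> \<and> 0 \<le> Re z)}"

definition upos_le :: "'a::unital_cstar_algebra \<Rightarrow> 'a \<Rightarrow> bool"  (infix "\<preceq>" 50) where
  "x \<preceq> y \<longleftrightarrow> y - x \<in> upos"

lemma upos_star: "x \<in> upos \<Longrightarrow> star x = x"
  by (simp add: upos_def)

lemma upos_spec: "x \<in> upos \<Longrightarrow> z \<in> spec x \<Longrightarrow> z = of_real (Re z) \<and> 0 \<le> Re z \<and> Re z \<le> norm x"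
  using norm_spec_le[of z x] complex_Re_le_cmod[of z] by (auto simp: upos_def)

lemma uposI: "star x = x \<Longrightarrow> (\<And>z. z \<in> spec x \<Longrightarrow> 0 \<le> Re z) \<Longrightarrow> x \<in> upos"
  using spec_selfadjoint_real[of x] by (auto simp: upos_def)

lemma fcalc_upos:
  assumes "star x = x" "continuous_on (spec x) f" "\<And>z. z \<in> spec x \<Longrightarrow> f z \<in> \<real> \<and> 0 \<le> Re (f z)"
  shows "fcalc x f \<in> upos"
  using spec_fcalc_subset[OF assms(1,2)] assms(3) star_fcalc[OF assms(1,2)] by (force intro!: uposI)

text \<open>For selfadjoint \<open>x\<close>, the norm of \<open>t *\<^sub>R 1 - x\<close> is at
  most \<open>t\<close> exactly if the spectrum lies between \<open>0\<close> and
  \<open>2 * t\<close>. In this form positivity visibly passes to sums and limits, which the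
  definition by spectra does not show.\<close>

lemma upos_norm_le:
  assumes "x \<in> upos" "norm x \<le> t"
  shows "norm (t *\<^sub>R 1 - x) \<le> t"
proof -
  have sa: "star x = x" using assms upos_star by blast
  have "t *\<^sub>R 1 - x = fcalc x (\<lambda>z. of_real t - z)"
    by (subst fcalc_diff[OF sa])
      (auto simp: fcalc_const[OF sa] fcalc_id[OF sa] scaleR_scaleC intro: continuous_intros)
  also have "norm \<dots> \<le> t"
  proof (rule norm_fcalc_le[OF sa])
    fix z assume "z \<in> spec x"
    then obtain r where "z = of_real r" "0 \<le> r" "r \<le> t" using upos_spec assms by (metis order_trans)
    then show "cmod (of_real t - z) \<le> t"
      by (simp del: of_real_diff add: of_real_diff[symmetric])
  qed (intro continuous_intros)
  finally show ?thesis .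
qed

lemma upos_norm_leD:
  assumes sa: "star x = x" and le: "norm (t *\<^sub>R 1 - x) \<le> t"
  shows "x \<in> upos"
proof (rule uposI[OF sa])
  fix z assume "z \<in> spec x"
  then have "poly [:of_real t, - 1:] z \<in> spec (peval [:of_real t, - 1:] x)" by (rule poly_mem_spec)
  then have "of_real t - z \<in> spec (t *\<^sub>R 1 - x)"
    by (simp add: scaleR_scaleC mult_scaleC_right complex_vector.scale_minus_left)
  then have "cmod (of_real t - z) \<le> t" using norm_spec_le le by (meson order_trans)
  then show "0 \<le> Re z" using complex_Re_le_cmod[of "of_real t - z"] by simp
qed

lemma upos_add:
  assumes "x \<in> upos" "y \<in> upos"
  shows "x + y \<in> upos"
proof (rule upos_norm_leD)
  have eq: "(norm x + norm y) *\<^sub>R 1 - (x + y) = (norm x *\<^sub>R 1 - x) + (norm y *\<^sub>R 1 - y)"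
    by (simp add: algebra_simps)
  show "norm ((norm x + norm y) *\<^sub>R 1 - (x + y)) \<le> norm x + norm y"
    using upos_norm_le[OF assms(1) order_refl] upos_norm_le[OF assms(2) order_refl]
      norm_triangle_ineq[of "norm x *\<^sub>R 1 - x" "norm y *\<^sub>R 1 - y"] unfolding eq by linarith
qed (simp add: assms upos_star)

lemma upos_scaleR:
  assumes "x \<in> upos" "0 \<le> r"
  shows "r *\<^sub>R x \<in> upos"
proof (rule upos_norm_leD)
  have "(r * norm x) *\<^sub>R 1 - r *\<^sub>R x = r *\<^sub>R (norm x *\<^sub>R 1 - x)" by (simp add: algebra_simps)
  then show "norm ((r * norm x) *\<^sub>R 1 - r *\<^sub>R x) \<le> r * norm x"
    using upos_norm_le[OF assms(1) order_refl] assms(2) by (simp add: mult_left_mono)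
qed (simp add: assms upos_star)

lemma upos_closed:
  assumes "X \<longlonglongrightarrow> x" "\<And>n::nat. X n \<in> upos"
  shows "x \<in> upos"
proof (rule upos_norm_leD)
  have "(\<lambda>n. star (X n)) \<longlonglongrightarrow> star x" using assms(1) by (rule tendsto_star)
  then have "X \<longlonglongrightarrow> star x" by (simp add: upos_star[OF assms(2)])
  then show "star x = x" using assms(1) by (rule LIMSEQ_unique)
  have "(\<lambda>n. norm (norm (X n) *\<^sub>R 1 - X n)) \<longlonglongrightarrow> norm (norm x *\<^sub>R 1 - x)"
    by (intro tendsto_intros assms(1))
  moreover have "(\<lambda>n. norm (X n)) \<longlonglongrightarrow> norm x" using assms(1) by (rule tendsto_norm)
  ultimately show "norm (norm x *\<^sub>R 1 - x) \<le> norm x"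
    by (rule LIMSEQ_le) (auto intro: upos_norm_le assms(2))
qed

lemma upos_0 [simp]: "0 \<in> upos" and upos_1 [simp]: "1 \<in> upos"
  by (rule upos_norm_leD[where t=0], simp, simp) (rule upos_norm_leD[where t=1], simp_all)

lemma upos_antisym:
  assumes "x \<in> upos" "- x \<in> upos"
  shows "x = 0"
proof -
  obtain z where z: "z \<in> spec x" "cmod z = norm x" using spec_norm_attained upos_star assms(1) by blast
  then have "poly [:0, - 1:] z \<in> spec (peval [:0, - 1:] x)" by (intro poly_mem_spec)
  then have "- z \<in> spec (- x)" by (simp add: mult_scaleC_right complex_vector.scale_minus_left)
  then have "Re (- z) \<ge> 0" using assms upos_spec by blast
  then have "z = 0" using upos_spec[OF assms(1) z(1)] by (simp add: complex_eq_iff)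
  then show ?thesis using z by simp
qed

lemma upos_square: "star x = x \<Longrightarrow> x * x \<in> upos"
proof -
  assume sa: "star x = x"
  have "fcalc x (\<lambda>z. z * z) \<in> upos"
  proof (rule fcalc_upos[OF sa])
    fix z assume "z \<in> spec x"
    then have "z \<in> \<real>" by (rule spec_selfadjoint_real[OF sa])
    then show "z * z \<in> \<real> \<and> 0 \<le> Re (z * z)" by (auto elim!: Reals_cases)
  qed (intro continuous_intros)
  then show ?thesis by (simp add: fcalc_mult[OF sa] fcalc_id[OF sa])
qed

text \<open>If \<open>y = x q\<close>, with \<open>q\<close> the root of the negative part of \<open>x\<^sup>* x\<close>, then \<open>y\<^sup>* y\<close> is negative,
  while \<open>y\<^sup>* y + y y\<^sup>*\<close> is a sum of squares; as \<open>y\<^sup>* y\<close> and \<open>y y\<^sup>*\<close> have the same nonzero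
  spectrum, \<open>y\<^sup>* y = 0\<close>.\<close>

lemma star_mult_self_upos: "star x * x \<in> upos"
proof -
  define h where "h = star x * x"
  have sa: "star h = h" by (simp add: h_def star_mult)
  define q where "q = fcalc h (\<lambda>z. of_real (sqrt (max (- Re z) 0)))"
  define k where "k = fcalc h (\<lambda>z. of_real ((max (- Re z) 0)\<^sup>2))"
  define y where "y = x * q"
  have qs: "star q = q" unfolding q_def by (rule star_fcalc[OF sa]) (auto intro!: continuous_intros)
  have k: "k \<in> upos" unfolding k_def by (rule fcalc_upos[OF sa]) (auto intro!: continuous_intros)
  have "star y * y = q * (h * q)" by (simp add: y_def h_def star_mult qs mult.assoc)
  also have "\<dots> = fcalc h (\<lambda>z. of_real (sqrt (max (- Re z) 0)) * (z * of_real (sqrt (max (- Re z) 0))))"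
    unfolding q_def by (simp add: fcalc_mult[OF sa] fcalc_id[OF sa] continuous_intros)
  also have "\<dots> = fcalc h (\<lambda>z. (- 1) * of_real ((max (- Re z) 0)\<^sup>2))"
  proof (rule fcalc_cong)
    fix z assume "z \<in> spec h"
    then obtain r where r: "z = of_real r" using spec_selfadjoint_real[OF sa] by (auto elim: Reals_cases)
    have "sqrt (max (- r) 0) * (r * sqrt (max (- r) 0)) = - ((max (- r) 0)\<^sup>2)"
      using real_sqrt_mult_self[of "- r"] by (auto simp: max_def power2_eq_square algebra_simps)
    then show "of_real (sqrt (max (- Re z) 0)) * (z * of_real (sqrt (max (- Re z) 0))) =
        (- 1) * complex_of_real ((max (- Re z) 0)\<^sup>2)"
      unfolding r by (metis Re_complex_of_real mult_minus1 of_real_minus of_real_mult)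
  qed
  also have "\<dots> = (- 1) *\<^sub>C k" unfolding k_def by (rule fcalc_scaleC[OF sa]) (intro continuous_intros)
  finally have yy: "star y * y = - k" by (simp add: complex_vector.scale_minus_left)
  \<comment> \<open>Twice the real part of \<open>y\<close> and, up to sign, twice its imaginary
    part; the terms \<open>y * y\<close> and \<open>star y * star y\<close> cancel in the sum of
    their squares.\<close>
  define u v where "u = y + star y" and "v = \<i> *\<^sub>C (y - star y)"
  have "u * u \<in> upos" "v * v \<in> upos"
    by (auto intro!: upos_square simp: u_def v_def star_scaleC complex_vector.scale_right_diff_distrib
        complex_vector.scale_minus_left)
  moreover have "u * u + v * v = 2 *\<^sub>R (star y * y + y * star y)"
    by (simp add: u_def v_def mult_scaleC_left mult_scaleC_right scaleC_scaleC complex_vector.scale_minus_left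
        algebra_simps scaleR_2)
  ultimately have "2 *\<^sub>R (star y * y + y * star y) \<in> upos" using upos_add by metis
  then have "(1/2) *\<^sub>R (2 *\<^sub>R (star y * y + y * star y)) \<in> upos" by (rule upos_scaleR) simp
  then have "star y * y + y * star y \<in> upos" by simp
  then have "(star y * y + y * star y) + k \<in> upos" using k by (rule upos_add)
  then have pos: "y * star y \<in> upos" by (simp add: yy)
  have "star y * y \<in> upos"
  proof (rule uposI)
    fix z assume "z \<in> spec (star y * y)"
    then show "0 \<le> Re z" using spec_mult_swap[of z "star y" y] upos_spec[OF pos] by (cases "z = 0") auto
  qed (simp add: star_mult)
  then have "k = 0" using k yy by (intro upos_antisym) simp_all
  have "h \<in> upos"
  proof (rule uposI[OF sa])
    fix z assume "z \<in> spec h"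
    then have "cmod (of_real ((max (- Re z) 0)\<^sup>2)) \<le> norm k"
      unfolding k_def by (intro norm_le_norm_fcalc[OF sa]) (auto intro!: continuous_intros)
    with \<open>k = 0\<close> show "0 \<le> Re z" by (auto simp: max_def norm_power split: if_splits)
  qed
  then show ?thesis by (simp add: h_def)
qed

lemma mult_star_self_upos: "x * star x \<in> upos"
  using star_mult_self_upos[of "star x"] by simp

section \<open>Real functions of positive elements\<close>

definition rcalc :: "'a::unital_cstar_algebra \<Rightarrow> (real \<Rightarrow> real) \<Rightarrow> 'a" where
  "rcalc x f = fcalc x (\<lambda>z. of_real (f (Re z)))"

lemma rcalc_cong:
  assumes "x \<in> upos" "\<And>t. 0 \<le> t \<Longrightarrow> f t = g t"
  shows "rcalc x f = rcalc x g"
  unfolding rcalc_def using assms(2) upos_spec[OF assms(1)] by (intro fcalc_cong) simp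

text \<open>Continuity on all of \<open>{0..}\<close> is asked for throughout, so that the side
  condition concerns the function alone and carries over to every positive element.\<close>

lemma continuous_on_spec_rcalc:
  assumes "x \<in> upos" "continuous_on {0..} f"
  shows "continuous_on (spec x) (\<lambda>z. complex_of_real (f (Re z)))"
  using upos_spec[OF assms(1)]
  by (intro continuous_on_of_real continuous_on_compose2[OF assms(2)] continuous_intros) auto

context
  fixes x :: "'a::unital_cstar_algebra"
  assumes x: "x \<in> upos"
begin

private lemmas sa = upos_star[OF x]

lemma rcalc_upos: "continuous_on {0..} f \<Longrightarrow> (\<And>t. 0 \<le> t \<Longrightarrow> 0 \<le> f t) \<Longrightarrow> rcalc x f \<in> upos"
  unfolding rcalc_def using upos_spec[OF x]
  by (intro fcalc_upos sa continuous_on_spec_rcalc[OF x]) auto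

lemma star_rcalc: "continuous_on {0..} f \<Longrightarrow> star (rcalc x f) = rcalc x f"
  unfolding rcalc_def by (intro star_fcalc sa continuous_on_spec_rcalc[OF x]) auto

lemma rcalc_mult:
  "continuous_on {0..} f \<Longrightarrow> continuous_on {0..} g \<Longrightarrow> rcalc x (\<lambda>t. f t * g t) = rcalc x f * rcalc x g"
  unfolding rcalc_def of_real_mult
  by (rule fcalc_mult[OF sa]) (erule continuous_on_spec_rcalc[OF x])+

lemma rcalc_diff:
  "continuous_on {0..} f \<Longrightarrow> continuous_on {0..} g \<Longrightarrow> rcalc x (\<lambda>t. f t - g t) = rcalc x f - rcalc x g"
  unfolding rcalc_def of_real_diff
  by (rule fcalc_diff[OF sa]) (erule continuous_on_spec_rcalc[OF x])+

lemma rcalc_const: "rcalc x (\<lambda>t. c) = c *\<^sub>R 1"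
  by (simp add: rcalc_def fcalc_const[OF sa] scaleR_scaleC)

lemma rcalc_id: "rcalc x (\<lambda>t. t) = x"
proof -
  have "rcalc x (\<lambda>t. t) = fcalc x (\<lambda>z. z)"
    unfolding rcalc_def using upos_spec[OF x] by (intro fcalc_cong) auto
  then show ?thesis by (simp add: fcalc_id[OF sa])
qed

lemma norm_rcalc_le:
  assumes "continuous_on {0..} f" "\<And>t. 0 \<le> t \<Longrightarrow> t \<le> norm x \<Longrightarrow> \<bar>f t\<bar> \<le> c"
  shows "norm (rcalc x f) \<le> c"
  unfolding rcalc_def using assms upos_spec[OF x]
  by (intro norm_fcalc_le sa continuous_on_spec_rcalc[OF x]) (auto simp: norm_of_real)

lemma rcalc_rcalc:
  assumes f: "continuous_on {0..} f" "\<And>t. 0 \<le> t \<Longrightarrow> 0 \<le> f t" and g: "continuous_on {0..} g"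
  shows "rcalc (rcalc x f) g = rcalc x (\<lambda>t. g (f t))"
proof -
  have "continuous_on ((\<lambda>z. complex_of_real (f (Re z))) ` spec x) (\<lambda>z. complex_of_real (g (Re z)))"
    using upos_spec[OF x] f(2)
    by (intro continuous_on_of_real continuous_on_compose2[OF g] continuous_intros) auto
  then show ?thesis
    unfolding rcalc_def by (subst fcalc_fcalc[OF sa continuous_on_spec_rcalc[OF x f(1)]]) auto
qed

lemma rcalc_tendsto:
  assumes F: "\<And>n. continuous_on {0..} (F n)" and f: "continuous_on {0..} f"
    and e: "e \<longlonglongrightarrow> 0" "\<And>(n::nat) t. 0 \<le> t \<Longrightarrow> t \<le> norm x \<Longrightarrow> \<bar>F n t - f t\<bar> \<le> e n"
  shows "(\<lambda>n. rcalc x (F n)) \<longlonglongrightarrow> rcalc x f"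
proof -
  have "norm (rcalc x (F n) - rcalc x f) \<le> e n" for n
    unfolding rcalc_diff[OF F f, symmetric] by (intro norm_rcalc_le continuous_on_diff F f e(2))
  then have "(\<lambda>n. rcalc x (F n) - rcalc x f) \<longlonglongrightarrow> 0"
    by (intro Lim_null_comparison[OF _ e(1)]) auto
  then show ?thesis by (rule LIM_zero_cancel)
qed

end

section \<open>Powers, conjugation and the order\<close>

definition upow :: "'a::unital_cstar_algebra \<Rightarrow> real \<Rightarrow> 'a" where
  "upow x s = rcalc x (\<lambda>t. t powr s)"

lemma continuous_on_powr_nonneg: "0 < s \<Longrightarrow> continuous_on {0..} (\<lambda>t::real. t powr s)"
  by (intro continuous_on_powr' continuous_intros) auto

lemma continuous_on_shift_powr: "0 < e \<Longrightarrow> continuous_on {0..} (\<lambda>t::real. (t + e) powr s)"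
  by (intro continuous_on_powr' continuous_intros) auto

lemma upow_upos: "x \<in> upos \<Longrightarrow> 0 < s \<Longrightarrow> upow x s \<in> upos"
  unfolding upow_def by (intro rcalc_upos continuous_on_powr_nonneg) auto

lemma upow_star: "x \<in> upos \<Longrightarrow> 0 < s \<Longrightarrow> star (upow x s) = upow x s"
  using upow_upos upos_star by blast

lemma upow_mult: "x \<in> upos \<Longrightarrow> 0 < s \<Longrightarrow> 0 < t \<Longrightarrow> upow x s * upow x t = upow x (s + t)"
  unfolding upow_def by (simp add: rcalc_mult[symmetric] continuous_on_powr_nonneg powr_add)

lemma upow_one: "x \<in> upos \<Longrightarrow> upow x 1 = x"
proof -
  assume x: "x \<in> upos"
  have "upow x 1 = rcalc x (\<lambda>t. t)" unfolding upow_def by (rule rcalc_cong[OF x]) simp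
  then show ?thesis by (simp add: rcalc_id[OF x])
qed

lemma upow_upow: "x \<in> upos \<Longrightarrow> 0 < s \<Longrightarrow> 0 < t \<Longrightarrow> upow (upow x s) t = upow x (s * t)"
  unfolding upow_def by (subst rcalc_rcalc) (auto simp: continuous_on_powr_nonneg powr_powr)

lemma upow_half_mult: "x \<in> upos \<Longrightarrow> upow x (1/2) * upow x (1/2) = x"
  using upow_mult[of x "1/2" "1/2"] by (simp add: upow_one)

lemma upow_two: "x \<in> upos \<Longrightarrow> upow x 2 = x * x"
  using upow_mult[of x 1 1] by (simp add: upow_one)

lemma conj_upos:
  assumes "a \<in> upos"
  shows "star x * a * x \<in> upos"
proof -
  have "star x * a * x = star (upow a (1/2) * x) * (upow a (1/2) * x)"
    unfolding star_mult upow_star[OF assms half_gt_zero[OF zero_less_one]]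
    by (simp only: mult.assoc[symmetric]) (simp only: mult.assoc upow_half_mult[OF assms])
  then show ?thesis using star_mult_self_upos by metis
qed

lemma conj_mono:
  assumes "a \<preceq> b"
  shows "star x * a * x \<preceq> star x * b * x"
  using conj_upos[of "b - a" x] assms by (simp add: upos_le_def algebra_simps)

lemma conj_mono_sa: "star x = x \<Longrightarrow> a \<preceq> b \<Longrightarrow> x * a * x \<preceq> x * b * x"
  using conj_mono[of a b x] by simp

lemma upos_le_trans: "a \<preceq> b \<Longrightarrow> b \<preceq> c \<Longrightarrow> a \<preceq> c"
  unfolding upos_le_def using upos_add[of "b - a" "c - b"] by (simp add: algebra_simps)

lemma upos_le_refl [simp]: "a \<preceq> a"
  by (simp add: upos_le_def)

lemma upos_le_limit:
  assumes "X \<longlonglongrightarrow> x" "Y \<longlonglongrightarrow> y" "\<And>n::nat. X n \<preceq> Y n"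
  shows "x \<preceq> y"
  unfolding upos_le_def
proof (rule upos_closed)
  show "(\<lambda>n. Y n - X n) \<longlonglongrightarrow> y - x" using assms(2,1) by (rule tendsto_diff)
qed (use assms(3) in \<open>simp add: upos_le_def\<close>)

lemma selfadjoint_le_norm:
  assumes sa: "star a = a" and c: "norm a \<le> c"
  shows "a \<preceq> c *\<^sub>R 1"
  unfolding upos_le_def
proof (rule uposI)
  fix z assume "z \<in> spec (c *\<^sub>R 1 - a)"
  moreover have "c *\<^sub>R 1 - a = peval [:of_real c, - 1:] a"
    by (simp add: scaleR_scaleC mult_scaleC_right complex_vector.scale_minus_left)
  ultimately obtain w where w: "w \<in> spec a" "z = of_real c - w"
    using spec_peval[of z "[:of_real c, - 1:]" a] by auto
  then show "0 \<le> Re z" using norm_spec_le[OF w(1)] complex_Re_le_cmod[of w] c by simp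
qed (simp add: sa)

lemma norm_le_of_upos_le:
  assumes "a \<in> upos" "a \<preceq> c *\<^sub>R 1"
  shows "norm a \<le> c"
proof -
  obtain z where z: "z \<in> spec a" "cmod z = norm a" using spec_norm_attained upos_star assms(1) by blast
  then have "poly [:of_real c, - 1:] z \<in> spec (peval [:of_real c, - 1:] a)" by (intro poly_mem_spec)
  then have "of_real c - z \<in> spec (c *\<^sub>R 1 - a)"
    by (simp add: scaleR_scaleC mult_scaleC_right complex_vector.scale_minus_left)
  then have "0 \<le> Re (of_real c - z)" using assms(2) upos_spec unfolding upos_le_def by blast
  moreover have "cmod z = Re z" using upos_spec[OF assms(1) z(1)] by (metis abs_of_nonneg norm_of_real)
  ultimately show ?thesis using z by simp
qed

lemma upos_norm_mono:
  assumes "a \<in> upos" "a \<preceq> b"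
  shows "norm a \<le> norm b"
proof -
  have "b \<in> upos" using upos_add[OF assms(1), of "b - a"] assms(2) by (simp add: upos_le_def)
  then have "b \<preceq> norm b *\<^sub>R 1" by (intro selfadjoint_le_norm upos_star) auto
  then show ?thesis using assms upos_le_trans norm_le_of_upos_le by blast
qed

text \<open>The norm of a selfadjoint product is attained in its spectrum, which it shares with the
  opposite product away from \<open>0\<close>.\<close>

lemma norm_mult_swap:
  fixes x :: "'a::unital_cstar_algebra"
  assumes "star (x * y) = x * y"
  shows "norm (x * y) \<le> norm (y * x)"
proof -
  obtain z where z: "z \<in> spec (x * y)" "cmod z = norm (x * y)" using spec_norm_attained assms by blast
  then show ?thesis using spec_mult_swap[OF z(1)] norm_spec_le[of z "y * x"] by (cases "z = 0") auto
qed

lemma peval_intertwine: "x * peval p (star x * x) = peval p (x * star x) * x"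
proof (induction p)
  case (pCons c p)
  have "x * (star x * x * peval p (star x * x)) = x * star x * (x * peval p (star x * x))"
    by (simp only: mult.assoc)
  also have "\<dots> = x * star x * peval p (x * star x) * x" by (simp only: pCons.IH mult.assoc)
  finally show ?case by (simp add: distrib_left distrib_right mult_scaleC_left mult_scaleC_right)
qed simp

text \<open>For polynomials this is repeated use of
  \<open>x * (star x * x) = (x * star x) * x\<close>. Approximating \<open>f\<close> on the union of
  the two spectra gives one sequence of polynomials for both sides.\<close>

lemma rcalc_intertwine:
  assumes f: "continuous_on {0..} f"
  shows "x * rcalc (star x * x) f = rcalc (x * star x) f * x"
proof -
  let ?h = "star x * x" and ?k = "x * star x" and ?f = "\<lambda>z. complex_of_real (f (Re z))"
  let ?S = "spec ?h \<union> spec ?k"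
  have pos: "?h \<in> upos" "?k \<in> upos" by (rule star_mult_self_upos mult_star_self_upos)+
  have S: "\<And>z. z \<in> ?S \<Longrightarrow> z = of_real (Re z) \<and> 0 \<le> Re z" using pos upos_spec by blast
  have "?S \<subseteq> \<real>" using S by (metis Reals_of_real subsetI)
  moreover have "continuous_on ?S ?f"
    using S by (intro continuous_on_of_real continuous_on_compose2[OF f] continuous_intros) auto
  ultimately obtain P where P: "uniform_limit ?S (\<lambda>n. poly (P n)) ?f sequentially"
    using uniform_poly_approximation[of ?S] compact_spec by blast
  have "(\<lambda>n. peval (P n) a) \<longlonglongrightarrow> rcalc a f" if "a \<in> upos" "spec a \<subseteq> ?S" for a
  proof -
    have "uniform_limit (spec a) (\<lambda>n. poly (P n)) ?f sequentially"
      using P that(2) by (rule uniform_limit_on_subset)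
    then have "(\<lambda>n. fcalc a (poly (P n))) \<longlonglongrightarrow> fcalc a ?f"
      by (rule fcalc_tendsto[OF upos_star[OF that(1)] _ _ continuous_on_spec_rcalc[OF that(1) f]])
        (intro continuous_intros)
    then show ?thesis by (simp add: fcalc_poly[OF upos_star[OF that(1)]] rcalc_def)
  qed
  then have "(\<lambda>n. x * peval (P n) ?h) \<longlonglongrightarrow> x * rcalc ?h f" "(\<lambda>n. peval (P n) ?k * x) \<longlonglongrightarrow> rcalc ?k f * x"
    using pos by (auto intro!: tendsto_intros)
  then show ?thesis unfolding peval_intertwine using LIMSEQ_unique by blast
qed

section \<open>Powers of strongly invariant order ideals\<close>

text \<open>For \<open>e > 0\<close>, the power of \<open>b + e *\<^sub>R 1\<close> with an exponent
  of either sign; the shift makes up for \<open>b\<close> not being invertible.\<close>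

definition shift_upow :: "'a::unital_cstar_algebra \<Rightarrow> real \<Rightarrow> real \<Rightarrow> 'a" where
  "shift_upow b e s = rcalc b (\<lambda>t. (t + e) powr s)"

lemma shift_upow_mult:
  "b \<in> upos \<Longrightarrow> 0 < e \<Longrightarrow> shift_upow b e s * shift_upow b e q = shift_upow b e (s + q)"
  unfolding shift_upow_def by (simp add: rcalc_mult[symmetric] continuous_on_shift_powr powr_add)

lemma star_shift_upow: "b \<in> upos \<Longrightarrow> 0 < e \<Longrightarrow> star (shift_upow b e s) = shift_upow b e s"
  unfolding shift_upow_def by (rule star_rcalc) (auto intro: continuous_on_shift_powr)

lemma shift_upow_0: "b \<in> upos \<Longrightarrow> 0 < e \<Longrightarrow> shift_upow b e 0 = 1"
proof -
  assume b: "b \<in> upos" and e: "0 < e"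
  have "shift_upow b e 0 = rcalc b (\<lambda>t. 1)"
    unfolding shift_upow_def by (rule rcalc_cong[OF b]) (use e in auto)
  then show ?thesis by (simp add: rcalc_const[OF b])
qed

section \<open>The Loewner-Heinz inequality\<close>

lemma norm_upow_le:
  assumes "a \<in> upos" "0 < s" "s \<le> 1"
  shows "norm (upow a s) \<le> 1 + norm a"
  unfolding upow_def
proof (rule norm_rcalc_le[OF assms(1)])
  fix t assume t: "0 \<le> t" "t \<le> norm a"
  have "t powr s \<le> (1 + t) powr s" using t assms by (intro powr_mono2) auto
  also have "\<dots> \<le> (1 + t) powr 1" using t assms by (intro powr_mono) auto
  finally show "\<bar>t powr s\<bar> \<le> 1 + norm a" using t by simp
qed (intro continuous_on_powr_nonneg assms)

lemma norm_shift_upow_le: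
  assumes "b \<in> upos" "0 < e" "0 < s" "s \<le> 1"
  shows "norm (shift_upow b e (- s)) \<le> 1 + 1 / e"
  unfolding shift_upow_def
proof (rule norm_rcalc_le[OF assms(1)])
  fix t :: real assume t: "0 \<le> t"
  have "(t + e) powr (- s) \<le> e powr (- s)" using t assms by (intro powr_mono2') auto
  also have "\<dots> = (1 / e) powr s" using assms by (simp add: powr_minus_divide powr_divide)
  also have "\<dots> \<le> (1 + 1 / e) powr s" using assms by (intro powr_mono2) auto
  also have "\<dots> \<le> (1 + 1 / e) powr 1" using assms by (intro powr_mono) auto
  finally show "\<bar>(t + e) powr (- s)\<bar> \<le> 1 + 1 / e" using assms by simp
qed (intro continuous_on_shift_powr assms)

text \<open>The function \<open>\<phi> s\<close> below satisfies \<open>\<phi> s ^ 2 \<le> \<phi> (2 s)\<close> for \<open>s \<le> 1/4\<close> and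
  \<open>\<phi> s ^ 2 \<le> \<phi> (2 s - 1/2)\<close> otherwise, so its supremum \<open>B\<close> satisfies \<open>B ^ 2 \<le> B\<close>. This
  replaces the usual density argument in the proof of the Loewner-Heinz inequality.\<close>

lemma upow_shift_contraction:
  assumes a: "a \<in> upos" and b: "b \<in> upos" and ab: "a \<preceq> b" and e: "0 < e"
    and s: "0 < s" "s \<le> 1/2"
  shows "norm (upow a s * shift_upow b e (- s)) \<le> 1"
proof -
  define U where "U q = shift_upow b e (- q)" for q
  define \<phi> where "\<phi> q = norm (upow a q * U q)" for q
  have UU: "U p * U q = U (p + q)" for p q
    unfolding U_def by (simp add: shift_upow_mult[OF b e])
  have Us: "star (U q) = U q" for q unfolding U_def by (rule star_shift_upow[OF b e])
  have as: "star (upow a q) = upow a q" if "0 < q" for q using upow_star[OF a that] .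
  have sq: "(\<phi> q)\<^sup>2 = norm (U q * upow a (2 * q) * U q)" if q: "0 < q" for q
  proof -
    have "(\<phi> q)\<^sup>2 = norm (star (upow a q * U q) * (upow a q * U q))"
      unfolding \<phi>_def by (rule cstar_identity[symmetric])
    also have "star (upow a q * U q) * (upow a q * U q) = U q * (upow a q * upow a q) * U q"
      by (simp add: star_mult Us as q mult.assoc)
    finally show ?thesis by (simp only: upow_mult[OF a q q] mult_2)
  qed
  have sa: "star (U q * upow a (2 * q) * U q) = U q * upow a (2 * q) * U q" if q: "0 < q" for q
    using q by (simp add: star_mult Us as mult.assoc)
  \<comment> \<open>The hypothesis \<open>a \<preceq> b\<close> enters here and reaches other
    exponents through \<open>hi\<close>.\<close>
  have half: "\<phi> (1/2) \<le> 1"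
  proof -
    have "(\<phi> (1/2))\<^sup>2 = norm (U (1/2) * a * U (1/2))"
      using sq[of "1/2"] by (simp add: upow_one[OF a])
    also have "\<dots> \<le> norm (U (1/2) * b * U (1/2))"
      using conj_upos[OF a, of "U (1/2)"] conj_mono_sa[OF Us ab] by (intro upos_norm_mono) (simp_all add: Us)
    also have "U (1/2) * b * U (1/2) = rcalc b (\<lambda>t. (t + e) powr (-1/2) * t * (t + e) powr (-1/2))"
      unfolding U_def shift_upow_def
      by (simp add: rcalc_mult[OF b] rcalc_id[OF b] continuous_on_shift_powr e continuous_intros)
    also have "norm \<dots> \<le> 1"
    proof (rule norm_rcalc_le[OF b])
      fix t :: real assume t: "0 \<le> t"
      have "(t + e) powr (-1/2) * t * (t + e) powr (-1/2) = t * ((t + e) powr (-1/2) * (t + e) powr (-1/2))"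
        by (simp add: ac_simps)
      also have "\<dots> = t / (t + e)"
        unfolding powr_add[symmetric] using t e by (simp add: powr_neg_one)
      finally show "\<bar>(t + e) powr (-1/2) * t * (t + e) powr (-1/2)\<bar> \<le> 1" using t e by simp
    qed (intro continuous_intros continuous_on_shift_powr e)
    finally show ?thesis by (simp add: \<phi>_def power2_le_iff_abs_le abs_square_le_1)
  qed
  have lo: "(\<phi> q)\<^sup>2 \<le> \<phi> (2 * q)" if q: "0 < q" for q
  proof -
    have "norm (U q * (upow a (2 * q) * U q)) \<le> norm (upow a (2 * q) * U q * U q)"
      using sa[OF q] by (intro norm_mult_swap) (simp add: mult.assoc)
    also have "upow a (2 * q) * U q * U q = upow a (2 * q) * U (2 * q)"
      by (simp only: mult.assoc UU mult_2)
    finally show ?thesis unfolding sq[OF q] unfolding \<phi>_def by (simp only: mult.assoc)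
  qed
  have hi: "(\<phi> q)\<^sup>2 \<le> \<phi> (2 * q - 1/2)" if q: "1/4 < q" for q
  proof -
    \<comment> \<open>\<open>?p\<close> is chosen so that \<open>2 * q = 1/2 + ?p\<close> and
      \<open>(q - ?p) + q = 1/2\<close>. Once \<open>U (q - ?p)\<close> is moved to the front, the
      product splits into the adjoint of the case \<open>1/2\<close>, a contraction, and the case
      \<open>?p\<close>.\<close>
    let ?p = "2 * q - 1/2"
    have p: "0 < ?p" using q by simp
    have split: "U q = U ?p * U (q - ?p)" by (simp add: UU)
    have half_split: "upow a (1/2 + ?p) = upow a (1/2) * upow a ?p"
      using upow_mult[OF a _ p, of "1/2"] by simp
    have UU_half: "U (q - ?p) * U q = U (1/2)" by (simp add: UU)
    have eq: "U q * upow a (2 * q) * U ?p * U (q - ?p) = U q * upow a (2 * q) * U q"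
      by (subst (3) split) (simp add: mult.assoc)
    have "norm (U q * upow a (2 * q) * U ?p * U (q - ?p)) \<le> norm (U (q - ?p) * (U q * upow a (2 * q) * U ?p))"
      by (rule norm_mult_swap, unfold eq, rule sa) (use q in simp)
    also have "U (q - ?p) * (U q * upow a (2 * q) * U ?p) = (U (q - ?p) * U q) * upow a (1/2 + ?p) * U ?p"
      by (simp add: mult.assoc)
    also have "\<dots> = star (upow a (1/2) * U (1/2)) * (upow a ?p * U ?p)"
      unfolding half_split UU_half by (simp add: star_mult Us as mult.assoc)
    also have "norm \<dots> \<le> \<phi> (1/2) * \<phi> ?p"
      unfolding \<phi>_def by (rule order_trans[OF norm_mult_ineq]) simp
    also have "\<dots> \<le> 1 * \<phi> ?p" using half by (intro mult_right_mono) (auto simp: \<phi>_def)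
    finally show ?thesis unfolding sq[OF order.strict_trans[OF _ q], simplified] eq by simp
  qed
  define B where "B = (SUP q\<in>{0<..1/2}. \<phi> q)"
  \<comment> \<open>A crude bound; what counts is that it is uniform in \<open>q\<close>, so that
    the supremum is finite.\<close>
  have bdd: "bdd_above (\<phi> ` {0<..1/2})"
  proof (rule bdd_aboveI2)
    fix q :: real assume q: "q \<in> {0<..1/2}"
    show "\<phi> q \<le> (1 + norm a) * (1 + 1 / e)"
      unfolding \<phi>_def U_def using q e
      by (intro order_trans[OF norm_mult_ineq] mult_mono norm_upow_le norm_shift_upow_le a b) auto
  qed
  have le: "\<phi> q \<le> B" if "0 < q" "q \<le> 1/2" for q
    unfolding B_def using that by (intro cSUP_upper bdd) auto
  have sqB: "(\<phi> q)\<^sup>2 \<le> B" if q: "0 < q" "q \<le> 1/2" for q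
  proof (cases "q \<le> 1/4")
    case True
    then show ?thesis using lo[OF q(1)] le[of "2 * q"] q by simp
  next
    case False
    then show ?thesis using hi[of q] le[of "2 * q - 1/2"] q by simp
  qed
  have B0: "0 \<le> B" using sqB[OF s] by (smt (verit) zero_le_power2)
  have "B \<le> sqrt B"
    unfolding B_def
  proof (rule cSUP_least)
    fix q :: real assume "q \<in> {0<..1/2}"
    then show "\<phi> q \<le> sqrt (SUP q\<in>{0<..1/2}. \<phi> q)"
      using sqB[of q] unfolding B_def by (intro real_le_rsqrt) auto
  qed simp
  then have "B * B \<le> B * 1" using B0 mult_mono[of B "sqrt B" B "sqrt B"] by simp
  then have "B \<le> 1" using B0 by (cases "B = 0") auto
  then show ?thesis using le[OF s] by (simp add: \<phi>_def U_def)
qed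

text \<open>A number in the unit interval does not decrease when raised to the power
  \<open>r\<close>; this is applied to the shares of \<open>x\<close> and \<open>y\<close> in
  \<open>x + y\<close>.\<close>

lemma powr_add_le:
  fixes x y r :: real
  assumes "0 \<le> x" "0 < y" "0 < r" "r \<le> 1"
  shows "(x + y) powr r \<le> x powr r + y powr r"
proof -
  have le: "u / (x + y) \<le> (u / (x + y)) powr r" if "0 \<le> u" "u \<le> x + y" for u
    using powr_mono'[of r 1 "u / (x + y)"] that assms by simp
  have "1 = x / (x + y) + y / (x + y)" using assms by (simp add: add_divide_distrib[symmetric])
  also have "\<dots> \<le> (x powr r + y powr r) / (x + y) powr r"
    using le[of x] le[of y] assms by (simp add: powr_divide add_divide_distrib)
  finally show ?thesis using assms by (simp add: pos_le_divide_eq)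
qed

lemma tendsto_inverse_powr: "0 < r \<Longrightarrow> (\<lambda>n. inverse (real (Suc n)) powr r) \<longlonglongrightarrow> 0"
  using tendsto_zero_powrI[OF LIMSEQ_inverse_real_of_nat tendsto_const[of r]] by simp

text \<open>The contraction \<open>?w\<close> gives \<open>star ?w * ?w \<preceq> 1\<close>, and
  conjugating with \<open>?U (r/2)\<close> cancels its negative powers; what results is an
  inequality for the shifted \<open>b\<close>, and the order is closed under letting the shift tend
  to \<open>0\<close>.\<close>

lemma upow_mono:
  assumes a: "a \<in> upos" and b: "b \<in> upos" and ab: "a \<preceq> b" and r: "0 < r" "r \<le> 1"
  shows "upow a r \<preceq> upow b r"
proof (rule upos_le_limit)
  let ?e = "\<lambda>n. inverse (real (Suc n))"
  show "(\<lambda>n. upow a r) \<longlonglongrightarrow> upow a r" by simp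
  show "(\<lambda>n. shift_upow b (?e n) r) \<longlonglongrightarrow> upow b r"
    unfolding upow_def shift_upow_def
  proof (rule rcalc_tendsto[OF b _ _ tendsto_inverse_powr[OF r(1)]])
    fix n and t :: real assume t: "0 \<le> t"
    have "t powr r \<le> (t + ?e n) powr r" using t r by (intro powr_mono2) auto
    then show "\<bar>(t + ?e n) powr r - t powr r\<bar> \<le> ?e n powr r"
      using powr_add_le[of t "?e n" r] t r by simp
  qed (auto intro!: continuous_on_shift_powr continuous_on_powr_nonneg r)
  fix n
  define e where "e = ?e n"
  have e: "0 < e" by (simp add: e_def)
  let ?U = "shift_upow b e"
  let ?w = "upow a (r/2) * ?U (- (r/2))"
  have sU: "star (?U q) = ?U q" for q by (rule star_shift_upow[OF b e])
  have sa: "star (upow a (r/2)) = upow a (r/2)" using r by (intro upow_star a) simp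
  have "norm ?w \<le> 1" using r by (intro upow_shift_contraction a b ab e) auto
  then have "norm (star ?w * ?w) \<le> 1" unfolding cstar_identity by (simp add: power_le_one)
  then have "star ?w * ?w \<preceq> 1 *\<^sub>R 1" by (intro selfadjoint_le_norm) (simp_all add: star_mult mult.assoc)
  then have "?U (r/2) * (star ?w * ?w) * ?U (r/2) \<preceq> ?U (r/2) * (1 *\<^sub>R 1) * ?U (r/2)"
    by (intro conj_mono_sa sU)
  moreover have "?U (r/2) * (star ?w * ?w) * ?U (r/2) =
      (?U (r/2) * ?U (- (r/2))) * (upow a (r/2) * upow a (r/2)) * (?U (- (r/2)) * ?U (r/2))"
    by (simp add: star_mult sU sa mult.assoc)
  moreover have "\<dots> = upow a r"
    using upow_mult[OF a, of "r/2" "r/2"] r by (simp add: shift_upow_mult[OF b e] shift_upow_0[OF b e])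
  ultimately have "upow a r \<preceq> ?U (r/2) * ?U (r/2)" by simp
  then show "upow a r \<preceq> shift_upow b (?e n) r"
    unfolding e_def[symmetric] by (simp add: shift_upow_mult[OF b e])
qed

text \<open>The point is uniformity in \<open>t\<close>. With \<open>p = (1 - r)/2\<close> and
  \<open>y = t / (t + e)\<close> the difference is \<open>t powr (r/2) * (y powr p - 1)\<close>. Its
  second factor is bounded by \<open>1 - y = e / (t + e)\<close>, which is at most
  \<open>(e / (t + e)) powr (r/2)\<close> and so absorbs \<open>t powr (r/2)\<close>.\<close>

lemma shift_powr_bound:
  fixes t e r :: real
  assumes "0 \<le> t" "0 < e" "0 < r" "r \<le> 1"
  shows "\<bar>t powr (1/2) * (t + e) powr (- ((1 - r)/2)) - t powr (r/2)\<bar> \<le> e powr (r/2)"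
proof (cases "t = 0")
  case False
  then have t: "0 < t" using assms by simp
  define p where "p = (1 - r) / 2"
  have p: "0 \<le> p" "p \<le> 1" using assms by (auto simp: p_def)
  define y where "y = t / (t + e)"
  have y: "0 < y" "y \<le> 1" "1 - y = e / (t + e)" using t assms by (auto simp: y_def field_simps)
  have "t powr (1/2) = t powr (r/2) * t powr p"
    unfolding powr_add[symmetric] by (simp add: p_def field_simps)
  moreover have "y powr p = t powr p * (t + e) powr (- p)"
    unfolding y_def using t assms by (simp add: powr_divide powr_minus_divide)
  ultimately have "t powr (1/2) * (t + e) powr (- p) = t powr (r/2) * y powr p"
    by (simp only: mult.assoc)
  then have "t powr (1/2) * (t + e) powr (- p) - t powr (r/2) = t powr (r/2) * (y powr p - 1)"
    by (simp add: right_diff_distrib)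
  then have "\<bar>t powr (1/2) * (t + e) powr (- p) - t powr (r/2)\<bar> = t powr (r/2) * \<bar>y powr p - 1\<bar>"
    by (simp add: abs_mult)
  also have "\<bar>y powr p - 1\<bar> \<le> 1 - y"
    using powr_mono'[of p 1 y] powr_mono'[of 0 p y] y p by auto
  also have "1 - y \<le> (e / (t + e)) powr (r/2)"
    using powr_mono'[of "r/2" 1 "e / (t + e)"] assms t y by simp
  also have "t powr (r/2) * (e / (t + e)) powr (r/2) \<le> (t + e) powr (r/2) * (e / (t + e)) powr (r/2)"
    using assms t by (intro mult_right_mono powr_mono2) auto
  also have "\<dots> = e powr (r/2)" using assms t by (simp add: powr_divide)
  finally show ?thesis using assms t by (simp add: p_def mult_left_mono)
qed (use assms in simp)

lemma shift_upow_sandwich: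
  assumes c: "c \<in> upos" and e: "0 < e"
  shows "shift_upow c e s * c * shift_upow c e s = rcalc c (\<lambda>t. (t powr (1/2) * (t + e) powr s)\<^sup>2)"
proof -
  have "shift_upow c e s * c * shift_upow c e s = rcalc c (\<lambda>t. (t + e) powr s * t * (t + e) powr s)"
    unfolding shift_upow_def
    by (simp add: rcalc_mult[OF c] rcalc_id[OF c] continuous_on_shift_powr e continuous_intros)
  also have "\<dots> = rcalc c (\<lambda>t. (t powr (1/2) * (t + e) powr s)\<^sup>2)"
  proof (rule rcalc_cong[OF c])
    fix t :: real assume "0 \<le> t"
    then have "(t powr (1/2))\<^sup>2 = t" by (simp add: powr_half_sqrt)
    then show "(t + e) powr s * t * (t + e) powr s = (t powr (1/2) * (t + e) powr s)\<^sup>2"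
      unfolding power_mult_distrib by (simp add: power2_eq_square)
  qed
  finally show ?thesis .
qed

text \<open>The outer factors contribute the exponent \<open>- (1 - r)\<close> and the middle one
  \<open>1\<close>, which leaves \<open>r\<close>. In this way the power is reached by expressions
  that are additive in the middle factor.\<close>

lemma shift_upow_sandwich_tendsto:
  assumes c: "c \<in> upos" and r: "0 < r" "r \<le> 1"
  defines "F \<equiv> \<lambda>n. shift_upow c (inverse (real (Suc n))) (- ((1 - r)/2))"
  shows "(\<lambda>n. F n * c * F n) \<longlonglongrightarrow> upow c r"
proof -
  let ?e = "\<lambda>n. inverse (real (Suc n))"
  have "(\<lambda>n. rcalc c (\<lambda>t. (t powr (1/2) * (t + ?e n) powr (- ((1 - r)/2)))\<^sup>2)) \<longlonglongrightarrow> upow c r"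
    unfolding upow_def
  proof (rule rcalc_tendsto[OF c])
    have "(\<lambda>n. ?e n powr (r/2) * (?e n powr (r/2) + 2 * (1 + norm c))) \<longlonglongrightarrow> 0 * (0 + 2 * (1 + norm c))"
      using r by (intro tendsto_intros tendsto_inverse_powr) auto
    then show "(\<lambda>n. ?e n powr (r/2) * (?e n powr (r/2) + 2 * (1 + norm c))) \<longlonglongrightarrow> 0" by simp
    fix n and t :: real assume t: "0 \<le> t" "t \<le> norm c"
    define A B E where "A = t powr (1/2) * (t + ?e n) powr (- ((1 - r)/2))" and "B = t powr (r/2)"
      and "E = ?e n powr (r/2)"
    have AB: "\<bar>A - B\<bar> \<le> E" unfolding A_def B_def E_def using t r by (intro shift_powr_bound) auto
    have B: "0 \<le> B" "B \<le> 1 + norm c"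
    proof -
      have "t powr (r/2) \<le> (1 + t) powr (r/2)" using t r by (intro powr_mono2) auto
      also have "\<dots> \<le> (1 + t) powr 1" using t r by (intro powr_mono) auto
      finally show "B \<le> 1 + norm c" using t by (simp add: B_def)
    qed (simp add: B_def)
    have "t powr r = B\<^sup>2" by (simp add: B_def power2_eq_square powr_add[symmetric])
    then have "\<bar>A\<^sup>2 - t powr r\<bar> = \<bar>A - B\<bar> * \<bar>(A - B) + 2 * B\<bar>"
      by (simp add: abs_mult[symmetric] power2_eq_square algebra_simps)
    also have "\<dots> \<le> E * (E + 2 * (1 + norm c))"
      using AB B by (intro mult_mono) auto
    finally show "\<bar>(t powr (1/2) * (t + ?e n) powr (- ((1 - r)/2)))\<^sup>2 - t powr r\<bar>
        \<le> ?e n powr (r/2) * (?e n powr (r/2) + 2 * (1 + norm c))"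
      by (simp only: A_def E_def)
  qed (auto intro!: continuous_intros continuous_on_shift_powr continuous_on_powr_nonneg r)
  then show ?thesis unfolding F_def by (simp add: shift_upow_sandwich[OF c])
qed

text \<open>A substitute for the polar decomposition: the limit is \<open>x c\<^sup>-\<^sup>(\<^sup>1\<^sup>-\<^sup>r\<^sup>)\<^sup>/\<^sup>2\<close>.\<close>

lemma weak_polar:
  assumes c: "c \<in> upos" and xc: "star x * x \<preceq> c" and r: "0 < r" "r \<le> 1"
  obtains y where "(\<lambda>n. x * shift_upow c (inverse (real (Suc n))) (- ((1 - r)/2))) \<longlonglongrightarrow> y"
proof -
  let ?e = "\<lambda>n. inverse (real (Suc n))"
  define f where "f n t = (t + ?e n) powr (- ((1 - r)/2))" for n t
  have cf: "continuous_on {0..} (f n)" for n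
    unfolding f_def by (intro continuous_on_shift_powr) auto
  define F where "F n = rcalc c (f n)" for n
  have le: "norm (x * F n - x * F m) \<le> ?e n powr (r/2) + ?e m powr (r/2)" for n m
  proof -
    define d where "d t = f n t - f m t" for t
    have cd: "continuous_on {0..} d" unfolding d_def by (intro continuous_intros cf)
    have D: "F n - F m = rcalc c d" unfolding F_def d_def by (simp add: rcalc_diff[OF c] cf)
    have sD: "star (rcalc c d) = rcalc c d" by (rule star_rcalc[OF c cd])
    \<comment> \<open>The C*-identity turns the norm into that of a sandwich around
      \<open>star x * x\<close>, where \<open>xc\<close> replaces it by \<open>c\<close>; the rest
      is the calculus of \<open>c\<close>.\<close>
    have "(norm (x * F n - x * F m))\<^sup>2 = norm (star (x * rcalc c d) * (x * rcalc c d))"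
      by (simp add: cstar_identity right_diff_distrib[symmetric] D)
    also have "\<dots> = norm (rcalc c d * (star x * x) * rcalc c d)"
      by (simp add: star_mult sD mult.assoc)
    also have "\<dots> \<le> norm (rcalc c d * c * rcalc c d)"
      using conj_upos[OF star_mult_self_upos, of "rcalc c d" x] conj_mono_sa[OF sD xc]
      by (intro upos_norm_mono) (simp_all add: sD)
    also have "rcalc c d * c * rcalc c d = rcalc c (\<lambda>t. d t * t * d t)"
      by (simp add: rcalc_mult[OF c] rcalc_id[OF c] cd continuous_intros)
    also have "norm \<dots> \<le> (?e n powr (r/2) + ?e m powr (r/2))\<^sup>2"
    proof (rule norm_rcalc_le[OF c])
      fix t :: real assume t: "0 \<le> t"
      have "\<bar>t powr (1/2) * f k t - t powr (r/2)\<bar> \<le> ?e k powr (r/2)" for k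
        unfolding f_def using t r by (intro shift_powr_bound) auto
      from this[of n] this[of m]
      have "\<bar>t powr (1/2) * f n t - t powr (1/2) * f m t\<bar> \<le> ?e n powr (r/2) + ?e m powr (r/2)"
        by linarith
      then have "(t powr (1/2) * d t)\<^sup>2 \<le> (?e n powr (r/2) + ?e m powr (r/2))\<^sup>2"
        unfolding d_def right_diff_distrib by (rule abs_le_square_iff[THEN iffD1, OF order_trans]) simp
      moreover have "(t powr (1/2) * d t)\<^sup>2 = d t * t * d t"
        using t by (simp add: power2_eq_square powr_half_sqrt algebra_simps)
      ultimately show "\<bar>d t * t * d t\<bar> \<le> (?e n powr (r/2) + ?e m powr (r/2))\<^sup>2"
        by (metis abs_of_nonneg zero_le_power2)
    qed (intro continuous_intros cd)
    finally show ?thesis by (rule power2_le_imp_le) simp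
  qed
  have "Cauchy (\<lambda>n. x * F n)"
  proof (rule CauchyI)
    fix d :: real assume d: "0 < d"
    have "\<forall>\<^sub>F n in sequentially. ?e n powr (r/2) < d/2"
      using order_tendstoD(2)[OF tendsto_inverse_powr[of "r/2"], of "d/2"] d r by simp
    then obtain N where N: "\<And>n. n \<ge> N \<Longrightarrow> ?e n powr (r/2) < d/2"
      unfolding eventually_sequentially by blast
    have "norm (x * F m - x * F n) < d" if "m \<ge> N" "n \<ge> N" for m n
      using le[of m n] N[OF that(1)] N[OF that(2)] by linarith
    then show "\<exists>M. \<forall>m\<ge>M. \<forall>n\<ge>M. norm (x * F m - x * F n) < d" by blast
  qed
  then obtain y where "(\<lambda>n. x * F n) \<longlonglongrightarrow> y"
    using Cauchy_convergent convergent_def by blast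
  then show thesis unfolding F_def f_def shift_upow_def[symmetric] by (rule that)
qed

text \<open>\<open>v\<close> is a limit standing for \<open>x\<close> times the power
  \<open>-1/4\<close> of \<open>h\<close>. The exponent balances the two factors:
  \<open>star v * v\<close> and the square of \<open>upow h (1/4)\<close> are both
  \<open>upow h (1/2)\<close>, so one membership serves for both.\<close>

lemma polar_factor:
  fixes x :: "'a::unital_cstar_algebra"
  defines "h \<equiv> star x * x"
  obtains v where "x = v * upow h (1/4)" "star v * v = upow h (1/2)"
proof -
  let ?e = "\<lambda>n. inverse (real (Suc n))"
  have h: "h \<in> upos" unfolding h_def by (rule star_mult_self_upos)
  define f where "f n t = (t + ?e n) powr (- (1/4))" for n t
  have cf: "continuous_on {0..} (f n)" for n
    unfolding f_def by (intro continuous_on_shift_powr) auto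
  define F where "F n = rcalc h (f n)" for n
  have sF: "star (F n) = F n" for n unfolding F_def by (rule star_rcalc[OF h cf])
  obtain v where "(\<lambda>n. x * shift_upow h (?e n) (- ((1 - 1/2)/2))) \<longlonglongrightarrow> v"
    using weak_polar[OF h, of x "1/2"] by (auto simp: h_def)
  then have v: "(\<lambda>n. x * F n) \<longlonglongrightarrow> v" by (simp add: F_def f_def[abs_def] shift_upow_def)
  have "(\<lambda>n. star (x * F n) * (x * F n)) \<longlonglongrightarrow> star v * v" by (intro tendsto_intros v)
  moreover have "star (x * F n) * (x * F n) = F n * h * F n" for n
    by (simp add: star_mult sF h_def mult.assoc)
  ultimately have "(\<lambda>n. F n * h * F n) \<longlonglongrightarrow> star v * v" by simp
  moreover have "(\<lambda>n. F n * h * F n) \<longlonglongrightarrow> upow h (1/2)"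
    using shift_upow_sandwich_tendsto[OF h, of "1/2"] by (simp add: F_def f_def[abs_def] shift_upow_def)
  ultimately have 1: "star v * v = upow h (1/2)" by (rule LIMSEQ_unique)
  have "(\<lambda>n. x * F n * upow h (1/4)) \<longlonglongrightarrow> x"
  proof -
    have "norm (x * F n * upow h (1/4) - x) \<le> ?e n powr (1/4) * (1 + norm h)" for n
    proof -
      define d where "d t = f n t * t powr (1/4) - 1" for t
      have cd: "continuous_on {0..} d" unfolding d_def
        by (intro continuous_intros cf continuous_on_powr_nonneg) simp
      have rd: "rcalc h d = F n * upow h (1/4) - 1"
        unfolding d_def F_def upow_def
        by (simp add: rcalc_diff[OF h] rcalc_mult[OF h] rcalc_const[OF h] cf continuous_on_powr_nonneg continuous_on_mult)
      have D: "x * F n * upow h (1/4) - x = x * rcalc h d"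
        unfolding rd by (simp add: right_diff_distrib mult.assoc)
      have sD: "star (rcalc h d) = rcalc h d" by (rule star_rcalc[OF h cd])
      have "(norm (x * F n * upow h (1/4) - x))\<^sup>2 = norm (star (x * rcalc h d) * (x * rcalc h d))"
        by (simp add: cstar_identity D)
      also have "star (x * rcalc h d) * (x * rcalc h d) = rcalc h d * h * rcalc h d"
        unfolding star_mult sD by (simp add: h_def mult.assoc)
      also have "\<dots> = rcalc h (\<lambda>t. d t * t * d t)"
        by (simp add: rcalc_mult[OF h] rcalc_id[OF h] cd continuous_intros)
      also have "norm \<dots> \<le> (?e n powr (1/4) * (1 + norm h))\<^sup>2"
      proof (rule norm_rcalc_le[OF h])
        fix t :: real assume t: "0 \<le> t" "t \<le> norm h"
        have q: "t powr (1/4) * t powr (1/4) = t powr (1/2)" by (simp add: powr_add[symmetric])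
        have "t powr (1/4) \<le> (1 + t) powr (1/4)" using t by (intro powr_mono2) auto
        also have "\<dots> \<le> (1 + t) powr 1" using t by (intro powr_mono) auto
        finally have t4: "t powr (1/4) \<le> 1 + norm h" using t by simp
        have "t powr (1/2) * d t = t powr (1/4) * (t powr (1/2) * f n t - t powr (1/4))"
          unfolding d_def q[symmetric] by (simp add: algebra_simps)
        moreover have "\<bar>t powr (1/2) * f n t - t powr (1/4)\<bar> \<le> ?e n powr (1/4)"
          unfolding f_def using shift_powr_bound[of t "?e n" "1/2"] t by simp
        ultimately have "\<bar>t powr (1/2) * d t\<bar> \<le> ?e n powr (1/4) * (1 + norm h)"
          using mult_mono[OF t4, of "\<bar>t powr (1/2) * f n t - t powr (1/4)\<bar>" "?e n powr (1/4)"] t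
          by (simp add: abs_mult mult.commute)
        then have "(t powr (1/2) * d t)\<^sup>2 \<le> (?e n powr (1/4) * (1 + norm h))\<^sup>2"
          by (rule abs_le_square_iff[THEN iffD1, OF order_trans]) simp
        moreover have "(t powr (1/2) * d t)\<^sup>2 = d t * t * d t"
          using t by (simp add: power2_eq_square powr_half_sqrt algebra_simps)
        ultimately show "\<bar>d t * t * d t\<bar> \<le> (?e n powr (1/4) * (1 + norm h))\<^sup>2"
          by (metis abs_of_nonneg zero_le_power2)
      qed (intro continuous_intros cd)
      finally show ?thesis by (rule power2_le_imp_le) simp
    qed
    then have "\<forall>\<^sub>F n in sequentially. norm (x * F n * upow h (1/4) - x) \<le> ?e n powr (1/4) * (1 + norm h)"
      by (intro always_eventually allI)
    moreover have "(\<lambda>n. ?e n powr (1/4) * (1 + norm h)) \<longlonglongrightarrow> 0"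
      using tendsto_mult_left_zero[OF tendsto_inverse_powr[of "1/4"]] by simp
    ultimately have "(\<lambda>n. x * F n * upow h (1/4) - x) \<longlonglongrightarrow> 0"
      by (rule Lim_null_comparison)
    then show ?thesis by (rule LIM_zero_cancel)
  qed
  moreover have "(\<lambda>n. x * F n * upow h (1/4)) \<longlonglongrightarrow> v * upow h (1/4)" by (intro tendsto_intros v)
  ultimately have "x = v * upow h (1/4)" by (rule LIMSEQ_unique)
  with 1 that show thesis by blast
qed

text \<open>The unital counterpart of the positive part of a Dixmier ideal. One implication
  expresses strong invariance, as putting \<open>star x\<close> for \<open>x\<close> gives the
  other.\<close>

definition strong_order_ideal :: "'a::unital_cstar_algebra set \<Rightarrow> bool" where
  "strong_order_ideal M \<longleftrightarrow> M \<subseteq> upos \<and> 0 \<in> M \<and> (\<forall>a\<in>M. \<forall>b\<in>M. a + b \<in> M) \<and>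
     (\<forall>a\<in>upos. \<forall>b\<in>M. a \<preceq> b \<longrightarrow> a \<in> M) \<and> (\<forall>x. star x * x \<in> M \<longrightarrow> x * star x \<in> M)"

lemma strong_order_idealD:
  assumes "strong_order_ideal M"
  shows "a \<in> M \<Longrightarrow> a \<in> upos" "0 \<in> M" "a \<in> M \<Longrightarrow> b \<in> M \<Longrightarrow> a + b \<in> M"
    "a \<in> upos \<Longrightarrow> a \<preceq> b \<Longrightarrow> b \<in> M \<Longrightarrow> a \<in> M" "star x * x \<in> M \<Longrightarrow> x * star x \<in> M"
    "x * star x \<in> M \<Longrightarrow> star x * x \<in> M"
proof -
  have si: "\<And>x. star x * x \<in> M \<Longrightarrow> x * star x \<in> M" using assms by (auto simp: strong_order_ideal_def)
  show "x * star x \<in> M \<Longrightarrow> star x * x \<in> M" using si[of "star x"] by simp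
qed (use assms in \<open>auto simp: strong_order_ideal_def\<close>)

text \<open>By \<open>cstar_powr_image\<close>, this corresponds to taking the powers with exponent
  \<open>1/r\<close> of the elements of \<open>M\<close>. As a preimage, it makes membership of
  \<open>b\<close> a condition on one power of \<open>b\<close>, which suits sums and
  inequalities.\<close>

definition upow_preimage :: "real \<Rightarrow> 'a::unital_cstar_algebra set \<Rightarrow> 'a set" where
  "upow_preimage r M = {b \<in> upos. upow b r \<in> M}"

lemma upow_preimage_mult:
  "0 < r \<Longrightarrow> 0 < q \<Longrightarrow> upow_preimage r (upow_preimage q M) = upow_preimage (r * q) M"
  by (auto simp: upow_preimage_def upow_upow upow_upos)

lemma upow_preimage_one: "strong_order_ideal M \<Longrightarrow> upow_preimage 1 M = M"
  unfolding upow_preimage_def by (auto simp: upow_one dest: strong_order_idealD(1))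

lemma upow_0: "0 < s \<Longrightarrow> upow 0 s = 0"
  unfolding upow_def using norm_rcalc_le[OF upos_0, of "\<lambda>t. t powr s" 0]
  by (simp add: continuous_on_powr_nonneg)

lemma strong_order_ideal_upow_preimage_2:
  assumes M: "strong_order_ideal M"
  shows "strong_order_ideal (upow_preimage 2 M)"
proof -
  note MD = strong_order_idealD[OF M]
  have mem: "b \<in> upow_preimage 2 M \<longleftrightarrow> b \<in> upos \<and> b * b \<in> M" for b
    by (auto simp: upow_preimage_def upow_two)
  show ?thesis
    unfolding strong_order_ideal_def
  proof (intro conjI ballI allI impI)
    show "upow_preimage 2 M \<subseteq> upos" "0 \<in> upow_preimage 2 M"
      by (auto simp: mem MD(2))
  next
    fix a b assume "a \<in> upow_preimage 2 M" "b \<in> upow_preimage 2 M"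
    then have ab: "a \<in> upos" "b \<in> upos" "a * a \<in> M" "b * b \<in> M" by (auto simp: mem)
    \<comment> \<open>The parallelogram law: the squares of \<open>a + b\<close> and
      \<open>a - b\<close> add up to twice \<open>a * a + b * b\<close>.\<close>
    have "(a - b) * (a - b) \<in> upos" using ab by (intro upos_square) (simp add: upos_star)
    then have "(a + b) * (a + b) \<preceq> (a * a + b * b) + (a * a + b * b)"
      by (simp add: upos_le_def algebra_simps)
    moreover have "(a + b) * (a + b) \<in> upos" using ab by (intro upos_square) (simp add: upos_star)
    ultimately show "a + b \<in> upow_preimage 2 M" using ab by (auto simp: mem upos_add intro: MD(3,4))
  next
    fix a b assume "a \<in> upos" "b \<in> upow_preimage 2 M" and ab: "a \<preceq> b"
    then have a: "a \<in> upos" and b: "b \<in> upos" "b * b \<in> M" by (auto simp: mem)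
    define s t where "s = upow a (1/2)" and "t = upow b (1/2)"
    have st: "star s = s" "star t = t" "s * s = a" "t * t = b"
      using a b by (simp_all add: s_def t_def upow_star upow_half_mult)
    have "t * a * t \<preceq> t * b * t" by (rule conj_mono_sa[OF st(2) ab])
    also have "t * b * t = b * b" unfolding st(4)[symmetric] by (simp add: mult.assoc)
    finally have "t * a * t \<in> M" using b(2) conj_upos[OF a, of t] st MD(4) by metis
    moreover have "star (s * t) * (s * t) = t * a * t" by (simp add: star_mult st(1,2) st(3)[symmetric] mult.assoc)
    moreover have "(s * t) * star (s * t) = s * b * s" by (simp add: star_mult st(1,2) st(4)[symmetric] mult.assoc)
    ultimately have sbs: "s * b * s \<in> M" using MD(5)[of "s * t"] by simp
    have "s * a * s \<preceq> s * b * s" by (rule conj_mono_sa[OF st(1) ab])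
    moreover have "s * a * s = a * a" unfolding st(3)[symmetric] by (simp add: mult.assoc)
    ultimately have "a * a \<preceq> s * b * s" by simp
    then have "a * a \<in> M" using sbs a by (intro MD(4)[of "a * a"] upos_square upos_star)
    then show "a \<in> upow_preimage 2 M" using a by (simp add: mem)
  next
    fix x assume "star x * x \<in> upow_preimage 2 M"
    define h where "h = star x * x"
    have h: "h \<in> upos" "h * h \<in> M" using \<open>star x * x \<in> upow_preimage 2 M\<close> by (auto simp: mem h_def)
    define s where "s = upow h (1/2)"
    have s: "star s = s" "s * s = h" using h by (simp_all add: s_def upow_star upow_half_mult)
    \<comment> \<open>The two products of \<open>x * s\<close> with its adjoint are the squares of
      \<open>star x * x\<close> and \<open>x * star x\<close>, so strong invariance of
      \<open>M\<close> is applied to \<open>x * s\<close>.\<close>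
    have "star (x * s) * (x * s) = s * h * s" by (simp add: star_mult s h_def mult.assoc)
    also have "\<dots> = h * h" unfolding s(2)[symmetric] by (simp add: mult.assoc)
    finally have "(x * s) * star (x * s) \<in> M" using h MD(5) by metis
    also have "(x * s) * star (x * s) = x * h * star x" by (simp add: star_mult s(1) s(2)[symmetric] mult.assoc)
    also have "\<dots> = (x * star x) * (x * star x)" by (simp add: h_def mult.assoc)
    finally show "x * star x \<in> upow_preimage 2 M" by (simp add: mem mult_star_self_upos)
  qed
qed

lemma strong_order_ideal_upow_preimage_less_1:
  assumes M: "strong_order_ideal M" and r: "0 < r" "r < 1"
  shows "strong_order_ideal (upow_preimage r M)"
proof -
  note MD = strong_order_idealD[OF M]
  let ?e = "\<lambda>n. inverse (real (Suc n))"
  let ?F = "\<lambda>c n. shift_upow c (?e n) (- ((1 - r)/2))"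
  have e: "0 < ?e n" for n by simp
  have mem: "b \<in> upow_preimage r M \<longleftrightarrow> b \<in> upos \<and> upow b r \<in> M" for b
    by (auto simp: upow_preimage_def)
  \<comment> \<open>Both products of one limit \<open>y\<close> are recorded: the first is a limit
    of sandwiches around \<open>star x * x\<close>, the second has the regularised power of
    \<open>c\<close> inside, and strong invariance of \<open>M\<close> exchanges them.\<close>
  have polar: "\<exists>y. (\<lambda>n. ?F c n * (star x * x) * ?F c n) \<longlonglongrightarrow> star y * y \<and>
      (\<lambda>n. x * (?F c n * ?F c n) * star x) \<longlonglongrightarrow> y * star y"
    if c: "c \<in> upos" and xc: "star x * x \<preceq> c" for c x
  proof -
    have s: "star (?F c n) = ?F c n" for n by (rule star_shift_upow[OF c e])
    obtain y where y: "(\<lambda>n. x * ?F c n) \<longlonglongrightarrow> y"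
      using weak_polar[OF c xc r(1)] r(2) by auto
    have "(\<lambda>n. star (x * ?F c n) * (x * ?F c n)) \<longlonglongrightarrow> star y * y"
      "(\<lambda>n. (x * ?F c n) * star (x * ?F c n)) \<longlonglongrightarrow> y * star y"
      by (intro tendsto_intros y)+
    then show ?thesis by (intro exI[of _ y]) (simp only: star_mult s mult.assoc)
  qed
  show ?thesis
    unfolding strong_order_ideal_def
  proof (intro conjI ballI allI impI)
    show "upow_preimage r M \<subseteq> upos" "0 \<in> upow_preimage r M"
      using r by (auto simp: mem MD(2) upow_0)
  next
    fix a b assume "a \<in> upow_preimage r M" "b \<in> upow_preimage r M"
    then have a: "a \<in> upos" "upow a r \<in> M" and b: "b \<in> upos" "upow b r \<in> M" by (auto simp: mem)
    define c where "c = a + b"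
    have c: "c \<in> upos" unfolding c_def using a b by (simp add: upos_add)
    have part: "\<exists>y. (\<lambda>n. ?F c n * d * ?F c n) \<longlonglongrightarrow> star y * y \<and> star y * y \<in> M"
      if d: "d \<in> upos" "upow d r \<in> M" and dc: "d \<preceq> c" for d
    proof -
      let ?x = "upow d (1/2)"
      have x: "star ?x = ?x" "?x * ?x = d" using d by (simp_all add: upow_star upow_half_mult)
      obtain y where y: "(\<lambda>n. ?F c n * d * ?F c n) \<longlonglongrightarrow> star y * y"
        "(\<lambda>n. ?x * (?F c n * ?F c n) * ?x) \<longlonglongrightarrow> y * star y"
        using polar[OF c, of ?x] dc by (auto simp: x)
      have "?x * (?F c n * ?F c n) * ?x \<preceq> upow d r" for n
      proof -
        \<comment> \<open>The root of \<open>d\<close> is split as \<open>1/2 = r/2 + ?p\<close>: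
          the inner power \<open>?p\<close> forms a contraction with \<open>?F c n\<close>, and the
          outer powers \<open>r/2\<close> leave \<open>upow d r\<close>.\<close>
        let ?p = "(1 - r)/2"
        have p: "0 < ?p" "?p \<le> 1/2" "r/2 + ?p = 1/2" "?p + r/2 = 1/2" using r by (auto simp: field_simps)
        let ?w = "upow d ?p * ?F c n"
        have s: "star (?F c n) = ?F c n" "star (upow d ?p) = upow d ?p" "star (upow d (r/2)) = upow d (r/2)"
          using star_shift_upow[OF c e] upow_star[OF d(1)] p r by auto
        have "norm ?w \<le> 1" using p by (intro upow_shift_contraction d c dc e) auto
        then have "norm (?w * star ?w) \<le> 1" unfolding norm_mult_star by (simp add: power_le_one)
        then have "?w * star ?w \<preceq> 1 *\<^sub>R 1" by (intro selfadjoint_le_norm) (simp_all add: star_mult mult.assoc)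
        then have "upow d (r/2) * (?w * star ?w) * upow d (r/2) \<preceq> upow d (r/2) * (1 *\<^sub>R 1) * upow d (r/2)"
          by (intro conj_mono_sa s)
        moreover have "upow d (r/2) * (?w * star ?w) * upow d (r/2) =
            (upow d (r/2) * upow d ?p) * (?F c n * ?F c n) * (upow d ?p * upow d (r/2))"
          by (simp only: star_mult s mult.assoc)
        moreover have "\<dots> = ?x * (?F c n * ?F c n) * ?x"
          using p r by (simp only: upow_mult[OF d(1)] half_gt_zero)
        moreover have "upow d (r/2) * upow d (r/2) = upow d r" using r by (simp add: upow_mult[OF d(1)])
        ultimately show ?thesis by simp
      qed
      then have "y * star y \<preceq> upow d r"
        by (rule upos_le_limit[OF y(2) tendsto_const[of "upow d r"]])
      then have "y * star y \<in> M" by (rule MD(4)[OF mult_star_self_upos _ d(2)])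
      then show ?thesis using y(1) MD(6) by blast
    qed
    obtain u where u: "(\<lambda>n. ?F c n * a * ?F c n) \<longlonglongrightarrow> star u * u" "star u * u \<in> M"
      using part[OF a] b by (auto simp: c_def upos_le_def)
    obtain v where v: "(\<lambda>n. ?F c n * b * ?F c n) \<longlonglongrightarrow> star v * v" "star v * v \<in> M"
      using part[OF b] a by (auto simp: c_def upos_le_def)
    have "(\<lambda>n. ?F c n * a * ?F c n + ?F c n * b * ?F c n) \<longlonglongrightarrow> star u * u + star v * v"
      by (intro tendsto_add u v)
    moreover have "?F c n * a * ?F c n + ?F c n * b * ?F c n = ?F c n * c * ?F c n" for n
      by (simp add: c_def algebra_simps)
    ultimately have "(\<lambda>n. ?F c n * c * ?F c n) \<longlonglongrightarrow> star u * u + star v * v" by simp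
    moreover have "(\<lambda>n. ?F c n * c * ?F c n) \<longlonglongrightarrow> upow c r"
      using shift_upow_sandwich_tendsto[OF c r(1)] r(2) by simp
    ultimately have eq: "star u * u + star v * v = upow c r" by (rule LIMSEQ_unique)
    have "upow c r \<in> M" using MD(3)[OF u(2) v(2)] by (simp only: eq)
    then show "a + b \<in> upow_preimage r M" using c by (simp add: mem c_def)
  next
    fix a b assume "a \<in> upos" "b \<in> upow_preimage r M" "a \<preceq> b"
    then show "a \<in> upow_preimage r M"
      using upow_mono[of a b r] upow_upos[of a r] r MD(4) by (auto simp: mem)
  next
    fix x assume "star x * x \<in> upow_preimage r M"
    define h k where "h = star x * x" and "k = x * star x"
    have h: "h \<in> upos" "upow h r \<in> M" using \<open>star x * x \<in> upow_preimage r M\<close> by (auto simp: mem h_def)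
    have k: "k \<in> upos" by (simp add: k_def mult_star_self_upos)
    obtain y where y: "(\<lambda>n. ?F h n * h * ?F h n) \<longlonglongrightarrow> star y * y"
      "(\<lambda>n. x * (?F h n * ?F h n) * star x) \<longlonglongrightarrow> y * star y"
      using polar[OF h(1), of x] by (auto simp: h_def)
    have lim: "(\<lambda>n. ?F a n * a * ?F a n) \<longlonglongrightarrow> upow a r" if "a \<in> upos" for a
      using shift_upow_sandwich_tendsto[OF that r(1)] r(2) by simp
    have "star y * y = upow h r" using y(1) lim[OF h(1)] by (rule LIMSEQ_unique)
    then have "y * star y \<in> M" using h MD(5) by metis
    moreover have "x * (?F h n * ?F h n) * star x = ?F k n * k * ?F k n" for n
    proof -
      \<comment> \<open>Moving the power across \<open>x\<close> replaces \<open>h\<close> by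
        \<open>k\<close>, so that \<open>y * star y\<close> is the same sandwich limit for
        \<open>k\<close> as \<open>star y * y\<close> is for \<open>h\<close>.\<close>
      have xF: "x * ?F h n = ?F k n * x"
        unfolding shift_upow_def h_def k_def by (intro rcalc_intertwine continuous_on_shift_powr) simp
      have "x * (?F h n * ?F h n) * star x = (x * ?F h n) * star (x * ?F h n)"
        by (simp add: star_mult star_shift_upow[OF h(1)] mult.assoc)
      then show ?thesis unfolding xF star_mult star_shift_upow[OF k e] by (simp add: k_def mult.assoc)
    qed
    then have "y * star y = upow k r" using y(2) lim[OF k] LIMSEQ_unique by fastforce
    ultimately show "x * star x \<in> upow_preimage r M" using k by (simp add: mem k_def)
  qed
qed

theorem strong_order_ideal_upow_preimage:
  assumes M: "strong_order_ideal M" and r: "0 < r"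
  shows "strong_order_ideal (upow_preimage r M)"
proof -
  have pow: "strong_order_ideal (upow_preimage (2 ^ n) M)" for n :: nat
  proof (induction n)
    case (Suc n)
    then have "strong_order_ideal (upow_preimage 2 (upow_preimage (2 ^ n) M))"
      by (rule strong_order_ideal_upow_preimage_2)
    then show ?case by (simp add: upow_preimage_mult)
  qed (simp add: upow_preimage_one M)
  obtain n :: nat where "r < 2 ^ n" using real_arch_pow[of 2 r] by auto
  then have "strong_order_ideal (upow_preimage (r / 2 ^ n) (upow_preimage (2 ^ n) M))"
    using r by (intro strong_order_ideal_upow_preimage_less_1 pow) auto
  then show ?thesis using r by (simp add: upow_preimage_mult)
qed

section \<open>Dixmier ideals\<close>

text \<open>Monotonicity reaches only the middle of a sandwich, so the two factors are enlarged one
  at a time: first \<open>b\<close> to \<open>c\<close> between two powers of \<open>c\<close>; then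
  strong invariance brings the other power of \<open>c\<close> into the middle, where it dominates
  that of \<open>a\<close>.\<close>

lemma strong_order_ideal_product:
  assumes L: "strong_order_ideal L" and a: "a \<in> L" and b: "b \<in> L"
    and st: "0 < s" "0 < t" "s + t = 1/2"
  shows "star (upow a s * upow b t) * (upow a s * upow b t) \<in> L"
proof -
  note LD = strong_order_idealD[OF L]
  define c where "c = a + b"
  have pos: "a \<in> upos" "b \<in> upos" "c \<in> upos" "c \<in> L" using a b LD(1,3) by (auto simp: c_def)
  have ac: "a \<preceq> c" "b \<preceq> c" using pos by (auto simp: c_def upos_le_def)
  have sa: "star (upow a q) = upow a q" "star (upow b q) = upow b q" "star (upow c q) = upow c q"
    if "0 < q" for q using that pos upow_star by blast+
  have sq: "upow d q * upow d q = upow d (2 * q)" if "d \<in> upos" "0 < q" for d :: 'a and q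
    using upow_mult[OF that(1) that(2) that(2)] by (simp only: mult_2)
  have eq1: "star (upow d s * upow b t) * (upow d s * upow b t) = upow b t * upow d (2 * s) * upow b t"
    and eq2: "(upow d s * upow b t) * star (upow d s * upow b t) = upow d s * upow b (2 * t) * upow d s"
    if d: "d \<in> upos" for d
  proof -
    have "star (upow d s * upow b t) * (upow d s * upow b t) = upow b t * (upow d s * upow d s) * upow b t"
      "(upow d s * upow b t) * star (upow d s * upow b t) = upow d s * (upow b t * upow b t) * upow d s"
      using st by (simp_all only: star_mult sa upow_star[OF d] mult.assoc)
    then show "star (upow d s * upow b t) * (upow d s * upow b t) = upow b t * upow d (2 * s) * upow b t"
      "(upow d s * upow b t) * star (upow d s * upow b t) = upow d s * upow b (2 * t) * upow d s"
      using st by (simp_all only: sq d pos)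
  qed
  have "upow c s * upow b (2 * t) * upow c s \<preceq> upow c s * upow c (2 * t) * upow c s"
    using st pos by (intro conj_mono_sa sa upow_mono ac) auto
  also have "\<dots> = c"
  proof -
    have eq: "s + 2 * t + s = 1" using st by simp
    have "upow c s * upow c (2 * t) * upow c s = upow c (s + 2 * t + s)"
      using st by (subst upow_mult[OF pos(3)], simp, simp, subst upow_mult[OF pos(3)]) auto
    then show ?thesis unfolding eq by (simp only: upow_one[OF pos(3)])
  qed
  finally have "(upow c s * upow b t) * star (upow c s * upow b t) \<in> L"
    unfolding eq2[OF pos(3)] by (rule LD(4)[rotated, OF _ pos(4)])
      (metis eq2 mult_star_self_upos pos(3))
  then have "upow b t * upow c (2 * s) * upow b t \<in> L"
    unfolding eq1[OF pos(3), symmetric] by (rule LD(6))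
  moreover have "upow b t * upow a (2 * s) * upow b t \<preceq> upow b t * upow c (2 * s) * upow b t"
    using st pos by (intro conj_mono_sa sa upow_mono ac) auto
  ultimately show ?thesis
    unfolding eq1[OF pos(1), symmetric] by (intro LD(4)[OF star_mult_self_upos])
qed

section \<open>Passage between the algebra and its unitization\<close>

lemma embed_upos_iff: "embed a \<in> upos \<longleftrightarrow> a \<in> cstar_pos"
  by (simp add: upos_def cstar_pos_def spec_embed embed_simps)

lemma embed_le_iff: "embed a \<preceq> embed b \<longleftrightarrow> cstar_le a b"
  by (simp add: upos_le_def cstar_le_def embed_simps embed_upos_iff)

lemma embed_cstar_powr:
  assumes a: "a \<in> cstar_pos" and s: "0 < s"
  shows "embed (cstar_powr a s) = upow (embed a) s"
proof -
  have "embed a \<in> upos" using a by (simp add: embed_upos_iff)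
  then have "(\<lambda>z. complex_of_real (Re z powr s)) \<in> cfc_dom a"
    using continuous_on_spec_rcalc[OF _ continuous_on_powr_nonneg[OF s]] by (simp add: cfc_dom_def flip: spec_embed)
  moreover have "star a = a" using a by (simp add: cstar_pos_def)
  ultimately show ?thesis by (simp add: cstar_powr_def embed_cfc upow_def rcalc_def)
qed

lemma cstar_powr_pos: "a \<in> cstar_pos \<Longrightarrow> 0 < s \<Longrightarrow> cstar_powr a s \<in> cstar_pos"
  by (simp add: embed_upos_iff[symmetric] embed_cstar_powr upow_upos)

lemma cstar_powr_star: "a \<in> cstar_pos \<Longrightarrow> 0 < s \<Longrightarrow> star (cstar_powr a s) = cstar_powr a s"
  using cstar_powr_pos by (auto simp: cstar_pos_def)

lemma cstar_powr_mult:
  assumes "a \<in> cstar_pos" "0 < s" "0 < t"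
  shows "cstar_powr a s * cstar_powr a t = cstar_powr a (s + t)"
proof -
  have "embed (cstar_powr a s * cstar_powr a t) = embed (cstar_powr a (s + t))"
    using assms by (simp add: embed_simps(4)[symmetric] embed_cstar_powr embed_upos_iff upow_mult)
  then show ?thesis by simp
qed

lemma cstar_powr_powr:
  assumes "a \<in> cstar_pos" "0 < s" "0 < t"
  shows "cstar_powr (cstar_powr a s) t = cstar_powr a (s * t)"
proof -
  have "embed (cstar_powr (cstar_powr a s) t) = embed (cstar_powr a (s * t))"
    using assms by (simp add: embed_cstar_powr cstar_powr_pos embed_upos_iff upow_upow)
  then show ?thesis by simp
qed

lemma cstar_powr_one: "a \<in> cstar_pos \<Longrightarrow> cstar_powr a 1 = a"
  using embed_cstar_powr[of a 1] by (simp add: upow_one embed_upos_iff)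

lemma cstar_pos_zero: "0 \<in> cstar_pos"
  using embed_upos_iff[of 0] by (simp add: embed_simps(1))

lemma cstar_pos_add: "a \<in> cstar_pos \<Longrightarrow> b \<in> cstar_pos \<Longrightarrow> a + b \<in> cstar_pos"
  using upos_add[of "embed a" "embed b"] by (simp add: embed_simps embed_upos_iff)

lemma embed_scaleR: "embed (r *\<^sub>R a) = r *\<^sub>R embed a"
  by (simp add: scaleR_unitization_def)

lemma cstar_pos_scaleR: "a \<in> cstar_pos \<Longrightarrow> 0 \<le> r \<Longrightarrow> r *\<^sub>R a \<in> cstar_pos"
  using upos_scaleR[of "embed a" r] by (simp add: embed_upos_iff flip: embed_scaleR)

lemma cstar_pos_star_mult: "star a * a \<in> cstar_pos"
  using star_mult_self_upos[of "embed a"] by (simp add: embed_simps embed_upos_iff)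

text \<open>A character maps a square of a selfadjoint element to a nonnegative number. This forces
  \<open>scalar_part u = 0\<close> for positive \<open>u\<close> below an element of the
  algebra.\<close>

lemma scalar_part_upos:
  assumes "u \<in> upos"
  shows "0 \<le> Re (scalar_part u)" "Im (scalar_part u) = 0"
proof -
  define s where "s = upow u (1/2)"
  have "star s = s" "s * s = u" using assms by (simp_all add: s_def upow_star upow_half_mult)
  then have "cnj (scalar_part s) * scalar_part s = scalar_part u" by (metis star_unitization_sel(2) unitization_sel(12))
  then show "0 \<le> Re (scalar_part u)" "Im (scalar_part u) = 0"
    by (auto simp: mult.commute[of "cnj _"] complex_mult_cnj simp flip: \<open>_ = scalar_part u\<close>)
qed

lemma embed_alg_part: "scalar_part u = 0 \<Longrightarrow> u = embed (alg_part u)"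
  by (auto intro: unitization_eqI)

lemma scalar_part_star_mult_eq_0: "scalar_part (star u * u) = 0 \<Longrightarrow> scalar_part u = 0"
  by simp

text \<open>Heredity and strong invariance now quantify over the larger algebra, but an element
  dominated by one of \<open>M\<close>, or with \<open>star u * u\<close> in \<open>M\<close>, has
  scalar part \<open>0\<close> and comes from the algebra.\<close>

lemma strong_order_ideal_embed:
  assumes oi: "order_ideal M" and si: "strongly_invariant M"
  shows "strong_order_ideal (embed ` M)"
  unfolding strong_order_ideal_def
proof (intro conjI ballI allI impI)
  show "embed ` M \<subseteq> upos" using oi by (auto simp: embed_upos_iff order_ideal_def)
  show "0 \<in> embed ` M" using oi embed_simps(1) by (metis image_eqI order_ideal_def)
  show "u + v \<in> embed ` M" if "u \<in> embed ` M" "v \<in> embed ` M" for u v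
    using that oi by (auto simp: embed_simps order_ideal_def)
next
  fix u v assume u: "u \<in> upos" and "v \<in> embed ` M" and le: "u \<preceq> v"
  then obtain m where m: "v = embed m" "m \<in> M" by blast
  have "scalar_part u = 0"
    using scalar_part_upos[OF u] scalar_part_upos[of "v - u"] le
    by (simp add: m(1) upos_le_def complex_eq_iff)
  then have eq: "u = embed (alg_part u)" by (rule embed_alg_part)
  have "alg_part u \<in> cstar_pos" using u eq embed_upos_iff by metis
  moreover have "cstar_le (alg_part u) m" using le eq m embed_le_iff by metis
  moreover have "m \<in> cstar_pos" using m oi by (auto simp: order_ideal_def)
  ultimately have "alg_part u \<in> M" using oi m by (auto simp: order_ideal_def)
  then show "u \<in> embed ` M" using eq by blast
next
  fix u assume u: "star u * u \<in> embed ` M"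
  then obtain m where "star u * u = embed m" by blast
  then have "scalar_part (star u * u) = 0" by (simp only: unitization.sel)
  then have eq: "u = embed (alg_part u)" by (rule embed_alg_part[OF scalar_part_star_mult_eq_0])
  have "star u * u = embed (star (alg_part u) * alg_part u)"
    "u * star u = embed (alg_part u * star (alg_part u))"
    by (subst (1 2) eq, simp add: embed_simps)+
  then show "u * star u \<in> embed ` M" using u si by (auto simp: strongly_invariant_def)
qed

lemma strong_order_ideal_vimage_embed:
  assumes K: "strong_order_ideal K"
  shows "order_ideal (embed -` K)" "strongly_invariant (embed -` K)"
proof -
  note KD = strong_order_idealD[OF K]
  show "order_ideal (embed -` K)"
    unfolding order_ideal_def vimage_def mem_Collect_eq
  proof (intro conjI ballI impI subsetI)
    show "embed 0 \<in> K" using KD(2) by (simp add: embed_simps)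
    show "embed (a + b) \<in> K" if "a \<in> {x. embed x \<in> K}" "b \<in> {x. embed x \<in> K}" for a b
      using that KD(3)[of "embed a" "embed b"] by (simp add: embed_simps)
    show "embed a \<in> K" if "a \<in> cstar_pos" "cstar_le a b" "embed b \<in> K" for a b
      using that KD(4)[of "embed a" "embed b"] by (simp add: embed_upos_iff embed_le_iff)
  qed (use KD(1) embed_upos_iff in blast)
  show "strongly_invariant (embed -` K)"
    using KD(5,6)[of "embed x" for x] by (auto simp: strongly_invariant_def embed_simps)
qed

text \<open>On positive elements the powers with exponents \<open>s\<close> and \<open>1/s\<close>
  are inverse to each other.\<close>

lemma cstar_powr_image:
  assumes M: "M \<subseteq> cstar_pos" and s: "0 < s"
  shows "(\<lambda>a. cstar_powr a s) ` M = embed -` upow_preimage (1/s) (embed ` M)"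
proof (intro equalityI subsetI)
  fix b assume "b \<in> (\<lambda>a. cstar_powr a s) ` M"
  then obtain a where a: "a \<in> M" "b = cstar_powr a s" "a \<in> cstar_pos" using M by blast
  then have "upow (embed b) (1/s) = embed a"
    using s by (simp add: embed_cstar_powr embed_upos_iff upow_upow upow_one)
  then show "b \<in> embed -` upow_preimage (1/s) (embed ` M)"
    using a s by (auto simp: upow_preimage_def embed_upos_iff cstar_powr_pos)
next
  fix b assume "b \<in> embed -` upow_preimage (1/s) (embed ` M)"
  then obtain m where b: "b \<in> cstar_pos" and m: "m \<in> M" "upow (embed b) (1/s) = embed m"
    by (auto simp: upow_preimage_def embed_upos_iff)
  have "embed (cstar_powr m s) = upow (upow (embed b) (1/s)) s"
    using m M s by (auto simp: embed_cstar_powr)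
  also have "\<dots> = embed b" using b s by (simp add: upow_upow upow_one embed_upos_iff)
  finally show "b \<in> (\<lambda>a. cstar_powr a s) ` M" using m(1) by (metis imageI unitization.inject)
qed

lemma order_ideal_cstar_powr:
  assumes "order_ideal M" "strongly_invariant M" "0 < s"
  shows "order_ideal ((\<lambda>a. cstar_powr a s) ` M)" "strongly_invariant ((\<lambda>a. cstar_powr a s) ` M)"
proof -
  have "M \<subseteq> cstar_pos" using assms by (simp add: order_ideal_def)
  then have "(\<lambda>a. cstar_powr a s) ` M = embed -` upow_preimage (1/s) (embed ` M)"
    using assms by (intro cstar_powr_image)
  moreover have "strong_order_ideal (upow_preimage (1/s) (embed ` M))"
    using assms by (intro strong_order_ideal_upow_preimage strong_order_ideal_embed) auto
  ultimately show "order_ideal ((\<lambda>a. cstar_powr a s) ` M)" "strongly_invariant ((\<lambda>a. cstar_powr a s) ` M)"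
    by (simp_all add: strong_order_ideal_vimage_embed)
qed

section \<open>Ideals spanned by strongly invariant order ideals\<close>

context
  fixes M :: "'a::cstar_algebra set"
  assumes oi: "order_ideal M" and si: "strongly_invariant M"
begin

text \<open>Integer multiples come from additivity, and heredity fills the gaps between
  them.\<close>

lemma order_ideal_scaleR:
  assumes a: "a \<in> M" and r: "0 \<le> r"
  shows "r *\<^sub>R a \<in> M"
proof -
  have nat: "real n *\<^sub>R a \<in> M" for n
    using a oi by (induction n) (auto simp: order_ideal_def scaleR_left_distrib)
  obtain n where n: "r \<le> real n" using real_arch_simple by blast
  have "a \<in> cstar_pos" using a oi by (auto simp: order_ideal_def)
  then have "r *\<^sub>R a \<in> cstar_pos" "cstar_le (r *\<^sub>R a) (real n *\<^sub>R a)"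
    using n r by (auto simp: cstar_le_def cstar_pos_scaleR simp flip: scaleR_left_diff_distrib)
  then show ?thesis using nat[of n] oi by (auto simp: order_ideal_def)
qed

lemma order_ideal_le: "a \<in> cstar_pos \<Longrightarrow> cstar_le a b \<Longrightarrow> b \<in> M \<Longrightarrow> a \<in> M"
  using oi by (auto simp: order_ideal_def)

text \<open>The elements \<open>x\<close> with \<open>star x * x \<in> M\<close> are to
  \<open>M\<close> as the Hilbert-Schmidt operators are to the positive trace class operators: they
  form a two-sided ideal closed under \<open>star\<close>, and products of two of them lie in the
  span of \<open>M\<close>.\<close>

lemma half_ideal_add:
  assumes "star x * x \<in> M" "star y * y \<in> M"
  shows "star (x + y) * (x + y) \<in> M"
proof (rule order_ideal_le[OF cstar_pos_star_mult])
  have "2 *\<^sub>R (star x * x + star y * y) - star (x + y) * (x + y) = star (x - y) * (x - y)"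
    by (simp add: algebra_simps scaleR_2)
  then show "cstar_le (star (x + y) * (x + y)) (2 *\<^sub>R (star x * x + star y * y))"
    unfolding cstar_le_def by (simp only: cstar_pos_star_mult)
  show "2 *\<^sub>R (star x * x + star y * y) \<in> M"
    using assms oi by (intro order_ideal_scaleR) (auto simp: order_ideal_def)
qed

lemma half_ideal_scaleC:
  assumes "star x * x \<in> M"
  shows "star (c *\<^sub>C x) * (c *\<^sub>C x) \<in> M"
proof -
  have "star (c *\<^sub>C x) * (c *\<^sub>C x) = (cmod c)\<^sup>2 *\<^sub>R (star x * x)"
    by (simp add: star_scaleC mult_scaleC_left mult_scaleC_right scaleC_scaleC scaleR_scaleC
        complex_norm_square mult.commute del: of_real_power)
  then show ?thesis using assms order_ideal_scaleR by simp
qed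

lemma half_ideal_star: "star x * x \<in> M \<Longrightarrow> star (star x) * star x \<in> M"
  using si by (simp add: strongly_invariant_def)

lemma half_ideal_mult_left:
  assumes "star x * x \<in> M"
  shows "star (a * x) * (a * x) \<in> M"
proof (rule order_ideal_le[OF cstar_pos_star_mult])
  let ?a = "embed a" and ?x = "embed x"
  have "star ?a * ?a \<preceq> (norm a)\<^sup>2 *\<^sub>R 1"
    by (rule selfadjoint_le_norm) (simp_all add: star_mult cstar_identity)
  then have "star ?x * (star ?a * ?a) * ?x \<preceq> star ?x * ((norm a)\<^sup>2 *\<^sub>R 1) * ?x" by (rule conj_mono)
  then have "embed (star (a * x) * (a * x)) \<preceq> embed ((norm a)\<^sup>2 *\<^sub>R (star x * x))"
    by (simp add: embed_simps embed_scaleR star_mult mult.assoc flip: embed_simps(4))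
  then show "cstar_le (star (a * x) * (a * x)) ((norm a)\<^sup>2 *\<^sub>R (star x * x))"
    by (simp only: embed_le_iff)
  show "(norm a)\<^sup>2 *\<^sub>R (star x * x) \<in> M" using assms by (intro order_ideal_scaleR) auto
qed

text \<open>Polarisation: combining the values of \<open>S c\<close> at the four roots of unity
  \<open>c\<close> isolates \<open>star x * y\<close>, and each of these values lies in
  \<open>M\<close>.\<close>

lemma half_ideal_product:
  assumes x: "star x * x \<in> M" and y: "star y * y \<in> M"
  shows "star x * y \<in> complex_vector.span M"
proof -
  define S where "S c = star (x + c *\<^sub>C y) * (x + c *\<^sub>C y)" for c
  have S: "S c \<in> complex_vector.span M" for c
    unfolding S_def by (intro complex_vector.span_base half_ideal_add half_ideal_scaleC x y)
  have "star x * y = (1/4) *\<^sub>C (S 1 - S (- 1) - \<i> *\<^sub>C S \<i> + \<i> *\<^sub>C S (- \<i>))"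
  proof -
    have four: "z + z + z + z = 4 *\<^sub>C z" for z :: 'a
    proof -
      have "(1 + 1 + 1 + 1) *\<^sub>C z = z + z + z + z" by (simp only: scaleC_add_left complex_vector.scale_one)
      then show ?thesis by simp
    qed
    have "S 1 - S (- 1) - \<i> *\<^sub>C S \<i> + \<i> *\<^sub>C S (- \<i>) = 4 *\<^sub>C (star x * y)"
      by (simp add: S_def star_scaleC mult_scaleC_left mult_scaleC_right scaleC_scaleC algebra_simps
          scaleC_add_right complex_vector.scale_right_diff_distrib complex_vector.scale_minus_left)
        (simp add: four flip: add.assoc)
    then show ?thesis by (simp add: scaleC_scaleC)
  qed
  then show ?thesis
    using S by (simp add: complex_vector.span_add complex_vector.span_diff complex_vector.span_scale)
qed

text \<open>Each \<open>m \<in> M\<close> is \<open>q * q\<close> with \<open>q\<close> selfadjoint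
  in the half ideal, so \<open>a * m = (a * q) * q\<close> is a product of two elements of the half
  ideal; likewise on the right.\<close>

lemma cstar_ideal_span: "cstar_ideal (complex_vector.span M)"
proof -
  let ?S = "complex_vector.span M"
  have gen: "a * m \<in> ?S" "m * a \<in> ?S" if m: "m \<in> M" for a m
  proof -
    define q where "q = cstar_powr m (1/2)"
    have mp: "m \<in> cstar_pos" using m oi by (auto simp: order_ideal_def)
    have q: "star q = q" "q * q = m"
      using mp cstar_powr_mult[OF mp, of "1/2" "1/2"] by (simp_all add: q_def cstar_powr_star cstar_powr_one)
    have Nq: "star q * q \<in> M" using q m by simp
    have N: "star (star (b * q)) * star (b * q) \<in> M" for b
      by (intro half_ideal_star half_ideal_mult_left Nq)
    have "star (star (a * q)) * q \<in> ?S" using half_ideal_product[OF N Nq] .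
    then show "a * m \<in> ?S" by (simp add: q(2)[symmetric] mult.assoc)
    have "star q * star (star a * q) \<in> ?S" using half_ideal_product[OF Nq N] .
    then show "m * a \<in> ?S" by (simp add: q(1) q(2)[symmetric] star_mult mult.assoc)
  qed
  have "?S \<subseteq> {x. a * x \<in> ?S \<and> x * a \<in> ?S}" for a
  proof (rule complex_vector.span_minimal)
    show "complex_vector.subspace {x. a * x \<in> ?S \<and> x * a \<in> ?S}"
      unfolding complex_vector.subspace_def
      by (auto simp: algebra_simps mult_scaleC_left mult_scaleC_right
          intro: complex_vector.span_add complex_vector.span_scale complex_vector.span_zero)
  qed (use gen in auto)
  then show ?thesis
    unfolding cstar_ideal_def add_subgroup_def
    by (auto intro: complex_vector.span_add complex_vector.span_neg complex_vector.span_zero)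
qed

text \<open>All multiples by \<open>c\<close> are part of the claim, so that it survives complex
  scaling in the span; \<open>c = 1\<close> then bounds twice a positive element of the span by an
  element of \<open>M\<close>.\<close>

lemma span_dominated:
  assumes "x \<in> complex_vector.span M"
  shows "\<exists>m\<in>M. cstar_le (c *\<^sub>C x + star (c *\<^sub>C x)) m"
proof -
  have "complex_vector.span M \<subseteq> {x. \<forall>c. \<exists>m\<in>M. cstar_le (c *\<^sub>C x + star (c *\<^sub>C x)) m}"
  proof (rule complex_vector.span_minimal)
    show "complex_vector.subspace {x. \<forall>c. \<exists>m\<in>M. cstar_le (c *\<^sub>C x + star (c *\<^sub>C x)) m}"
      unfolding complex_vector.subspace_def Ball_def mem_Collect_eq
    proof (intro conjI allI ballI impI)
      have z: "0 \<in> M" using oi by (simp add: order_ideal_def)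
      show "\<exists>m\<in>M. cstar_le (c *\<^sub>C 0 + star (c *\<^sub>C 0)) m" for c
        by (rule bexI[OF _ z]) (simp add: cstar_le_def cstar_pos_zero)
      fix x :: 'a and c d assume x: "\<forall>c. \<exists>m\<in>M. cstar_le (c *\<^sub>C x + star (c *\<^sub>C x)) m"
      then show "\<exists>m\<in>M. cstar_le (c *\<^sub>C d *\<^sub>C x + star (c *\<^sub>C d *\<^sub>C x)) m"
        by (simp only: scaleC_scaleC)
      fix y assume y: "\<forall>c. \<exists>m\<in>M. cstar_le (c *\<^sub>C y + star (c *\<^sub>C y)) m"
      obtain m n where mn: "m \<in> M" "n \<in> M" "cstar_le (c *\<^sub>C x + star (c *\<^sub>C x)) m"
        "cstar_le (c *\<^sub>C y + star (c *\<^sub>C y)) n" using x y by blast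
      have "m + n \<in> M" using mn oi by (auto simp: order_ideal_def)
      moreover have "cstar_le (c *\<^sub>C (x + y) + star (c *\<^sub>C (x + y))) (m + n)"
        using cstar_pos_add[OF mn(3,4)[unfolded cstar_le_def]]
        by (simp add: cstar_le_def scaleC_add_right algebra_simps)
      ultimately show "\<exists>m\<in>M. cstar_le (c *\<^sub>C (x + y) + star (c *\<^sub>C (x + y))) m" by blast
    qed
    show "M \<subseteq> {x. \<forall>c. \<exists>m\<in>M. cstar_le (c *\<^sub>C x + star (c *\<^sub>C x)) m}"
    proof (intro subsetI CollectI allI)
      fix x and c assume x: "x \<in> M"
      then have xp: "x \<in> cstar_pos" using oi by (auto simp: order_ideal_def)
      then have "c *\<^sub>C x + star (c *\<^sub>C x) = (2 * Re c) *\<^sub>R x"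
        by (simp add: cstar_pos_def star_scaleC scaleR_scaleC complex_vector.scale_left_distrib[symmetric] complex_add_cnj)
      then have "(2 * cmod c) *\<^sub>R x - (c *\<^sub>C x + star (c *\<^sub>C x)) = (2 * cmod c - 2 * Re c) *\<^sub>R x"
        by (simp add: scaleR_left_diff_distrib)
      then have "cstar_le (c *\<^sub>C x + star (c *\<^sub>C x)) ((2 * cmod c) *\<^sub>R x)"
        unfolding cstar_le_def using xp complex_Re_le_cmod[of c] by (simp add: cstar_pos_scaleR)
      then show "\<exists>m\<in>M. cstar_le (c *\<^sub>C x + star (c *\<^sub>C x)) m"
        using order_ideal_scaleR[OF x, of "2 * cmod c"] by auto
    qed
  qed
  with assms show ?thesis by blast
qed

lemma pos_part_span: "pos_part (complex_vector.span M) = M"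
proof
  show "M \<subseteq> pos_part (complex_vector.span M)"
    using oi by (auto simp: pos_part_def order_ideal_def intro: complex_vector.span_base)
  show "pos_part (complex_vector.span M) \<subseteq> M"
  proof
    fix b assume "b \<in> pos_part (complex_vector.span M)"
    then have b: "b \<in> complex_vector.span M" "b \<in> cstar_pos" by (auto simp: pos_part_def)
    then obtain m where m: "m \<in> M" "cstar_le (b + b) m"
      using span_dominated[OF b(1), of 1] by (auto simp: cstar_pos_def)
    have "m - b = (m - (b + b)) + b" by simp
    then have "cstar_le b m" using m(2) b(2) cstar_pos_add unfolding cstar_le_def by metis
    with m b show "b \<in> M" using order_ideal_le by blast
  qed
qed

lemma dixmier_ideal_span: "dixmier_ideal (complex_vector.span M)"
  unfolding dixmier_ideal_def pos_part_span using cstar_ideal_span oi si by simp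

end

text \<open>\<open>w\<close> need not be positive, so \<open>polar_factor\<close> cuts it into two
  factors of the half ideal of \<open>?K\<close>: both are controlled by
  \<open>cstar_powr h (1/2)\<close>, and \<open>h \<in> L\<close> by
  \<open>strong_order_ideal_product\<close>.\<close>

lemma powr_product_mem_span:
  assumes oi: "order_ideal L" and si: "strongly_invariant L"
    and a: "a \<in> L" and b: "b \<in> L" and st: "0 < s" "0 < t" "s + t = 1/2"
  shows "cstar_powr a s * cstar_powr b t \<in> complex_vector.span ((\<lambda>a. cstar_powr a (1/2)) ` L)"
proof -
  let ?K = "(\<lambda>a. cstar_powr a (1/2)) ` L"
  define w where "w = cstar_powr a s * cstar_powr b t"
  define h where "h = star w * w"
  have hp: "h \<in> cstar_pos" by (simp add: h_def cstar_pos_star_mult)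
  have ab: "a \<in> cstar_pos" "b \<in> cstar_pos" using a b oi by (auto simp: order_ideal_def)
  have eh: "embed h = star (embed w) * embed w" by (simp add: h_def embed_simps)
  have "embed w = upow (embed a) s * upow (embed b) t"
    using ab st by (simp add: w_def embed_simps(4)[symmetric] embed_cstar_powr)
  then have "embed h \<in> embed ` L"
    unfolding eh using a b st by (auto intro!: strong_order_ideal_product strong_order_ideal_embed oi si)
  then have hL: "h \<in> L" by auto
  obtain v where v: "embed w = v * upow (embed h) (1/4)" "star v * v = upow (embed h) (1/2)"
    using polar_factor[of "embed w"] unfolding eh by blast
  have pw: "upow (embed h) (1/4) = embed (cstar_powr h (1/4))" "upow (embed h) (1/2) = embed (cstar_powr h (1/2))"
    using hp by (simp_all add: embed_cstar_powr)
  \<comment> \<open>\<open>v\<close> is found in the unitization, but \<open>star v * v\<close> lies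
    in the algebra, hence so does \<open>v\<close>.\<close>
  have "scalar_part v = 0" by (rule scalar_part_star_mult_eq_0) (simp only: v(2) pw unitization.sel)
  then obtain v' where v': "v = embed v'" using embed_alg_part by blast
  have w: "w = v' * cstar_powr h (1/4)" and vv: "star v' * v' = cstar_powr h (1/2)"
    using v unfolding pw v' by (simp_all add: embed_simps)
  note K = order_ideal_cstar_powr[OF oi si, of "1/2", simplified]
  have hK: "cstar_powr h (1/2) \<in> ?K" using hL by blast
  have "star (star v') * star v' \<in> ?K" using vv hK by (intro half_ideal_star[OF K]) simp
  moreover have "star (cstar_powr h (1/4)) * cstar_powr h (1/4) \<in> ?K"
    using hK hp by (simp add: cstar_powr_star cstar_powr_mult)
  ultimately have "star (star v') * cstar_powr h (1/4) \<in> complex_vector.span ?K"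
    by (rule half_ideal_product[OF K])
  then show ?thesis by (simp add: w w_def[symmetric])
qed

section \<open>Multiplicativity and products of the powers of an ideal\<close>

lemma powr_image_powr_image:
  assumes "M \<subseteq> cstar_pos" "0 < s" "0 < t"
  shows "(\<lambda>a. cstar_powr a t) ` (\<lambda>a. cstar_powr a s) ` M = (\<lambda>a. cstar_powr a (s * t)) ` M"
  unfolding image_image using assms by (intro image_cong) (auto simp: cstar_powr_powr)

lemma add_subgroup_hull: "add_subgroup (add_subgroup hull S)"
  by (rule hull_in) (auto simp: add_subgroup_def)

lemma ideal_prod_ideal_powr:
  assumes J: "dixmier_ideal J" and st: "0 < s" "0 < t"
  shows "ideal_prod (ideal_powr J s) (ideal_powr J t) = ideal_powr J (s + t)"
proof
  let ?M = "pos_part J"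
  have oi: "order_ideal ?M" and si: "strongly_invariant ?M" using J by (auto simp: dixmier_ideal_def)
  have Mp: "?M \<subseteq> cstar_pos" by (auto simp: pos_part_def)
  let ?S = "ideal_powr J (s + t)"
  have S: "complex_vector.subspace ?S" unfolding ideal_powr_def by (rule complex_vector.subspace_span)
  note SD = complex_vector.subspace_0[OF S] complex_vector.subspace_add[OF S]
    complex_vector.subspace_neg[OF S] complex_vector.subspace_scale[OF S]
  have gen: "cstar_powr a s * cstar_powr b t \<in> ?S" if ab: "a \<in> ?M" "b \<in> ?M" for a b
  proof -
    \<comment> \<open>Relative to the powers with exponent \<open>l\<close>, the exponents
      \<open>s/l\<close> and \<open>t/l\<close> add up to \<open>1/2\<close>, and the square roots
      of these powers are the powers with exponent \<open>s + t\<close>.\<close>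
    define l where "l = 2 * (s + t)"
    have l: "0 < l" "l * (s/l) = s" "l * (t/l) = t" "s/l + t/l = 1/2" "l * (1/2) = s + t"
      using st by (auto simp: l_def simp flip: add_divide_distrib)
    let ?L = "(\<lambda>a. cstar_powr a l) ` ?M"
    note L = order_ideal_cstar_powr[OF oi si l(1)]
    have "cstar_powr (cstar_powr a l) (s/l) * cstar_powr (cstar_powr b l) (t/l)
        \<in> complex_vector.span ((\<lambda>a. cstar_powr a (1/2)) ` ?L)"
      using ab st l by (intro powr_product_mem_span L) auto
    also have "(\<lambda>a. cstar_powr a (1/2)) ` ?L = (\<lambda>a. cstar_powr a (s + t)) ` ?M"
      using powr_image_powr_image[OF Mp l(1), of "1/2"] unfolding l(5) by simp
    finally have "cstar_powr (cstar_powr a l) (s/l) * cstar_powr (cstar_powr b l) (t/l) \<in> ?S"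
      by (simp only: ideal_powr_def)
    moreover have "a \<in> cstar_pos" "b \<in> cstar_pos" "0 < s/l" "0 < t/l" using ab Mp st l(1) by auto
    ultimately show ?thesis using l(1) by (simp only: cstar_powr_powr l(2,3))
  qed
  have left: "ideal_powr J s \<subseteq> {x. x * cstar_powr b t \<in> ?S}" if "b \<in> ?M" for b
    unfolding ideal_powr_def[of J s]
  proof (rule complex_vector.span_minimal)
    show "complex_vector.subspace {x. x * cstar_powr b t \<in> ?S}"
      unfolding complex_vector.subspace_def by (auto simp: distrib_right mult_scaleC_left SD)
  qed (use gen that in auto)
  have right: "ideal_powr J t \<subseteq> {y. x * y \<in> ?S}" if "x \<in> ideal_powr J s" for x
    unfolding ideal_powr_def[of J t]
  proof (rule complex_vector.span_minimal)
    show "complex_vector.subspace {y. x * y \<in> ?S}"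
      unfolding complex_vector.subspace_def by (auto simp: distrib_left mult_scaleC_right SD)
  qed (use left that in auto)
  show "ideal_prod (ideal_powr J s) (ideal_powr J t) \<subseteq> ?S"
    unfolding ideal_prod_def by (rule hull_minimal) (use right SD in \<open>auto simp: add_subgroup_def\<close>)
  let ?G = "{x * y |x y. x \<in> ideal_powr J s \<and> y \<in> ideal_powr J t}"
  let ?H = "ideal_prod (ideal_powr J s) (ideal_powr J t)"
  have H: "add_subgroup ?H" unfolding ideal_prod_def by (rule add_subgroup_hull)
  have GH: "?G \<subseteq> ?H" unfolding ideal_prod_def by (rule hull_subset)
  \<comment> \<open>\<open>ideal_prod\<close> is generated additively; scalars are absorbed by the
    left factor of each generator.\<close>
  have scale: "?H \<subseteq> {x. c *\<^sub>C x \<in> ?H}" for c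
    unfolding ideal_prod_def[of "ideal_powr J s"]
  proof (rule hull_minimal)
    show "?G \<subseteq> {x. c *\<^sub>C x \<in> add_subgroup hull ?G}"
    proof (intro subsetI CollectI)
      fix z assume "z \<in> ?G"
      then obtain x y where z: "z = x * y" "x \<in> ideal_powr J s" "y \<in> ideal_powr J t" by blast
      have "c *\<^sub>C x \<in> ideal_powr J s" using z unfolding ideal_powr_def by (intro complex_vector.span_scale)
      then have "(c *\<^sub>C x) * y \<in> ?G" using z by blast
      then show "c *\<^sub>C z \<in> add_subgroup hull ?G" unfolding z mult_scaleC_left by (rule hull_inc)
    qed
    show "add_subgroup {x. c *\<^sub>C x \<in> add_subgroup hull ?G}"
      using H unfolding ideal_prod_def by (auto simp: add_subgroup_def scaleC_add_right)
  qed
  have subsp: "complex_vector.subspace ?H"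
    using H scale unfolding complex_vector.subspace_def add_subgroup_def by blast
  show "?S \<subseteq> ?H"
    unfolding ideal_powr_def[of J "s + t"]
  proof (rule complex_vector.span_minimal[OF _ subsp], intro image_subsetI)
    fix a assume a: "a \<in> ?M"
    have "cstar_powr a s \<in> ideal_powr J s" "cstar_powr a t \<in> ideal_powr J t"
      using a by (auto simp: ideal_powr_def intro: complex_vector.span_base)
    then have "cstar_powr a s * cstar_powr a t \<in> ?H" using GH by blast
    moreover have "a \<in> cstar_pos" using a Mp by blast
    ultimately show "cstar_powr a (s + t) \<in> ?H" using st by (simp only: cstar_powr_mult)
  qed
qed

theorem theorem3p9:
  fixes I :: "'a::cstar_algebra set"
  assumes "dixmier_ideal I"
  shows "(\<forall>s>0. dixmier_ideal (ideal_powr I s) \<and>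
            pos_part (ideal_powr I s) = (\<lambda>a. cstar_powr a s) ` pos_part I) \<and>
         (\<forall>s>0. \<forall>t>0. ideal_powr (ideal_powr I s) t = ideal_powr I (s * t) \<and>
            ideal_powr I (s * t) = ideal_powr (ideal_powr I t) s) \<and>
         (\<forall>s>0. \<forall>t>0. ideal_prod (ideal_powr I s) (ideal_powr I t) = ideal_powr I (s + t)) \<and>
         (\<forall>s t. s \<ge> t \<and> t > 0 \<longrightarrow> ideal_powr I s \<subseteq> ideal_powr I t)"
proof -
  have oi: "order_ideal (pos_part I)" and si: "strongly_invariant (pos_part I)"
    using assms by (auto simp: dixmier_ideal_def)
  have Mp: "pos_part I \<subseteq> cstar_pos" by (auto simp: pos_part_def)
  have dix: "dixmier_ideal (ideal_powr I s)"
    and pos: "pos_part (ideal_powr I s) = (\<lambda>a. cstar_powr a s) ` pos_part I" if "0 < s" for s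
    unfolding ideal_powr_def
    using dixmier_ideal_span pos_part_span order_ideal_cstar_powr[OF oi si that] by blast+
  have pow: "ideal_powr (ideal_powr I s) t = ideal_powr I (s * t)" if "0 < s" "0 < t" for s t
    using that by (simp add: ideal_powr_def[of "ideal_powr I s"] ideal_powr_def[of I "s * t"] pos powr_image_powr_image[OF Mp])
  have prod: "ideal_prod (ideal_powr I s) (ideal_powr I t) = ideal_powr I (s + t)" if "0 < s" "0 < t" for s t
    using ideal_prod_ideal_powr[OF assms that] .
  have "ideal_powr I s \<subseteq> ideal_powr I t" if "t \<le> s" "0 < t" for s t
  proof (cases "s = t")
    case False
    \<comment> \<open>The exponent \<open>s - t\<close> is positive here, so it can be split off;
      the inclusion is then the ideal property of \<open>ideal_powr I t\<close>.\<close>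
    then have "ideal_powr I s = ideal_prod (ideal_powr I t) (ideal_powr I (s - t))"
      using prod[of t "s - t"] that by simp
    also have "\<dots> \<subseteq> ideal_powr I t"
      unfolding ideal_prod_def
      by (rule hull_minimal) (use dix[OF that(2)] in \<open>auto simp: dixmier_ideal_def cstar_ideal_def\<close>)
    finally show ?thesis .
  qed simp
  then show ?thesis
    using dix pos pow prod by (simp add: mult.commute)
qed

end
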